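(* Let $N\ge 1$ be an integer and $s\in(0,1)$. Let $\Omega\subset\mathbb{R}^N$ be a bounded domain such that for some $R>0$, $$B_R\subset\Omega\subset B_{2R},$$ and such that there exists $c_0>0$ with $$|\Omega_t|\le c_0R^{N-1}\quad\text{for all } t>0,$$ where $\Omega_t=\{x\in\Omega:\ \rho(x)=\mathrm{dist}(x,\partial\Omega)=t\}$ and $|\Omega_t|$ denotes its $(N-1)$-dimensional Hausdorff measure. Let $\{\lambda_{s,i}(\Omega)\}_{i\in\mathbb{N}}$ be the increasing sequence of eigenvalues (counted with multiplicity) of the Dirichlet problem $$(-\Delta)^s u=\lambda u\ \text{ in }\Omega,\qquad u=0\ \text{ in }\mathbb{R}^N\setminus\Omega.$$ Then there exists a constant $c_1>0$, independent of $k$, such that for every $k\in\mathbb{N}$, $k\geq 1$, $$\sum_{i=1}^k\lambda_{s,i}(\Omega)\le\frac{(2\pi)^{2s}N}{N+2s}\,(|B_1||\Omega|)^{-\frac{2s}{N}}\,k^{1+\frac{2s}{N}}+c_1k^{1+\frac{s}{N}}.$$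
   Context: $B_r$ is the open ball of radius $r$ centered at the origin of $\mathbb{R}^N$; $|B_1|$ and $|\Omega|$ denote Lebesgue measure. A domain is a nonempty connected open set. For $s\in(0,1)$, $(-\Delta)^s u(x)=c_{N,s}\lim_{\epsilon\to0^+}\int_{\mathbb{R}^N\setminus B_\epsilon(x)}\frac{u(x)-u(y)}{|x-y|^{N+2s}}\,dy$ with $c_{N,s}=2^{2s}\pi^{-\frac N2}s\frac{\Gamma(\frac{N+2s}{2})}{\Gamma(1-s)}$. Eigenvalues are understood in the weak sense. Let $\mathbb{H}^s_0(\Omega)$ be the space of measurable $u:\mathbb{R}^N\to\mathbb{R}$ with $u\equiv0$ in $\mathbb{R}^N\setminus\Omega$ and $\int_{\mathbb{R}^N}\int_{\mathbb{R}^N}\frac{|u(x)-u(y)|^2}{|x-y|^{N+2s}}\,dx\,dy<+\infty$; it is a Hilbert space with inner product $$\mathcal{E}_s(u,w)=\frac{c_{N,s}}{2}\int_{\mathbb{R}^N}\int_{\mathbb{R}^N}\frac{(u(x)-u(y))(w(x)-w(y))}{|x-y|^{N+2s}}\,dx\,dy.$$ A nonzero $u\in\mathbb{H}^s_0(\Omega)$ is an eigenfunction with eigenvalue $\lambda$ if $\mathcal{E}_s(u,w)=\lambda\int_\Omega uw\,dx$ for all $w\in\mathbb{H}^s_0(\Omega)$. It is known that the eigenvalues, repeated according to multiplicity, form a sequence $0<\lambda_{s,1}(\Omega)<\lambda_{s,2}(\Omega)\le\lambda_{s,3}(\Omega)\le\cdots\to+\infty$ with corresponding eigenfunctions $\phi_i$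 forming an orthonormal basis of $L^2(\Omega)$, and that $\lambda_{s,i}(\Omega)=\min\{\mathcal{E}_s(u,u): u\in\mathbb{H}^s_0(\Omega),\ \|u\|_{L^2(\Omega)}=1,\ \int_\Omega u\phi_j\,dx=0\text{ for } j=1,\dots,i-1\}$. *)

theory Defs
  imports "HOL-Analysis.Analysis"
begin

section \<open>Hausdorff measure of integer dimension\<close>

text \<open>
  Countable covers are sequences of bounded sets (\<open>diameter\<close> is a junk value on unbounded sets).
  In dimension \<open>0\<close> every nonempty set has weight \<open>1\<close>, because \<open>0 ^ 0 = 1\<close>, whereas the empty
  set must always have weight \<open>0\<close>; thus the \<open>0\<close>-dimensional measure is the counting measure.
  The factor \<open>unit_ball_vol\<close> gives the usual normalisation, which agrees with Lebesgue measure
  in full dimension.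
\<close>

definition hausdorff_weight :: "nat \<Rightarrow> 'a::metric_space set \<Rightarrow> ennreal" where
  "hausdorff_weight d C =
     (if C = {} then 0 else ennreal (unit_ball_vol (real d) * (diameter C / 2) ^ d))"

definition hausdorff_cover :: "real \<Rightarrow> 'a::metric_space set \<Rightarrow> (nat \<Rightarrow> 'a set) \<Rightarrow> bool" where
  "hausdorff_cover \<delta> S C \<longleftrightarrow>
     S \<subseteq> (\<Union>i. C i) \<and> (\<forall>i. bounded (C i) \<and> diameter (C i) \<le> \<delta>)"

definition hausdorff_measure :: "nat \<Rightarrow> 'a::metric_space set \<Rightarrow> ennreal" where
  "hausdorff_measure d S =
     (SUP \<delta>\<in>{0<..}. INF C\<in>{C. hausdorff_cover \<delta> S C}. \<Sum>i. hausdorff_weight d (C i))"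


section \<open>The weak Dirichlet eigenvalue problem for the fractional Laplacian\<close>

definition frac_const :: "nat \<Rightarrow> real \<Rightarrow> real" where
  "frac_const N s =
     2 powr (2 * s) * pi powr (- (real N / 2)) * s *
       Gamma ((real N + 2 * s) / 2) / Gamma (1 - s)"

text \<open>
  Elements of \<open>H0s s \<Omega>\<close> are genuine functions, not classes modulo null sets, and measurability is
  Lebesgue measurability. On the diagonal \<open>x = y\<close>, a null set, the integrands are \<open>0 / 0 = 0\<close>.
\<close>

definition H0s :: "real \<Rightarrow> (real ^ 'n) set \<Rightarrow> (real ^ 'n \<Rightarrow> real) set" where
  "H0s s \<Omega> =
     {u. u \<in> borel_measurable lebesgue \<and> (\<forall>x. x \<notin> \<Omega> \<longrightarrow> u x = 0) \<and>
         (\<integral>\<^sup>+ y. (\<integral>\<^sup>+ x.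
            ennreal (\<bar>u x - u y\<bar>\<^sup>2 / norm (x - y) powr (real CARD('n) + 2 * s))
          \<partial>lebesgue) \<partial>lebesgue) < \<infinity>}"

definition frac_form :: "real \<Rightarrow> (real ^ 'n \<Rightarrow> real) \<Rightarrow> (real ^ 'n \<Rightarrow> real) \<Rightarrow> real" where
  "frac_form s u w =
     frac_const CARD('n) s / 2 *
       (LINT y|lebesgue. LINT x|lebesgue.
          (u x - u y) * (w x - w y) / norm (x - y) powr (real CARD('n) + 2 * s))"

definition eigenspace ::
    "real \<Rightarrow> (real ^ 'n) set \<Rightarrow> real \<Rightarrow> (real ^ 'n \<Rightarrow> real) set" where
  "eigenspace s \<Omega> \<mu> =
     {u \<in> H0s s \<Omega>. \<forall>w\<in>H0s s \<Omega>. frac_form s u w = \<mu> * (LINT x:\<Omega>|lebesgue. u x * w x)}"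

definition eigenfunction ::
    "real \<Rightarrow> (real ^ 'n) set \<Rightarrow> real \<Rightarrow> (real ^ 'n \<Rightarrow> real) \<Rightarrow> bool" where
  "eigenfunction s \<Omega> \<mu> u \<longleftrightarrow> u \<in> eigenspace s \<Omega> \<mu> \<and> \<not> (AE x in lebesgue. u x = 0)"

definition eigenvalue :: "real \<Rightarrow> (real ^ 'n) set \<Rightarrow> real \<Rightarrow> bool" where
  "eigenvalue s \<Omega> \<mu> \<longleftrightarrow> (\<exists>u. eigenfunction s \<Omega> \<mu> u)"

text \<open>
  The multiplicity of \<open>\<mu>\<close> is the dimension of its eigenspace with functions identified when they
  agree almost everywhere: some \<open>m\<close> eigenspace members are linearly independent and span, both
  modulo null sets.
\<close>

definition has_multiplicity :: "real \<Rightarrow> (real ^ 'n) set \<Rightarrow> real \<Rightarrow> nat \<Rightarrow> bool" where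
  "has_multiplicity s \<Omega> \<mu> m \<longleftrightarrow>
     (\<exists>b :: nat \<Rightarrow> real ^ 'n \<Rightarrow> real.
        (\<forall>j<m. b j \<in> eigenspace s \<Omega> \<mu>) \<and>
        (\<forall>c :: nat \<Rightarrow> real. (AE x in lebesgue. (\<Sum>j<m. c j * b j x) = 0) \<longrightarrow> (\<forall>j<m. c j = 0)) \<and>
        (\<forall>u\<in>eigenspace s \<Omega> \<mu>. \<exists>c :: nat \<Rightarrow> real.
           AE x in lebesgue. u x = (\<Sum>j<m. c j * b j x)))"

text \<open>
  The nondecreasing enumeration \<open>lam 1 \<le> lam 2 \<le> \<dots>\<close> of all eigenvalues, each repeated according to its
  multiplicity. The enumeration starts at index \<open>1\<close>; \<open>lam 0\<close> is irrelevant.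
\<close>

definition eigenvalue_sequence :: "real \<Rightarrow> (real ^ 'n) set \<Rightarrow> (nat \<Rightarrow> real) \<Rightarrow> bool" where
  "eigenvalue_sequence s \<Omega> lam \<longleftrightarrow>
     mono_on {1..} lam \<and>
     (\<forall>i\<ge>1. eigenvalue s \<Omega> (lam i)) \<and>
     (\<forall>\<mu>. eigenvalue s \<Omega> \<mu> \<longrightarrow>
        finite {i. 1 \<le> i \<and> lam i = \<mu>} \<and>
        has_multiplicity s \<Omega> \<mu> (card {i. 1 \<le> i \<and> lam i = \<mu>}))"

end

theory Submission
  imports Defs "HOL-Probability.Characteristic_Functions"
begin

text \<open>
  Trial functions are the modulated cutoffs \<open>w(x) cos(\<xi>x)\<close> and \<open>w(x) sin(\<xi>x)\<close> with
  \<open>w = min(1, dist(x, \<Omega>\<^sup>c)/\<delta>)\<close>. Projecting them away from the first \<open>k\<close> eigenfunctions \<open>\<phi>\<^sub>i\<close> and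
  adding the two Rayleigh inequalities gives, for each frequency \<open>\<xi>\<close>,
  \<open>\<lambda>\<^sub>k \<parallel>w\<parallel>\<^sup>2 - (\<bar>\<xi>\<bar>\<^sup>2\<^sup>s \<parallel>w\<parallel>\<^sup>2 + E(w)) \<le> \<Sum>\<^sub>i (\<lambda>\<^sub>k - \<lambda>\<^sub>i) \<bar>F(w \<phi>\<^sub>i)(\<xi>)\<bar>\<^sup>2\<close>, where \<open>F\<close> is the
  Fourier transform. Integrate over the ball of radius \<open>r\<close> with \<open>\<bar>B\<^sub>r\<bar> \<parallel>w\<parallel>\<^sup>2 = (2\<pi>)\<^sup>N k\<close>: by Plancherel
  \<open>\<lambda>\<^sub>k\<close> cancels, and what remains is the Weyl term up to \<open>\<parallel>w\<parallel>\<^sup>2\<close> against \<open>\<bar>\<Omega>\<bar>\<close> and the energy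
  \<open>E(w)\<close>. The bound on the level sets of the distance function makes the first error \<open>O(\<delta>)\<close> and
  gives \<open>E(w) = O(\<delta>\<^sup>-\<^sup>s)\<close>; take \<open>\<delta>\<close> proportional to \<open>k\<^sup>-\<^sup>1\<^sup>/\<^sup>N\<close>.

  The Rayleigh inequality off the first \<open>k\<close> eigenfunctions needs the existence of minimisers, which
  comes from the Poincare inequality on small grid cells and the completeness of \<open>L\<^sup>2\<close>.
\<close>

section \<open>Volume of boundary layers\<close>

text \<open>The width \<open>\<delta>\<close> serves two errors. The volume lost to the cutoff has
  relative size of order \<open>\<delta>\<close> and multiplies the Weyl term, which costs about
  k^(2s/N) \<open>\<delta>\<close> per eigenvalue; the energy costs \<open>\<delta>\<close>^(-s).
  With \<open>\<delta>\<close> of order k^(-1/N) these are k^((2s-1)/N) and k^(s/N), and s < 1 makes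
  the second dominate: this is the exponent of the remainder. The energy rate comes from
  translations: shifting \<open>w\<close> by z changes it, in squared norm, by at most a multiple of
  min(1, |z|^2/\<open>\<delta>\<close>). This profile has length scale
  sqrt(\<open>\<delta>\<close>), at which the kernel |z|^(-N-2s) yields
  \<open>\<delta>\<close>^(-s). Minimisers matter because \<open>eigenvalue_sequence\<close> only
  enumerates eigenvalues. If the Rayleigh quotient off the first k eigenfunctions fell below
  \<open>lam k\<close>, a minimiser would be one more eigenfunction for a value whose multiplicity
  is already exhausted by the indices below k. All functions are real and are not identified almost
  everywhere, so complex exponentials appear as pairs of cosine and sine, and the
  \<open>L\<^sup>2\<close> product is only semidefinite.\<close>

definition tube :: "'a::real_vector set \<Rightarrow> 'a \<Rightarrow> 'a set" where
  "tube C v = (\<lambda>(c, u). c - u *\<^sub>R v) ` (C \<times> {0..1})"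

lemma compact_tube:
  fixes C :: "'a::real_normed_vector set"
  shows "compact C \<Longrightarrow> compact (tube C v)"
  unfolding tube_def
  by (intro compact_continuous_image compact_Times) (auto intro!: continuous_intros simp: case_prod_unfold)

text \<open>Balls of radius \<open>2 * d\<close> placed along the segment at spacing at most
  \<open>d\<close> cover the tube. At most \<open>4 * t / d\<close> of them are needed, so one power
  of \<open>d\<close> cancels and the volume is linear in \<open>t\<close>. A separate
  \<open>d\<close> is used because the diameter may be 0.\<close>

lemma measure_tube_le_aux:
  fixes C :: "'a::euclidean_space set"
  assumes C: "compact C" "C \<noteq> {}" and d: "diameter C \<le> d" "0 < d" "d \<le> t" and v: "norm v \<le> 2 * t"
  shows "measure lborel (tube C v) \<le> 2 ^ (DIM('a) + 2) * unit_ball_vol DIM('a) * t * d ^ (DIM('a) - 1)"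
proof -
  define N where "N = DIM('a)"
  have N: "N \<ge> 1" by (simp add: N_def Suc_leI)
  obtain c0 where c0: "c0 \<in> C" using C by auto
  define m where "m = nat \<lceil>2 * t / d\<rceil>"
  have td: "2 * t / d \<ge> 2" using d by (simp add: field_simps)
  have m1: "real m \<ge> 2 * t / d" unfolding m_def by linarith
  have m2: "real m \<le> 2 * t / d + 1" unfolding m_def using td by linarith
  have mpos: "real m > 0" using m1 td by linarith
  define \<B> where "\<B> j = cball (c0 - (real j / real m) *\<^sub>R v) (2 * d)" for j
  have "tube C v \<subseteq> (\<Union>j\<le>m. \<B> j)"
  proof
    fix y assume "y \<in> tube C v"
    then obtain c u where cu: "c \<in> C" "0 \<le> u" "u \<le> 1" "y = c - u *\<^sub>R v" by (auto simp: tube_def)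
    define j where "j = nat \<lfloor>u * m\<rfloor>"
    have j: "real j \<le> u * m" "u * m < real j + 1" using cu mpos by (auto simp: j_def)
    have "u * m \<le> m" using cu mpos by (simp add: mult_left_le_one_le)
    then have jm: "j \<le> m" using j by linarith
    have "\<bar>u - real j / m\<bar> = \<bar>u * m - real j\<bar> / m" using mpos by (simp add: abs_if field_simps)
    also have "\<dots> \<le> 1 / m" using j mpos by (intro divide_right_mono) auto
    finally have "\<bar>u - real j / m\<bar> \<le> 1 / m" .
    then have "\<bar>u - real j / m\<bar> * norm v \<le> 1 / m * (2 * t)" using v d mpos by (intro mult_mono) auto
    also have "\<dots> \<le> d" using m1 d mpos by (simp add: field_simps)
    finally have 1: "norm ((u - real j / m) *\<^sub>R v) \<le> d" by simp
    have 2: "norm (c - c0) \<le> d"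
      using diameter_bounded_bound[OF compact_imp_bounded[OF C(1)] cu(1) c0] d by (simp add: dist_norm)
    have "norm (y - (c0 - (real j / m) *\<^sub>R v)) = norm ((c - c0) - (u - real j / m) *\<^sub>R v)"
      by (simp add: cu algebra_simps)
    also have "\<dots> \<le> norm (c - c0) + norm ((u - real j / m) *\<^sub>R v)" by (rule norm_triangle_ineq4)
    also have "\<dots> \<le> 2 * d" using 1 2 by linarith
    finally show "y \<in> (\<Union>j\<le>m. \<B> j)" using jm by (auto simp: \<B>_def dist_norm norm_minus_commute)
  qed
  then have "measure lborel (tube C v) \<le> measure lborel (\<Union>j\<le>m. \<B> j)"
    using compact_tube[OF C(1)]
    by (intro measure_mono_fmeasurable) (auto simp: \<B>_def compact_imp_closed intro!: fmeasurable_compact)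
  also have "\<dots> \<le> (\<Sum>j\<le>m. measure lborel (\<B> j))"
    by (intro measure_UNION_le) (auto simp: \<B>_def)
  also have "\<dots> = (real m + 1) * (unit_ball_vol N * (2 * d) ^ N)"
    using d by (simp add: \<B>_def content_cball N_def)
  also have "\<dots> \<le> (4 * t / d) * (unit_ball_vol N * (2 * d) ^ N)"
    using m2 td d by (intro mult_right_mono) auto
  also have "(4 * t / d) * (unit_ball_vol N * (2 * d) ^ N) = 2 ^ (N + 2) * unit_ball_vol N * t * d ^ (N - 1)"
    using N d by (cases N) (auto simp: power_mult_distrib field_simps)
  finally show ?thesis by (simp add: N_def)
qed

text \<open>Lets \<open>d\<close> decrease to the diameter, which is 0 for a single point; in
  dimension one the factor is then \<open>0 ^ 0 = 1\<close>, matching the Hausdorff weight of a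
  nonempty set.\<close>

lemma measure_tube_le:
  fixes C :: "'a::euclidean_space set"
  assumes C: "compact C" "C \<noteq> {}" and t: "diameter C < t" and v: "norm v \<le> 2 * t"
  shows "measure lborel (tube C v) \<le> 2 ^ (DIM('a) + 2) * unit_ball_vol DIM('a) * t * diameter C ^ (DIM('a) - 1)"
proof (rule LIMSEQ_le_const)
  let ?d = "\<lambda>n. diameter C + (t - diameter C) / real (Suc n)"
  have "(\<lambda>n. diameter C + (t - diameter C) * (1 / real (Suc n))) \<longlonglongrightarrow> diameter C + (t - diameter C) * 0"
    by (intro tendsto_intros LIMSEQ_Suc[OF lim_1_over_n])
  then have "?d \<longlonglongrightarrow> diameter C" by simp
  then show "(\<lambda>n. 2 ^ (DIM('a) + 2) * unit_ball_vol DIM('a) * t * ?d n ^ (DIM('a) - 1))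
    \<longlonglongrightarrow> 2 ^ (DIM('a) + 2) * unit_ball_vol DIM('a) * t * diameter C ^ (DIM('a) - 1)"
    by (intro tendsto_intros)
  have ge: "diameter C \<ge> 0" using C by (simp add: diameter_ge_0 compact_imp_bounded)
  show "\<exists>N. \<forall>n\<ge>N. measure lborel (tube C v) \<le> 2 ^ (DIM('a) + 2) * unit_ball_vol DIM('a) * t * ?d n ^ (DIM('a) - 1)"
  proof (intro exI allI impI measure_tube_le_aux C v)
    fix n :: nat
    have "(t - diameter C) / real (Suc n) > 0" using t by simp
    moreover have "(t - diameter C) / real (Suc n) \<le> (t - diameter C) / 1"
      using t by (intro divide_left_mono) auto
    ultimately have "(t - diameter C) / real (Suc n) > 0" "(t - diameter C) / real (Suc n) \<le> t - diameter C" by auto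
    then show "diameter C \<le> ?d n" "0 < ?d n" "?d n \<le> t" using ge by auto
  qed
qed

text \<open>The ball is connected: if it contained a point outside \<open>\<Omega>\<close> it would
  meet the frontier, at a distance from \<open>x\<close> smaller than the infimum.\<close>

lemma ball_subset_of_infdist_frontier:
  fixes \<Omega> :: "'a::euclidean_space set"
  assumes "x \<in> \<Omega>"
  shows "ball x (infdist x (frontier \<Omega>)) \<subseteq> \<Omega>"
proof (rule ccontr)
  assume "\<not> ?thesis"
  then obtain y where y: "y \<in> ball x (infdist x (frontier \<Omega>)) - \<Omega>" by blast
  then have "ball x (infdist x (frontier \<Omega>)) - \<Omega> \<noteq> {}" by blast
  moreover have "dist x y < infdist x (frontier \<Omega>)" using y by simp
  then have "0 < infdist x (frontier \<Omega>)" using zero_le_dist[of x y] by linarith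
  then have "x \<in> ball x (infdist x (frontier \<Omega>))" by simp
  then have "ball x (infdist x (frontier \<Omega>)) \<inter> \<Omega> \<noteq> {}" using assms by blast
  ultimately have "ball x (infdist x (frontier \<Omega>)) \<inter> frontier \<Omega> \<noteq> {}"
    by (intro connected_Int_frontier connected_ball)
  then obtain y where "y \<in> frontier \<Omega>" "dist x y < infdist x (frontier \<Omega>)" by auto
  then show False using infdist_le[of y "frontier \<Omega>" x] by (simp add: dist_commute)
qed

text \<open>This replaces the coarea formula: moving a small ball around a point of the band
  \<open>t \<le> dist \<le> 2t\<close> towards the nearest boundary point makes every point of the ball cross the level
  \<open>t/2\<close>. Hence the tubes over any cover of that single level cover the ball, and each tube has
  volume at most a multiple of \<open>t\<close> times the weight of the covering set.\<close>

lemma level_crossing: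
  fixes \<Omega> :: "'a::euclidean_space set"
  assumes ne: "frontier \<Omega> \<noteq> {}" and x: "x \<in> \<Omega>" and t: "0 < t" "t \<le> infdist x (frontier \<Omega>)" "infdist x (frontier \<Omega>) \<le> 2 * t"
  obtains v where "norm v \<le> 2 * t"
    "\<And>y. y \<in> ball x (t/8) \<Longrightarrow> \<exists>u\<in>{0..1}. y + u *\<^sub>R v \<in> \<Omega> \<inter> ball x (2 * t) \<and> infdist (y + u *\<^sub>R v) (frontier \<Omega>) = t / 2"
proof -
  let ?\<rho> = "\<lambda>x. infdist x (frontier \<Omega>)"
  define \<sigma> where "\<sigma> = ?\<rho> x"
  have \<sigma>: "t \<le> \<sigma>" "\<sigma> \<le> 2 * t" using t by (simp_all add: \<sigma>_def)
  obtain p where p: "p \<in> frontier \<Omega>" "\<sigma> = dist x p"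
    using infdist_attains_inf[OF frontier_closed ne, of x] by (auto simp: \<sigma>_def)
  \<comment> \<open>\<open>v\<close> stops at distance \<open>t / 4\<close> from the nearest
    boundary point \<open>p\<close>. After a shift by less than \<open>t / 8\<close> the start still
    has distance at least \<open>t / 2\<close> and the end at most \<open>t / 2\<close>, and the
    path stays in the ball of radius \<open>\<sigma>\<close> about \<open>x\<close>, hence in
    \<open>\<Omega>\<close>.\<close>
  define a where "a = 1 - t / (4 * \<sigma>)"
  have a: "0 \<le> a" "a \<le> 1" "a * \<sigma> = \<sigma> - t / 4" using \<sigma> t by (auto simp: a_def field_simps)
  define v where "v = a *\<^sub>R (p - x)"
  have nv: "norm v = \<sigma> - t / 4" using a p by (simp add: v_def dist_norm norm_minus_commute)
  have crossing: "\<exists>u\<in>{0..1}. y + u *\<^sub>R v \<in> \<Omega> \<inter> ball x (2 * t) \<and> ?\<rho> (y + u *\<^sub>R v) = t / 2"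
    if y: "y \<in> ball x (t/8)" for y
  proof -
    have dy: "norm (y - x) < t / 8" using y by (simp add: dist_norm norm_minus_commute)
    have cont: "continuous_on {0..1} (\<lambda>u. ?\<rho> (y + u *\<^sub>R v))"
      by (intro continuous_intros)
    have y0: "?\<rho> y \<ge> t / 2"
      using infdist_triangle[of x "frontier \<Omega>" y] dy \<sigma> t by (simp add: \<sigma>_def dist_norm norm_minus_commute)
    have "?\<rho> (y + v) \<le> dist (y + v) p" by (rule infdist_le) (rule p)
    also have "dist (y + v) p = norm ((y - x) - (1 - a) *\<^sub>R (p - x))" by (simp add: v_def dist_norm algebra_simps)
    also have "\<dots> \<le> norm (y - x) + norm ((1 - a) *\<^sub>R (p - x))" by (rule norm_triangle_ineq4)
    also have "norm ((1 - a) *\<^sub>R (p - x)) = (1 - a) * \<sigma>" using a p by (simp add: dist_norm norm_minus_commute)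
    also have "\<dots> = t / 4" using a by (simp add: algebra_simps)
    finally have y1: "?\<rho> (y + v) \<le> t / 2" using dy t by linarith
    have "\<exists>u\<ge>0. u \<le> 1 \<and> ?\<rho> (y + u *\<^sub>R v) = t / 2"
      using y0 y1 cont by (intro IVT2') auto
    then obtain u where u: "0 \<le> u" "u \<le> 1" "?\<rho> (y + u *\<^sub>R v) = t / 2" by auto
    have "norm (y + u *\<^sub>R v - x) \<le> norm (y - x) + norm (u *\<^sub>R v)"
      using norm_triangle_ineq[of "y - x" "u *\<^sub>R v"] by (simp add: algebra_simps)
    also have "norm (u *\<^sub>R v) \<le> norm v" using u by (simp add: mult_left_le_one_le)
    finally have "norm (y + u *\<^sub>R v - x) < \<sigma>" using dy nv t by linarith
    then have "y + u *\<^sub>R v \<in> ball x \<sigma>" by (simp add: dist_norm norm_minus_commute)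
    then have "y + u *\<^sub>R v \<in> \<Omega>" "y + u *\<^sub>R v \<in> ball x (2 * t)"
      using ball_subset_of_infdist_frontier[OF x] \<sigma> by (auto simp: \<sigma>_def)
    then show ?thesis using u by auto
  qed
  have "norm v \<le> 2 * t" using nv \<sigma> t by linarith
  then show ?thesis using crossing by (rule that)
qed

text \<open>The tube constant \<open>2 ^ (N + 2) * unit_ball_vol N\<close>, times the factor that
  turns a power of the diameter into the Hausdorff weight of dimension \<open>N - 1\<close>.\<close>

definition layer_const :: "nat \<Rightarrow> real" where
  "layer_const N = 2 ^ (N + 2) * unit_ball_vol N * 2 ^ (N - 1) / unit_ball_vol (real (N - 1))"

lemma layer_const_pos: "layer_const N > 0"
  by (simp add: layer_const_def)

text \<open>Cover sets may be non-measurable; passing to the closure keeps the diameter and makes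
  the tube compact.\<close>

lemma emeasure_tube_le_weight:
  fixes C :: "'a::euclidean_space set"
  assumes C: "bounded C" "C \<noteq> {}" and t: "diameter C < t" and v: "norm v \<le> 2 * t"
  shows "emeasure lborel (tube (closure C) v) \<le> ennreal (layer_const DIM('a) * t) * hausdorff_weight (DIM('a) - 1) C"
proof -
  have comp: "compact (closure C)" using C by (simp add: compact_closure)
  have diam: "diameter (closure C) = diameter C" using C by (simp add: diameter_closure)
  have "emeasure lborel (tube (closure C) v) = ennreal (measure lborel (tube (closure C) v))"
    using emeasure_compact_finite[OF compact_tube[OF comp]] by (intro emeasure_eq_ennreal_measure) (simp add: less_top)
  also have "\<dots> \<le> ennreal (2 ^ (DIM('a) + 2) * unit_ball_vol DIM('a) * t * diameter C ^ (DIM('a) - 1))"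
    using measure_tube_le[OF comp _ _ v] C t diam by (intro ennreal_leI) auto
  also have "2 ^ (DIM('a) + 2) * unit_ball_vol DIM('a) * t * diameter C ^ (DIM('a) - 1)
      = (layer_const DIM('a) * t) * (unit_ball_vol (real (DIM('a) - 1)) * (diameter C / 2) ^ (DIM('a) - 1))"
    using unit_ball_vol_pos[of "real (DIM('a) - 1)"]
    by (simp add: layer_const_def power_divide field_simps del: unit_ball_vol_pos of_nat_diff of_nat_diff_if)
  also have "ennreal \<dots> = ennreal (layer_const DIM('a) * t) * hausdorff_weight (DIM('a) - 1) C"
    using C layer_const_pos[of "DIM('a)"] diameter_ge_0[OF C(1)] t
    by (subst ennreal_mult) (auto simp: hausdorff_weight_def)
  finally show ?thesis .
qed

text \<open>Each point of \<open>F\<close> needs tubes of total volume at least that of its ball of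
  radius \<open>t/8\<close>. Separation makes these demands additive: one cover set cannot serve two
  points, so the total weight of a cover pays for all balls at once.\<close>

lemma separated_card_le_hausdorff:
  fixes \<Omega> :: "'a::euclidean_space set"
  assumes ne: "frontier \<Omega> \<noteq> {}" and t: "0 < t"
    and F: "finite F" "F \<subseteq> {x\<in>\<Omega>. t \<le> infdist x (frontier \<Omega>) \<and> infdist x (frontier \<Omega>) \<le> 2 * t}"
    and sep: "\<And>x y. x \<in> F \<Longrightarrow> y \<in> F \<Longrightarrow> x \<noteq> y \<Longrightarrow> 5 * t \<le> dist x y"
  shows "of_nat (card F) * ennreal (unit_ball_vol DIM('a) * (t/8) ^ DIM('a))
    \<le> ennreal (layer_const DIM('a) * t) * hausdorff_measure (DIM('a) - 1) {x\<in>\<Omega>. infdist x (frontier \<Omega>) = t / 2}"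
proof -
  let ?\<rho> = "\<lambda>x. infdist x (frontier \<Omega>)"
  let ?v = "unit_ball_vol DIM('a) * (t/8) ^ DIM('a)"
  let ?S = "{x\<in>\<Omega>. ?\<rho> x = t / 2}"
  let ?w = "hausdorff_weight (DIM('a) - 1) :: 'a set \<Rightarrow> ennreal"
  let ?K = "ennreal (layer_const DIM('a) * t)"
  let ?L = "of_nat (card F) * ennreal (?v)"
  have Kpos: "0 < ?K" "?K < top" using layer_const_pos t by auto
  have bound: "?L \<le> ?K * (\<Sum>i. ?w (C i))" if C: "hausdorff_cover (t/2) ?S C" for C
  proof -
    define I where "I x = {i. C i \<inter> ball x (2 * t) \<noteq> {}}" for x
    have Cb: "bounded (C i)" "diameter (C i) \<le> t / 2" for i using C by (auto simp: hausdorff_cover_def)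
    have one: "ennreal (?v) \<le> ?K * (\<Sum>i. ?w (C i) * indicator (I x) i)"
      if x: "x \<in> F" for x
    proof -
      obtain v where v: "norm v \<le> 2 * t"
        "\<And>y. y \<in> ball x (t/8) \<Longrightarrow> \<exists>u\<in>{0..1}. y + u *\<^sub>R v \<in> \<Omega> \<inter> ball x (2 * t) \<and> ?\<rho> (y + u *\<^sub>R v) = t / 2"
        using level_crossing[OF ne, of x t] F(2) x t by blast
      define T where "T i = (if i \<in> I x then tube (closure (C i)) v else {})" for i
      have "ball x (t/8) \<subseteq> (\<Union>i. T i)"
      proof
        fix y assume "y \<in> ball x (t/8)"
        from v(2)[OF this] obtain u where u: "u \<in> {0..1}" "y + u *\<^sub>R v \<in> ?S" "y + u *\<^sub>R v \<in> ball x (2 * t)" by auto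
        then obtain i where i: "y + u *\<^sub>R v \<in> C i" using C unfolding hausdorff_cover_def by blast
        then have "i \<in> I x" using u by (auto simp: I_def)
        moreover have "y \<in> tube (closure (C i)) v"
          unfolding tube_def using i u closure_subset[of "C i"]
          by (intro image_eqI[of _ _ "(y + u *\<^sub>R v, u)"]) auto
        ultimately show "y \<in> (\<Union>i. T i)" by (auto simp: T_def)
      qed
      have Tc: "compact (T i)" for i using Cb by (auto simp: T_def intro!: compact_tube)
      then have Tb: "T i \<in> sets borel" for i by (simp add: borel_closed compact_imp_closed)
      have "ennreal (?v) = emeasure lborel (ball x (t/8))"
        using t by (simp add: emeasure_ball)
      also have "\<dots> \<le> emeasure lborel (\<Union>i. T i)"
        using \<open>ball x (t/8) \<subseteq> _\<close> Tb by (intro emeasure_mono) auto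
      also have "\<dots> \<le> (\<Sum>i. emeasure lborel (T i))"
        using Tb by (intro emeasure_subadditive_countably) auto
      also have "\<dots> \<le> (\<Sum>i. ?K * (?w (C i) * indicator (I x) i))"
      proof (intro suminf_le)
        fix i
        show "emeasure lborel (T i) \<le> ?K * (?w (C i) * indicator (I x) i)"
        proof (cases "i \<in> I x")
          case True
          then have "C i \<noteq> {}" by (auto simp: I_def)
          moreover have "diameter (C i) < t" using Cb(2)[of i] t by linarith
          ultimately show ?thesis using emeasure_tube_le_weight[OF Cb(1) _ _ v(1), of i] True by (simp add: T_def)
        qed (simp add: T_def)
      qed auto
      also have "\<dots> = ?K * (\<Sum>i. ?w (C i) * indicator (I x) i)" by (simp add: ennreal_suminf_cmult)
      finally show ?thesis .
    qed
    \<comment> \<open>A cover set has diameter at most \<open>t / 2\<close>, so it meets at most one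
      of the balls of radius \<open>2 * t\<close>: meeting two would put their centres closer than
      \<open>4 * t + t / 2\<close>, hence closer than \<open>5 * t\<close>.\<close>
    have disj: "(\<Sum>x\<in>F. ?w (C i) * indicator (I x) i) \<le> ?w (C i)" for i
    proof (cases "\<exists>x\<in>F. i \<in> I x")
      case False then show ?thesis by simp
    next
      case True
      then obtain x where x: "x \<in> F" "i \<in> I x" by auto
      have uniq: "y = x" if y: "y \<in> F" "i \<in> I y" for y
      proof (rule ccontr)
        assume "y \<noteq> x"
        then have far: "5 * t \<le> dist x y" using sep x y by auto
        obtain p q where p: "p \<in> C i" "dist x p < 2 * t" and q: "q \<in> C i" "dist y q < 2 * t"
          using x y by (auto simp: I_def)
        have "dist p q \<le> t / 2" using diameter_bounded_bound[OF Cb(1) p(1) q(1)] Cb(2)[of i] by linarith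
        moreover have "dist x y \<le> dist x p + dist p q + dist y q"
          by (metis (no_types) add.commute add_mono_thms_linordered_semiring(3) dist_commute dist_triangle dist_triangle_le order_refl)
        ultimately show False using far p q t by linarith
      qed
      have "(\<Sum>y\<in>F. ?w (C i) * indicator (I y) i) = (\<Sum>y\<in>F. if y = x then ?w (C i) else 0)"
      proof (intro sum.cong refl)
        fix y assume y: "y \<in> F"
        show "?w (C i) * indicator (I y) i = (if y = x then ?w (C i) else 0)"
        proof (cases "y = x")
          case False
          then have "i \<notin> I y" using uniq[OF y] by blast
          then show ?thesis using False by simp
        qed (use x in simp)
      qed
      then show ?thesis using F(1) x by simp
    qed
    have "?L = (\<Sum>x\<in>F. ennreal (?v))" by simp
    also have "\<dots> \<le> (\<Sum>x\<in>F. ?K * (\<Sum>i. ?w (C i) * indicator (I x) i))" by (intro sum_mono one)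
    also have "\<dots> = ?K * (\<Sum>i. \<Sum>x\<in>F. ?w (C i) * indicator (I x) i)"
      by (subst suminf_sum) (auto simp: sum_distrib_left)
    also have "\<dots> \<le> ?K * (\<Sum>i. ?w (C i))"
      by (intro mult_left_mono suminf_le disj) auto
    finally show ?thesis .
  qed
  \<comment> \<open>The constant is divided out so that the bound can pass to the infimum over
    covers; the scale \<open>t / 2\<close> is one of those in the supremum.\<close>
  have "?L / ?K \<le> (INF C\<in>{C. hausdorff_cover (t/2) ?S C}. \<Sum>i. ?w (C i))"
  proof (intro INF_greatest)
    fix C assume "C \<in> {C. hausdorff_cover (t/2) ?S C}"
    then have "?L \<le> ?K * (\<Sum>i. ?w (C i))" by (intro bound) simp
    with Kpos(1) show "?L / ?K \<le> (\<Sum>i. ?w (C i))" by (rule divide_le_posI_ennreal)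
  qed
  also have "\<dots> \<le> hausdorff_measure (DIM('a) - 1) ?S"
    unfolding hausdorff_measure_def using t by (intro SUP_upper) auto
  finally have "?L / ?K * ?K \<le> hausdorff_measure (DIM('a) - 1) ?S * ?K" by (rule mult_right_mono) simp
  moreover have "?L / ?K * ?K = ?L"
    unfolding ennreal_divide_times ennreal_divide_self[OF gr_implies_not_zero[OF Kpos(1)] Kpos(2)] by (rule mult_1_right)
  ultimately show ?thesis by (simp add: mult.commute)
qed

text \<open>A maximal \<open>5 * t\<close>-separated subset exists because the preceding estimate
  bounds cardinalities, and by maximality its balls of radius \<open>5 * t\<close> cover the band.
  The factor 40 is the ratio of the radii \<open>5 * t\<close> and \<open>t / 8\<close>.\<close>

lemma band_emeasure_le:
  fixes \<Omega> :: "'a::euclidean_space set"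
  assumes op: "open \<Omega>" and ne: "frontier \<Omega> \<noteq> {}" and t: "0 < t" and h: "0 \<le> h"
    and level: "hausdorff_measure (DIM('a) - 1) {x\<in>\<Omega>. infdist x (frontier \<Omega>) = t / 2} \<le> ennreal h"
  shows "emeasure lborel {x\<in>\<Omega>. t \<le> infdist x (frontier \<Omega>) \<and> infdist x (frontier \<Omega>) \<le> 2 * t}
     \<le> ennreal (40 ^ DIM('a) * layer_const DIM('a) * h * t)"
proof -
  let ?B = "{x\<in>\<Omega>. t \<le> infdist x (frontier \<Omega>) \<and> infdist x (frontier \<Omega>) \<le> 2 * t}"
  define sep where "sep F \<longleftrightarrow> finite F \<and> F \<subseteq> ?B \<and> (\<forall>x\<in>F. \<forall>y\<in>F. x \<noteq> y \<longrightarrow> 5 * t \<le> dist x y)" for F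
  let ?v = "unit_ball_vol DIM('a) * (t/8) ^ DIM('a)"
  have vpos: "?v > 0" using t by simp
  have card: "real (card F) * ?v \<le> layer_const DIM('a) * t * h" if "sep F" for F
  proof -
    have "of_nat (card F) * ennreal ?v
      \<le> ennreal (layer_const DIM('a) * t) * hausdorff_measure (DIM('a) - 1) {x\<in>\<Omega>. infdist x (frontier \<Omega>) = t / 2}"
      using that unfolding sep_def by (intro separated_card_le_hausdorff ne t) auto
    also have "\<dots> \<le> ennreal (layer_const DIM('a) * t) * ennreal h" by (intro mult_left_mono level) simp
    finally have "ennreal (real (card F) * ?v) \<le> ennreal (layer_const DIM('a) * t * h)"
      using layer_const_pos[of "DIM('a)"] t h vpos by (simp add: ennreal_mult ennreal_of_nat_eq_real_of_nat less_imp_le)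
    then show ?thesis using layer_const_pos[of "DIM('a)"] t h by (subst (asm) ennreal_le_iff) auto
  qed
  then have "card F \<le> nat \<lfloor>layer_const DIM('a) * t * h / ?v\<rfloor>" if "sep F" for F
    using that vpos by (auto simp: le_nat_floor field_simps)
  moreover have "sep {}" by (simp add: sep_def)
  ultimately obtain F where F: "sep F" "\<And>G. sep G \<Longrightarrow> card G \<le> card F"
    using ex_has_greatest_nat[of sep "{}" card "Suc (nat \<lfloor>layer_const DIM('a) * t * h / ?v\<rfloor>)"]
    by (metis less_Suc_eq_le)
  have cover: "?B \<subseteq> (\<Union>x\<in>F. ball x (5 * t))"
  proof (rule ccontr)
    assume "\<not> ?thesis"
    then obtain z where z: "z \<in> ?B" "\<And>x. x \<in> F \<Longrightarrow> 5 * t \<le> dist x z" by (force simp: not_less)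
    then have "z \<notin> F" using t by force
    have "sep (insert z F)" using F(1) z unfolding sep_def by (auto simp: dist_commute)
    from F(2)[OF this] show False using F(1) \<open>z \<notin> F\<close> by (simp add: sep_def)
  qed
  have fin: "finite F" using F(1) by (simp add: sep_def)
  have "emeasure lborel ?B \<le> emeasure lborel (\<Union>x\<in>F. ball x (5 * t))"
    using fin by (intro emeasure_mono cover) (auto intro!: borel_open)
  also have "\<dots> \<le> (\<Sum>x\<in>F. emeasure lborel (ball x (5 * t)))"
    using fin by (intro emeasure_subadditive_finite) auto
  also have "\<dots> = ennreal (real (card F) * ?v * 40 ^ DIM('a))"
    using t by (simp add: emeasure_ball ennreal_of_nat_eq_real_of_nat ennreal_mult[symmetric] power_divide
        power_mult_distrib field_simps) (simp flip: power_mult_distrib)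
  also have "\<dots> \<le> ennreal (40 ^ DIM('a) * layer_const DIM('a) * h * t)"
    using card[OF F(1)] by (intro ennreal_leI) (simp add: mult_ac)
  finally show ?thesis .
qed

lemma infdist_frontier_pos:
  fixes \<Omega> :: "'a::euclidean_space set"
  assumes "open \<Omega>" "x \<in> \<Omega>" "frontier \<Omega> \<noteq> {}"
  shows "0 < infdist x (frontier \<Omega>)"
  using assms by (intro infdist_pos_not_in_closed) (auto simp: frontier_def interior_open)

text \<open>Dyadic bands exhaust the layer, since openness keeps the distance to the frontier
  positive; their volume bounds form a geometric series.\<close>

theorem boundary_layer_measure:
  fixes \<Omega> :: "'a::euclidean_space set"
  assumes op: "open \<Omega>" and ne: "frontier \<Omega> \<noteq> {}" and h: "0 \<le> h"
    and level: "\<And>t. t > 0 \<Longrightarrow> hausdorff_measure (DIM('a) - 1) {x\<in>\<Omega>. infdist x (frontier \<Omega>) = t} \<le> ennreal h"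
    and t: "t > 0"
  shows "emeasure lborel {x\<in>\<Omega>. infdist x (frontier \<Omega>) < t} \<le> ennreal (40 ^ DIM('a) * layer_const DIM('a) * h * t)"
proof -
  let ?\<rho> = "\<lambda>x. infdist x (frontier \<Omega>)"
  let ?C = "40 ^ DIM('a) * layer_const DIM('a) * h"
  define B where "B j = {x\<in>\<Omega>. t / 2 ^ Suc j \<le> ?\<rho> x \<and> ?\<rho> x \<le> 2 * (t / 2 ^ Suc j)}" for j
  have C0: "?C \<ge> 0" using h layer_const_pos[of "DIM('a)"] by simp
  have B_meas[measurable]: "B j \<in> sets borel" for j
  proof -
    have "B j = \<Omega> \<inter> (?\<rho> -` {t / 2 ^ Suc j .. 2 * (t / 2 ^ Suc j)} \<inter> space borel)" by (auto simp: B_def)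
    also have "\<dots> \<in> sets borel"
      using op by (intro sets.Int measurable_sets[of _ borel borel] borel_measurable_continuous_onI continuous_intros) auto
    finally show ?thesis .
  qed
  have "{x\<in>\<Omega>. ?\<rho> x < t} \<subseteq> (\<Union>j. B j)"
  proof
    fix x assume "x \<in> {x\<in>\<Omega>. ?\<rho> x < t}"
    then have x: "x \<in> \<Omega>" "?\<rho> x < t" by auto
    have pos: "?\<rho> x > 0" using infdist_frontier_pos[OF op x(1) ne] .
    obtain n where "(1/2::real) ^ n < ?\<rho> x / t"
      using real_arch_pow_inv[of "?\<rho> x / t" "1/2"] pos t by auto
    then have ex: "\<exists>n. t / 2 ^ n \<le> ?\<rho> x" using t by (intro exI[of _ n]) (simp add: field_simps)
    define n where "n = (LEAST n. t / 2 ^ n \<le> ?\<rho> x)"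
    have n: "t / 2 ^ n \<le> ?\<rho> x" unfolding n_def using ex by (rule LeastI_ex)
    have "n \<noteq> 0" using n x by (intro notI) simp
    then obtain j where j: "n = Suc j" by (cases n) auto
    have "\<not> t / 2 ^ j \<le> ?\<rho> x" using not_less_Least[of j "\<lambda>n. t / 2 ^ n \<le> ?\<rho> x"] j n_def by simp
    then have "x \<in> B j" using n x j by (simp add: B_def)
    then show "x \<in> (\<Union>j. B j)" by blast
  qed
  then have "emeasure lborel {x\<in>\<Omega>. ?\<rho> x < t} \<le> emeasure lborel (\<Union>j. B j)"
    by (intro emeasure_mono) auto
  also have "\<dots> \<le> (\<Sum>j. emeasure lborel (B j))" by (intro emeasure_subadditive_countably) auto
  also have "\<dots> \<le> (\<Sum>j. ennreal (?C * t * (1/2) ^ Suc j))"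
  proof (intro suminf_le)
    fix j
    have "emeasure lborel (B j) \<le> ennreal (40 ^ DIM('a) * layer_const DIM('a) * h * (t / 2 ^ Suc j))"
      unfolding B_def using t by (intro band_emeasure_le op ne h level) auto
    then show "emeasure lborel (B j) \<le> ennreal (?C * t * (1/2) ^ Suc j)"
      by (simp add: power_one_over field_simps)
  qed auto
  also have "\<dots> = ennreal (\<Sum>j. ?C * t * (1/2) ^ Suc j)"
    using C0 t by (intro suminf_ennreal2 summable_mult sums_summable[OF power_half_series]) auto
  also have "(\<Sum>j. ?C * t * (1/2) ^ Suc j) = ?C * t"
    using sums_unique[OF sums_mult[OF power_half_series, of "?C * t"]] by simp
  finally show ?thesis .
qed

section \<open>Quadratic forms with compact embedding\<close>

text \<open>Gaussian elimination, by induction on the number of equations. It supplies both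
  dimension counts needed for multiplicities: too many eigenvectors, and too few orthogonality
  conditions.\<close>

lemma homogeneous_system_nontrivial:
  fixes a :: "nat \<Rightarrow> nat \<Rightarrow> real"
  assumes "p < m"
  shows "\<exists>c. (\<exists>j<m. c j \<noteq> 0) \<and> (\<forall>i<p. (\<Sum>j<m. c j * a i j) = 0)"
  using assms
proof (induction p arbitrary: m a)
  case 0
  then show ?case by (intro exI[of _ "\<lambda>_. 1"]) auto
next
  case (Suc p)
  then obtain m' where m: "m = Suc m'" and pm: "p < m'" by (cases m) auto
  show ?case
  proof (cases "\<forall>j<m. a p j = 0")
    case True
    from Suc.IH[of m a] Suc.prems obtain c where "\<exists>j<m. c j \<noteq> 0" "\<forall>i<p. (\<Sum>j<m. c j * a i j) = 0" by auto
    then show ?thesis using True by (intro exI[of _ c]) (auto simp: less_Suc_eq)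
  next
    case False
    then obtain q where q: "q < m" "a p q \<noteq> 0" by auto
    \<comment> \<open>\<open>\<tau>\<close> lists the unknowns other than \<open>q\<close>;
      \<open>b\<close> is the system left after equation \<open>p\<close> has been solved for
      unknown \<open>q\<close>.\<close>
    define \<tau> where "\<tau> = (\<lambda>j. if j < q then j else Suc j)"
    define b where "b i j = a i (\<tau> j) - a i q / a p q * a p (\<tau> j)" for i j
    obtain c where c: "\<exists>j<m'. c j \<noteq> 0" "\<forall>i<p. (\<Sum>j<m'. c j * b i j) = 0"
      using Suc.IH[OF pm, of b] by auto
    define T where "T = (\<Sum>j<m'. c j * a p (\<tau> j))"
    define d where "d j = (if j = q then - T / a p q else if j < q then c j else c (j - 1))" for j
    have tau_img: "\<tau> ` {..<m'} = {..<m} - {q}"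
    proof
      show "\<tau> ` {..<m'} \<subseteq> {..<m} - {q}" using q m by (auto simp: \<tau>_def)
      show "{..<m} - {q} \<subseteq> \<tau> ` {..<m'}"
      proof
        fix x assume x: "x \<in> {..<m} - {q}"
        show "x \<in> \<tau> ` {..<m'}"
        proof (cases "x < q")
          case True then show ?thesis using q m by (intro image_eqI[of _ _ x]) (auto simp: \<tau>_def)
        next
          case False then show ?thesis using x m by (intro image_eqI[of _ _ "x - 1"]) (auto simp: \<tau>_def)
        qed
      qed
    qed
    have tau_inj: "inj_on \<tau> {..<m'}" by (auto simp: inj_on_def \<tau>_def split: if_splits)
    have d_tau: "d (\<tau> j) = c j" for j by (auto simp: d_def \<tau>_def)
    have sum_d: "(\<Sum>j<m. d j * a i j) = - T / a p q * a i q + (\<Sum>j<m'. c j * a i (\<tau> j))" for i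
    proof -
      have "(\<Sum>j<m. d j * a i j) = d q * a i q + (\<Sum>j\<in>{..<m} - {q}. d j * a i j)"
        using q by (intro sum.remove) auto
      also have "(\<Sum>j\<in>{..<m} - {q}. d j * a i j) = (\<Sum>j<m'. c j * a i (\<tau> j))"
        unfolding tau_img[symmetric] by (subst sum.reindex[OF tau_inj]) (simp add: d_tau)
      finally show ?thesis by (simp add: d_def)
    qed
    have b_sum: "(\<Sum>j<m'. c j * b i j) = (\<Sum>j<m'. c j * a i (\<tau> j)) - a i q / a p q * T" for i
      by (simp add: b_def T_def algebra_simps sum_subtractf sum_distrib_left)
    have "(\<Sum>j<m. d j * a i j) = 0" if "i < Suc p" for i
    proof (cases "i = p")
      case True then show ?thesis using q(2) by (simp add: sum_d T_def)
    next
      case False then have "i < p" using that by simp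
      then have "(\<Sum>j<m'. c j * b i j) = 0" using c by blast
      then show ?thesis by (simp add: sum_d b_sum)
    qed
    moreover have "\<exists>j<m. d j \<noteq> 0"
    proof -
      obtain j where "j < m'" "c j \<noteq> 0" using c by auto
      moreover have "\<tau> j < m" using \<open>j < m'\<close> tau_img by auto
      ultimately show ?thesis using d_tau by metis
    qed
    ultimately show ?thesis by blast
  qed
qed

lemma common_convergent_subseq:
  fixes f :: "'j \<Rightarrow> nat \<Rightarrow> real"
  assumes "finite J" "\<And>j. j \<in> J \<Longrightarrow> bounded (range (f j))"
  shows "\<exists>r. strict_mono (r::nat\<Rightarrow>nat) \<and> (\<forall>j\<in>J. convergent (\<lambda>n. f j (r n)))"
  using assms
proof (induction J)
  case empty then show ?case by (auto intro: exI[of _ id] simp: strict_mono_def)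
next
  case (insert j J)
  then obtain r where r: "strict_mono (r::nat\<Rightarrow>nat)" "\<And>j. j\<in>J \<Longrightarrow> convergent (\<lambda>n. f j (r n))" by auto
  have "bounded (range (\<lambda>n. f j (r n)))"
    using insert.prems[of j] by (rule bounded_subset) auto
  then obtain l s where s: "strict_mono (s::nat\<Rightarrow>nat)" "((\<lambda>n. f j (r n)) \<circ> s) \<longlonglongrightarrow> l"
    using bounded_imp_convergent_subsequence by blast
  have "convergent (\<lambda>n. f i (r (s n)))" if "i \<in> J" for i
    using convergent_subseq_convergent[OF r(2)[OF that] s(1)] by (simp add: o_def)
  moreover have "convergent (\<lambda>n. f j (r (s n)))" using s(2) by (auto simp: convergent_def o_def)
  ultimately show ?case using r(1) s(1)
    by (intro exI[of _ "r \<circ> s"]) (auto simp: strict_mono_def)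
qed

text \<open>First-order condition at the minimum \<open>t = 0\<close>: for small \<open>t\<close> of
  the right sign the linear term would win, whatever the sign of \<open>a\<close>. It serves the
  Euler-Lagrange equation and Cauchy-Schwarz against null vectors.\<close>

lemma linear_coeff_zero_if_nonneg:
  fixes a b :: real
  assumes "\<And>t. a * t^2 + 2 * b * t \<ge> 0"
  shows "b = 0"
proof (rule ccontr)
  assume b: "b \<noteq> 0"
  define t where "t = - b / (\<bar>a\<bar> + 1)"
  have "a * t^2 + 2 * b * t \<le> \<bar>a\<bar> * t^2 + 2 * b * t" by (simp add: mult_right_mono)
  also have "\<dots> = b^2 / (\<bar>a\<bar>+1)^2 * (\<bar>a\<bar> - 2 * (\<bar>a\<bar> + 1))"
    by (simp add: t_def power2_eq_square divide_simps) (simp add: algebra_simps)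
  also have "\<dots> < 0" using b by (intro mult_pos_neg) auto
  finally show False using assms[of t] by linarith
qed

text \<open>Since functions that agree almost everywhere are not identified, a form may vanish on
  nonzero elements and only semidefiniteness is available. One interface serves both the energy and
  the \<open>L\<^sup>2\<close> product.\<close>

locale psd_form =
  fixes H :: "('a \<Rightarrow> real) set" and B :: "('a \<Rightarrow> real) \<Rightarrow> ('a \<Rightarrow> real) \<Rightarrow> real"
  assumes zero: "(\<lambda>x. 0) \<in> H"
    and comb: "\<And>a b u v. u \<in> H \<Longrightarrow> v \<in> H \<Longrightarrow> (\<lambda>x. a * u x + b * v x) \<in> H"
    and form_comb: "\<And>a b u v w. u \<in> H \<Longrightarrow> v \<in> H \<Longrightarrow> w \<in> H \<Longrightarrow>
          B (\<lambda>x. a * u x + b * v x) w = a * B u w + b * B v w"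
    and form_sym: "\<And>u v. u \<in> H \<Longrightarrow> v \<in> H \<Longrightarrow> B u v = B v u"
    and form_nonneg: "\<And>u. u \<in> H \<Longrightarrow> 0 \<le> B u u"
begin

lemma diff_mem: "u \<in> H \<Longrightarrow> v \<in> H \<Longrightarrow> (\<lambda>x. u x - v x) \<in> H"
  using comb[of u v 1 "-1"] by simp

lemma scale_mem: "u \<in> H \<Longrightarrow> (\<lambda>x. c * u x) \<in> H"
  using comb[of u u c 0] by simp

lemma form_comb_right:
  "u \<in> H \<Longrightarrow> v \<in> H \<Longrightarrow> w \<in> H \<Longrightarrow> B w (\<lambda>x. a * u x + b * v x) = a * B w u + b * B w v"
  by (simp add: form_sym[of w] comb form_comb)

lemma form_diff: "u \<in> H \<Longrightarrow> v \<in> H \<Longrightarrow> w \<in> H \<Longrightarrow> B (\<lambda>x. u x - v x) w = B u w - B v w"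
  using form_comb[of u v w 1 "-1"] by simp

lemma form_diff_right: "u \<in> H \<Longrightarrow> v \<in> H \<Longrightarrow> w \<in> H \<Longrightarrow> B w (\<lambda>x. u x - v x) = B w u - B w v"
  using form_comb_right[of u v w 1 "-1"] by simp

lemma form_scale: "u \<in> H \<Longrightarrow> w \<in> H \<Longrightarrow> B (\<lambda>x. c * u x) w = c * B u w"
  using form_comb[of u u w c 0] by simp

lemma form_scale_right: "u \<in> H \<Longrightarrow> w \<in> H \<Longrightarrow> B w (\<lambda>x. c * u x) = c * B w u"
  using form_comb_right[of u u w c 0] by simp

lemma sum_mem: "finite I \<Longrightarrow> (\<And>i. i \<in> I \<Longrightarrow> u i \<in> H) \<Longrightarrow> (\<lambda>x. \<Sum>i\<in>I. c i * u i x) \<in> H"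
proof (induction I rule: finite_induct)
  case (insert i I)
  then show ?case using comb[of "u i" "\<lambda>x. \<Sum>i\<in>I. c i * u i x" "c i" 1] by simp
qed (simp add: zero)

lemma form_zero: "w \<in> H \<Longrightarrow> B (\<lambda>x. 0) w = 0"
  using form_scale[OF zero, of w 0] by simp

lemma form_sum:
  "finite I \<Longrightarrow> (\<And>i. i \<in> I \<Longrightarrow> u i \<in> H) \<Longrightarrow> w \<in> H \<Longrightarrow>
    B (\<lambda>x. \<Sum>i\<in>I. c i * u i x) w = (\<Sum>i\<in>I. c i * B (u i) w)"
proof (induction I rule: finite_induct)
  case (insert i I)
  then show ?case using form_comb[of "u i" "\<lambda>x. \<Sum>i\<in>I. c i * u i x" w "c i" 1]
    by (simp add: sum_mem)
qed (simp add: form_zero)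

lemma form_sum_right:
  "finite I \<Longrightarrow> (\<And>i. i \<in> I \<Longrightarrow> u i \<in> H) \<Longrightarrow> w \<in> H \<Longrightarrow>
    B w (\<lambda>x. \<Sum>i\<in>I. c i * u i x) = (\<Sum>i\<in>I. c i * B w (u i))"
  by (simp add: form_sym[of w] sum_mem form_sum cong: sum.cong)

lemma form_comb_self:
  assumes "u \<in> H" "v \<in> H"
  shows "B (\<lambda>x. a * u x + b * v x) (\<lambda>x. a * u x + b * v x) = a^2 * B u u + 2 * a * b * B u v + b^2 * B v v"
  using assms by (simp add: form_comb form_comb_right comb form_sym[of v u] power2_eq_square algebra_simps)

lemma form_diff_self:
  assumes "u \<in> H" "v \<in> H"
  shows "B (\<lambda>x. u x - v x) (\<lambda>x. u x - v x) = B u u - 2 * B u v + B v v"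
  using form_comb_self[OF assms, of 1 "-1"] by simp

lemma parallelogram:
  assumes "u \<in> H" "v \<in> H"
  shows "B (\<lambda>x. u x - v x) (\<lambda>x. u x - v x) + B (\<lambda>x. u x + v x) (\<lambda>x. u x + v x) = 2 * B u u + 2 * B v v"
  using form_comb_self[OF assms, of 1 1] form_diff_self[OF assms] by simp

lemma cauchy_schwarz:
  assumes "u \<in> H" "v \<in> H"
  shows "(B u v)^2 \<le> B u u * B v v"
proof -
  have q: "0 \<le> a^2 * B u u + 2 * a * b * B u v + b^2 * B v v" for a b
    using form_nonneg[OF comb[OF assms, of a b]] form_comb_self[OF assms] by simp
  show ?thesis
  proof (cases "B v v = 0")
    case True
    have "B u v = 0"
    proof (rule linear_coeff_zero_if_nonneg)
      show "B u u * t^2 + 2 * B u v * t \<ge> 0" for t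
        using q[of t 1] True by (simp add: algebra_simps)
    qed
    then show ?thesis using True by simp
  next
    case False
    then have pos: "B v v > 0" using form_nonneg[OF assms(2)] by simp
    have "0 \<le> (B v v)^2 * B u u + 2 * B v v * (- B u v) * B u v + (- B u v)^2 * B v v" by (rule q)
    also have "\<dots> = B v v * (B u u * B v v - (B u v)^2)"
      by (simp add: power2_eq_square algebra_simps)
    finally show ?thesis using pos by (simp add: zero_le_mult_iff)
  qed
qed

end

text \<open>The two extra assumptions stand for the compact embedding of \<open>H\<close> into \<open>L\<^sup>2\<close> and for the
  completeness of \<open>L\<^sup>2\<close> with a lower semicontinuous energy. Equality almost everywhere is expressed by
  \<open>ip\<close>-null differences.\<close>

locale compact_form = energy: psd_form H E + psd_form H ip
  for H :: "('a \<Rightarrow> real) set" and E ip :: "('a \<Rightarrow> real) \<Rightarrow> ('a \<Rightarrow> real) \<Rightarrow> real" +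
  assumes poincare: "\<And>L. \<exists>(J::'a set set) \<theta> C. finite J \<and>
      (\<forall>j\<in>J. \<forall>u\<in>H. (\<theta> j u)^2 \<le> C * ip u u) \<and>
      (\<forall>j\<in>J. \<forall>u\<in>H. \<forall>v\<in>H. \<theta> j (\<lambda>x. u x - v x) = \<theta> j u - \<theta> j v) \<and>
      (\<forall>u\<in>H. L * ip u u \<le> E u u + (\<Sum>j\<in>J. (\<theta> j u)^2))"
    and closed: "\<And>u \<mu>. (\<And>n. u n \<in> H) \<Longrightarrow>
      (\<And>e. e > 0 \<Longrightarrow> \<exists>M. \<forall>m\<ge>M. \<forall>n\<ge>M. ip (\<lambda>x. u m x - u n x) (\<lambda>x. u m x - u n x) < e) \<Longrightarrow>
      (\<lambda>n. E (u n) (u n)) \<longlonglongrightarrow> \<mu> \<Longrightarrow>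
      \<exists>v\<in>H. (\<lambda>n. ip (\<lambda>x. u n x - v x) (\<lambda>x. u n x - v x)) \<longlonglongrightarrow> 0 \<and> E v v \<le> \<mu>"
begin

lemma ip_tendsto:
  fixes u :: "nat \<Rightarrow> 'a \<Rightarrow> real"
  assumes u: "\<And>n. u n \<in> H" and v: "v \<in> H" and w: "w \<in> H"
    and lim: "(\<lambda>n. ip (\<lambda>x. u n x - v x) (\<lambda>x. u n x - v x)) \<longlonglongrightarrow> 0"
  shows "(\<lambda>n. ip (u n) w) \<longlonglongrightarrow> ip v w"
proof -
  have "(\<lambda>n. (ip (\<lambda>x. u n x - v x) w)^2) \<longlonglongrightarrow> 0"
  proof (rule tendsto_sandwich[OF _ _ tendsto_const])
    show "\<forall>\<^sub>F n in sequentially. 0 \<le> (ip (\<lambda>x. u n x - v x) w)^2" by simp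
    show "\<forall>\<^sub>F n in sequentially. (ip (\<lambda>x. u n x - v x) w)^2
        \<le> ip (\<lambda>x. u n x - v x) (\<lambda>x. u n x - v x) * ip w w"
      using u v w by (simp add: cauchy_schwarz diff_mem)
    show "(\<lambda>n. ip (\<lambda>x. u n x - v x) (\<lambda>x. u n x - v x) * ip w w) \<longlonglongrightarrow> 0"
      using tendsto_mult_right[OF lim, of "ip w w"] by simp
  qed
  then have "(\<lambda>n. sqrt ((ip (u n) w - ip v w)^2)) \<longlonglongrightarrow> sqrt 0"
    using u v w by (intro tendsto_real_sqrt) (simp add: form_diff)
  then have "(\<lambda>n. ip (u n) w - ip v w) \<longlonglongrightarrow> 0"
    by (simp add: tendsto_rabs_zero_iff)
  then show ?thesis by (simp add: LIM_zero_iff)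
qed

lemma ip_self_tendsto:
  fixes u :: "nat \<Rightarrow> 'a \<Rightarrow> real"
  assumes u: "\<And>n. u n \<in> H" and v: "v \<in> H"
    and lim: "(\<lambda>n. ip (\<lambda>x. u n x - v x) (\<lambda>x. u n x - v x)) \<longlonglongrightarrow> 0"
  shows "(\<lambda>n. ip (u n) (u n)) \<longlonglongrightarrow> ip v v"
proof -
  have "(\<lambda>n. ip (\<lambda>x. u n x - v x) (\<lambda>x. u n x - v x) + 2 * ip (u n) v - ip v v)
     \<longlonglongrightarrow> 0 + 2 * ip v v - ip v v"
    by (intro tendsto_intros lim ip_tendsto u v)
  then show ?thesis using u v by (simp add: form_diff_self)
qed

definition orth :: "'i set \<Rightarrow> ('i \<Rightarrow> 'a \<Rightarrow> real) \<Rightarrow> ('a \<Rightarrow> real) set" where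
  "orth I \<phi> = {u \<in> H. \<forall>i\<in>I. ip u (\<phi> i) = 0}"

lemma orth_mem: "u \<in> orth I \<phi> \<Longrightarrow> u \<in> H" by (simp add: orth_def)

lemma orth_comb:
  assumes "\<And>i. i \<in> I \<Longrightarrow> \<phi> i \<in> H" "u \<in> orth I \<phi>" "v \<in> orth I \<phi>"
  shows "(\<lambda>x. a * u x + b * v x) \<in> orth I \<phi>"
  using assms by (auto simp: orth_def comb form_comb)

text \<open>Direct method. The parallelogram law turns the nearly minimal energy of the sequence
  into smallness of its differences, up to finitely many functionals that converge along a
  subsequence. The sequence is therefore Cauchy for \<open>ip\<close>, and \<open>closed\<close>
  provides the limit.\<close>

lemma minimizer_exists:
  assumes \<phi>: "\<And>i. i \<in> I \<Longrightarrow> \<phi> i \<in> H"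
    and u0: "u0 \<in> orth I \<phi>" "ip u0 u0 > 0"
  shows "\<exists>v\<in>orth I \<phi>. ip v v = 1 \<and> E v v * ip u0 u0 \<le> E u0 u0 \<and> (\<forall>u\<in>orth I \<phi>. E v v * ip u u \<le> E u u)"
proof -
  define S where "S = {E u u |u. u \<in> orth I \<phi> \<and> ip u u = 1}"
  define \<mu> where "\<mu> = Inf S"
  have scaled: "\<exists>e\<in>S. e * ip u u = E u u" if "u \<in> orth I \<phi>" "ip u u > 0" for u
  proof
    let ?v = "\<lambda>x. (1 / sqrt (ip u u)) * u x"
    have u: "u \<in> H" using that by (simp add: orth_mem)
    have v: "?v \<in> orth I \<phi>" using orth_comb[OF \<phi> that(1) that(1), of "1 / sqrt (ip u u)" 0] by simp
    have 1: "ip ?v ?v = 1" using u that(2)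
      by (simp only: form_scale form_scale_right scale_mem) (simp add: field_simps)
    have 2: "E ?v ?v * ip u u = E u u" using u that(2)
      by (simp only: energy.form_scale energy.form_scale_right scale_mem) (simp add: field_simps)
    from 2 show "E ?v ?v * ip u u = E u u" .
    show "E ?v ?v \<in> S" unfolding S_def using v 1 by blast
  qed
  have ne: "S \<noteq> {}" using scaled[OF u0] by auto
  have bdd: "bdd_below S" unfolding S_def
    by (rule bdd_belowI[of _ 0]) (auto simp: orth_mem energy.form_nonneg)
  have lower: "\<mu> * ip u u \<le> E u u" if "u \<in> orth I \<phi>" for u
  proof (cases "ip u u > 0")
    case True
    then obtain e where "e \<in> S" "e * ip u u = E u u" using scaled \<open>u \<in> _\<close> by blast
    then show ?thesis using cInf_lower[OF _ bdd, of e] True unfolding \<mu>_def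
      by (metis mult_right_mono less_imp_le)
  next
    case False
    then have "ip u u = 0" using form_nonneg[OF orth_mem[OF that]] by simp
    then show ?thesis using energy.form_nonneg[OF orth_mem[OF that]] by simp
  qed
  have "\<exists>u. u \<in> orth I \<phi> \<and> ip u u = 1 \<and> E u u < \<mu> + 1 / real (Suc n)" for n
  proof -
    have "\<exists>e\<in>S. e < \<mu> + 1 / real (Suc n)"
      using cInf_lessD[OF ne, of "\<mu> + 1 / real (Suc n)"] by (auto simp: \<mu>_def)
    then show ?thesis by (auto simp: S_def)
  qed
  then obtain u where u: "\<And>n. u n \<in> orth I \<phi>" "\<And>n. ip (u n) (u n) = 1"
      "\<And>n. E (u n) (u n) < \<mu> + 1 / real (Suc n)" by metis
  have uH[simp]: "u n \<in> H" for n using u(1) orth_mem by blast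
  have low: "\<mu> \<le> E (u n) (u n)" for n using lower[OF u(1)] u(2) by simp
  have E_lim: "(\<lambda>n. E (u n) (u n)) \<longlonglongrightarrow> \<mu>"
  proof (rule tendsto_sandwich[OF _ _ tendsto_const])
    show "\<forall>\<^sub>F n in sequentially. \<mu> \<le> E (u n) (u n)" using low by simp
    show "\<forall>\<^sub>F n in sequentially. E (u n) (u n) \<le> \<mu> + 1 / real (Suc n)" using u(3) by (simp add: less_imp_le)
    show "(\<lambda>n. \<mu> + 1 / real (Suc n)) \<longlonglongrightarrow> \<mu>"
      using tendsto_add[OF tendsto_const[of \<mu>] LIMSEQ_Suc[OF lim_1_over_n]] by simp
  qed
  \<comment> \<open>Level \<open>\<mu> + 1\<close>: the parallelogram law puts \<open>\<mu>\<close>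
    times the squared distance on the right, so exactly one copy of it remains on the left.\<close>
  from poincare[of "\<mu> + 1"] obtain J :: "'a set set" and \<theta> C where P: "finite J \<and>
      (\<forall>j\<in>J. \<forall>u\<in>H. (\<theta> j u)^2 \<le> C * ip u u) \<and>
      (\<forall>j\<in>J. \<forall>u\<in>H. \<forall>v\<in>H. \<theta> j (\<lambda>x. u x - v x) = \<theta> j u - \<theta> j v) \<and>
      (\<forall>u\<in>H. (\<mu> + 1) * ip u u \<le> E u u + (\<Sum>j\<in>J. (\<theta> j u)^2))"
    by (elim exE) (rule that)
  then have J: "finite J"
    and lb: "\<And>j u. j \<in> J \<Longrightarrow> u \<in> H \<Longrightarrow> (\<theta> j u)^2 \<le> C * ip u u"
    and ld: "\<And>j u v. j \<in> J \<Longrightarrow> u \<in> H \<Longrightarrow> v \<in> H \<Longrightarrow> \<theta> j (\<lambda>x. u x - v x) = \<theta> j u - \<theta> j v"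
    and poin: "\<And>u. u \<in> H \<Longrightarrow> (\<mu> + 1) * ip u u \<le> E u u + (\<Sum>j\<in>J. (\<theta> j u)^2)"
    by simp_all
  have "bounded (range (\<lambda>n. \<theta> j (u n)))" if "j \<in> J" for j
  proof -
    have "\<bar>\<theta> j (u n)\<bar> \<le> sqrt C" for n
      using lb[OF that uH[of n]] u(2) by (simp add: real_le_rsqrt)
    then show ?thesis by (auto simp: bounded_iff)
  qed
  then obtain r where r: "strict_mono (r::nat\<Rightarrow>nat)" "\<And>j. j \<in> J \<Longrightarrow> convergent (\<lambda>n. \<theta> j (u (r n)))"
    using common_convergent_subseq[OF J, of "\<lambda>j n. \<theta> j (u n)"] by blast
  define U where "U n = u (r n)" for n
  let ?D = "\<lambda>m n. ip (\<lambda>x. U m x - U n x) (\<lambda>x. U m x - U n x)"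
  have UH[simp]: "U n \<in> H" for n by (simp add: U_def)
  have UE: "(\<lambda>n. E (U n) (U n)) \<longlonglongrightarrow> \<mu>"
    using LIMSEQ_subseq_LIMSEQ[OF E_lim r(1)] by (simp add: U_def o_def)
  have diff_bound: "?D m n \<le>
      2 * (E (U m) (U m) - \<mu>) + 2 * (E (U n) (U n) - \<mu>) + (\<Sum>j\<in>J. (\<theta> j (U m) - \<theta> j (U n))^2)" for m n
  proof -
    let ?d = "\<lambda>x. U m x - U n x" and ?s = "\<lambda>x. U m x + U n x"
    have "(\<mu> + 1) * ip ?d ?d \<le> E ?d ?d + (\<Sum>j\<in>J. (\<theta> j ?d)^2)"
      by (rule poin) (simp add: diff_mem)
    moreover have "(\<Sum>j\<in>J. (\<theta> j ?d)^2) = (\<Sum>j\<in>J. (\<theta> j (U m) - \<theta> j (U n))^2)"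
      by (intro sum.cong) (simp_all add: ld)
    moreover have "\<mu> * ip ?s ?s \<le> E ?s ?s"
      using lower[OF orth_comb[OF \<phi> u(1)[of "r m"] u(1)[of "r n"], of 1 1]] by (simp add: U_def)
    moreover have "ip ?d ?d + ip ?s ?s = 4" "E ?d ?d + E ?s ?s = 2 * E (U m) (U m) + 2 * E (U n) (U n)"
      using parallelogram[of "U m" "U n"] energy.parallelogram[of "U m" "U n"] u(2) by (simp_all add: U_def)
    moreover have "\<mu> * ip ?s ?s = \<mu> * 4 - \<mu> * ip ?d ?d"
      using calculation(4) by (metis add_diff_cancel_left' right_diff_distrib)
    ultimately show ?thesis by (simp add: algebra_simps)
  qed
  have cauchy: "\<exists>M. \<forall>m\<ge>M. \<forall>n\<ge>M. ?D m n < e" if "e > 0" for e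
  proof -
    define l where "l j = lim (\<lambda>n. \<theta> j (U n))" for j
    have l: "(\<lambda>n. \<theta> j (U n)) \<longlonglongrightarrow> l j" if "j \<in> J" for j
      using r(2)[OF that] by (simp add: U_def l_def convergent_LIMSEQ_iff)
    \<comment> \<open>Splitting at the limits \<open>l j\<close> bounds the squared distance by one
      null sequence evaluated at \<open>m\<close> and at \<open>n\<close>.\<close>
    define a where "a n = 2 * (E (U n) (U n) - \<mu>) + (\<Sum>j\<in>J. 2 * (\<theta> j (U n) - l j)^2)" for n
    have "a \<longlonglongrightarrow> 2 * (\<mu> - \<mu>) + (\<Sum>j\<in>J. 2 * (l j - l j)^2)"
      unfolding a_def by (intro tendsto_intros UE l)
    then have "a \<longlonglongrightarrow> 0" by simp
    then obtain M where M: "\<And>n. n \<ge> M \<Longrightarrow> \<bar>a n\<bar> < e / 2"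
      using \<open>e > 0\<close> LIMSEQ_D[of a 0 "e/2"] by auto
    have "?D m n \<le> a m + a n" for m n
    proof -
      have "(\<theta> j (U m) - \<theta> j (U n))^2 \<le> 2 * (\<theta> j (U m) - l j)^2 + 2 * (\<theta> j (U n) - l j)^2" for j
      proof -
        have "0 \<le> ((\<theta> j (U m) - l j) + (\<theta> j (U n) - l j))^2" by simp
        then show ?thesis by (simp add: power2_eq_square algebra_simps)
      qed
      then have "(\<Sum>j\<in>J. (\<theta> j (U m) - \<theta> j (U n))^2) \<le>
          (\<Sum>j\<in>J. 2 * (\<theta> j (U m) - l j)^2 + 2 * (\<theta> j (U n) - l j)^2)" by (intro sum_mono)
      then show ?thesis using diff_bound[of m n] by (simp add: a_def sum.distrib)
    qed
    then show ?thesis using M by (intro exI[of _ M]) (smt (verit) field_sum_of_halves)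
  qed
  obtain v where v: "v \<in> H" "(\<lambda>n. ip (\<lambda>x. U n x - v x) (\<lambda>x. U n x - v x)) \<longlonglongrightarrow> 0" "E v v \<le> \<mu>"
    using closed[of U, OF UH cauchy UE] by blast
  have "ip v (\<phi> i) = 0" if "i \<in> I" for i
  proof -
    have "(\<lambda>n. ip (U n) (\<phi> i)) \<longlonglongrightarrow> ip v (\<phi> i)"
      using v \<phi>[OF that] by (intro ip_tendsto) auto
    moreover have "ip (U n) (\<phi> i) = 0" for n using u(1) that by (simp add: U_def orth_def)
    ultimately show ?thesis by (simp add: LIMSEQ_const_iff)
  qed
  then have vO: "v \<in> orth I \<phi>" using v by (simp add: orth_def)
  have "(\<lambda>n. ip (U n) (U n)) \<longlonglongrightarrow> ip v v" using v by (intro ip_self_tendsto) auto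
  then have v1: "ip v v = 1" using u(2) by (simp add: U_def LIMSEQ_const_iff)
  have "E v v = \<mu>" using v(3) lower[OF vO] v1 by simp
  then show ?thesis using vO v1 lower u0(1) by blast
qed

section \<open>Eigenvectors, multiplicity and the variational principle\<close>

definition eig :: "real \<Rightarrow> ('a \<Rightarrow> real) set" where
  "eig \<mu> = {u \<in> H. \<forall>w\<in>H. E u w = \<mu> * ip u w}"

definition mult :: "real \<Rightarrow> nat \<Rightarrow> bool" where
  "mult \<mu> m \<longleftrightarrow> (\<exists>b. (\<forall>j<m. b j \<in> eig \<mu>) \<and>
     (\<forall>c. ip (\<lambda>x. \<Sum>j<m. c j * b j x) (\<lambda>x. \<Sum>j<m. c j * b j x) = 0 \<longrightarrow> (\<forall>j<m. c j = (0::real))) \<and>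
     (\<forall>u\<in>eig \<mu>. \<exists>c. ip (\<lambda>x. u x - (\<Sum>j<m. c j * b j x)) (\<lambda>x. u x - (\<Sum>j<m. c j * b j x)) = 0))"

definition orthonormal :: "'i set \<Rightarrow> ('i \<Rightarrow> 'a \<Rightarrow> real) \<Rightarrow> bool" where
  "orthonormal I \<phi> \<longleftrightarrow> (\<forall>i\<in>I. \<phi> i \<in> H) \<and> (\<forall>i\<in>I. \<forall>j\<in>I. ip (\<phi> i) (\<phi> j) = (if i = j then 1 else 0))"

lemma orthonormal_insert:
  assumes on: "orthonormal I \<phi>" and k: "k \<notin> I"
    and v: "v \<in> H" "ip v v = 1" "\<And>i. i \<in> I \<Longrightarrow> ip v (\<phi> i) = 0"
  shows "orthonormal (insert k I) (\<phi>(k := v))"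
proof -
  have mem: "\<phi> i \<in> H" and neq: "i \<noteq> k" if "i \<in> I" for i
    using on k that by (auto simp: orthonormal_def)
  have sym: "ip (\<phi> i) v = 0" if "i \<in> I" for i
    using v(3)[OF that] form_sym[OF v(1) mem[OF that]] by simp
  show ?thesis
    unfolding orthonormal_def
  proof (intro conjI ballI)
    fix i assume "i \<in> insert k I"
    then show "(\<phi>(k := v)) i \<in> H" using mem v(1) by auto
  next
    fix i j assume i: "i \<in> insert k I" and j: "j \<in> insert k I"
    show "ip ((\<phi>(k := v)) i) ((\<phi>(k := v)) j) = (if i = j then 1 else 0)"
    proof (cases "i = k")
      case True
      then show ?thesis using j v(2,3) k by (cases "j = k") auto
    next
      case False
      then have "i \<in> I" using i by simp
      then show ?thesis using False j sym on by (cases "j = k") (auto simp: orthonormal_def)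
    qed
  qed
qed

lemma orthonormal_subset: "orthonormal I \<phi> \<Longrightarrow> J \<subseteq> I \<Longrightarrow> orthonormal J \<phi>"
  unfolding orthonormal_def by blast

lemma eig_mem: "u \<in> eig \<mu> \<Longrightarrow> u \<in> H" by (simp add: eig_def)
lemma eig_form: "u \<in> eig \<mu> \<Longrightarrow> w \<in> H \<Longrightarrow> E u w = \<mu> * ip u w" by (simp add: eig_def)

lemma eig_sum: "finite I \<Longrightarrow> (\<And>i. i \<in> I \<Longrightarrow> u i \<in> eig \<mu>) \<Longrightarrow> (\<lambda>x. \<Sum>i\<in>I. c i * u i x) \<in> eig \<mu>"
  by (simp add: eig_def sum_mem form_sum energy.form_sum sum_distrib_left mult_ac)

lemma eig_orthogonal:
  assumes "u \<in> eig \<mu>" "v \<in> eig \<nu>" "\<mu> \<noteq> \<nu>"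
  shows "ip u v = 0"
proof -
  have "\<mu> * ip u v = \<nu> * ip u v"
    using eig_form[OF assms(1) eig_mem[OF assms(2)]] eig_form[OF assms(2) eig_mem[OF assms(1)]]
      energy.form_sym[OF eig_mem[OF assms(1)] eig_mem[OF assms(2)]]
      form_sym[OF eig_mem[OF assms(1)] eig_mem[OF assms(2)]] by metis
  then show ?thesis using assms(3) by simp
qed

text \<open>Variation within the orthogonal complement gives the weak equation for test functions
  there. From a general \<open>w\<close> the projection \<open>p\<close> is split off; both sides
  vanish on \<open>p\<close>, a combination of eigenvectors orthogonal to \<open>v\<close>.\<close>

lemma minimizer_is_eigenvector:
  assumes I: "finite I" and on: "orthonormal I \<phi>" and eig: "\<And>i. i \<in> I \<Longrightarrow> \<phi> i \<in> eig (l i)"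
    and v: "v \<in> orth I \<phi>" "ip v v = 1" and min: "\<And>u. u \<in> orth I \<phi> \<Longrightarrow> E v v * ip u u \<le> E u u"
  shows "v \<in> eig (E v v)"
proof -
  let ?\<mu> = "E v v"
  have \<phi>H: "\<phi> i \<in> H" if "i \<in> I" for i using on that by (simp add: orthonormal_def)
  have vH: "v \<in> H" using v(1) by (rule orth_mem)
  have orth: "E v w = ?\<mu> * ip v w" if w: "w \<in> orth I \<phi>" for w
  proof -
    have wH: "w \<in> H" using w by (rule orth_mem)
    have "(E w w - ?\<mu> * ip w w) * t^2 + 2 * (E v w - ?\<mu> * ip v w) * t \<ge> 0" for t
      using min[OF orth_comb[OF \<phi>H v(1) w, of 1 t]]
        form_comb_self[OF vH wH, of 1 t] energy.form_comb_self[OF vH wH, of 1 t] v(2)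
      by (simp add: algebra_simps)
    from linear_coeff_zero_if_nonneg[OF this] show ?thesis by simp
  qed
  have "E v w = ?\<mu> * ip v w" if w: "w \<in> H" for w
  proof -
    define p where "p = (\<lambda>x. \<Sum>i\<in>I. ip w (\<phi> i) * \<phi> i x)"
    have pH: "p \<in> H" unfolding p_def using I \<phi>H by (rule sum_mem)
    have ip_p: "ip p (\<phi> i) = ip w (\<phi> i)" if "i \<in> I" for i
    proof -
      have "ip p (\<phi> i) = (\<Sum>j\<in>I. ip w (\<phi> j) * ip (\<phi> j) (\<phi> i))"
        unfolding p_def using I \<phi>H that by (intro form_sum) auto
      also have "\<dots> = (\<Sum>j\<in>I. if j = i then ip w (\<phi> i) else 0)"
        using on that by (intro sum.cong) (auto simp: orthonormal_def)
      finally show ?thesis using I that by simp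
    qed
    have "(\<lambda>x. w x - p x) \<in> orth I \<phi>"
      using w pH \<phi>H by (simp add: orth_def diff_mem form_diff ip_p)
    from orth[OF this] have "E v w - E v p = ?\<mu> * (ip v w - ip v p)"
      using vH w pH by (simp add: form_diff_right energy.form_diff_right)
    moreover have "ip v p = 0"
      unfolding p_def using I \<phi>H vH v(1) by (subst form_sum_right) (auto simp: orth_def)
    moreover have "E v p = 0"
    proof -
      have "E v (\<phi> i) = 0" if "i \<in> I" for i
        using eig_form[OF eig[OF that] vH] v(1) that \<phi>H[OF that] vH
        by (simp add: orth_def energy.form_sym[of v] form_sym[of "\<phi> i" v])
      then show ?thesis
        unfolding p_def using I \<phi>H vH by (subst energy.form_sum_right) auto
    qed
    ultimately show ?thesis by simp
  qed
  then show ?thesis using vH unfolding eig_def by blast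
qed

lemma null_sum_zero:
  assumes "ip v v = 0" "v \<in> H" "w \<in> H"
  shows "ip v w = 0"
  using cauchy_schwarz[OF assms(2,3)] assms(1) by simp

text \<open>More than \<open>m\<close> members would admit a nontrivial combination whose
  coordinates in the spanning family all vanish. It would be null, although orthonormality makes its
  pairing with some member nonzero.\<close>

lemma orthonormal_card_le_mult:
  assumes m: "mult \<mu> m" and I: "finite I" and on: "orthonormal I \<phi>" and eig: "\<And>i. i \<in> I \<Longrightarrow> \<phi> i \<in> eig \<mu>"
  shows "card I \<le> m"
proof (rule ccontr)
  assume "\<not> card I \<le> m"
  then have lt: "m < card I" by simp
  from m obtain b where b: "\<And>j. j<m \<Longrightarrow> b j \<in> eig \<mu>"
    and sp: "\<And>u. u\<in>eig \<mu> \<Longrightarrow> \<exists>c. ip (\<lambda>x. u x - (\<Sum>j<m. c j * b j x)) (\<lambda>x. u x - (\<Sum>j<m. c j * b j x)) = 0"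
    unfolding mult_def by blast
  obtain h where h: "bij_betw h {..<card I} I" using I by (metis bij_betw_from_nat_into_finite)
  define q where "q = card I"
  have hI: "h i \<in> I" if "i < q" for i using h that by (auto simp: bij_betw_def q_def)
  have \<phi>H: "\<phi> (h i) \<in> H" if "i < q" for i using on hI[OF that] by (simp add: orthonormal_def)
  define c where "c i = (SOME c. ip (\<lambda>x. \<phi> (h i) x - (\<Sum>j<m. c j * b j x)) (\<lambda>x. \<phi> (h i) x - (\<Sum>j<m. c j * b j x)) = 0)" for i
  have c: "ip (\<lambda>x. \<phi> (h i) x - (\<Sum>j<m. c i j * b j x)) (\<lambda>x. \<phi> (h i) x - (\<Sum>j<m. c i j * b j x)) = 0"
    if "i < q" for i
    unfolding c_def by (rule someI_ex[OF sp[OF eig[OF hI[OF that]]]])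
  obtain d where d: "\<exists>i<q. d i \<noteq> 0" "\<forall>j<m. (\<Sum>i<q. d i * c i j) = 0"
    using homogeneous_system_nontrivial[of m q "\<lambda>j i. c i j"] lt q_def by auto
  define S where "S i = (\<lambda>x. \<Sum>j<m. c i j * b j x)" for i
  have SH: "S i \<in> H" for i unfolding S_def using b by (intro sum_mem) (auto intro: eig_mem)
  \<comment> \<open>In this form \<open>z\<close> is a combination of null functions; the choice of
    \<open>d\<close> removes the \<open>S i\<close> and leaves a combination of the
    \<open>\<phi> (h i)\<close> alone.\<close>
  define z where "z = (\<lambda>x. \<Sum>i<q. d i * (\<phi> (h i) x - S i x))"
  have z_eq: "z = (\<lambda>x. \<Sum>i<q. d i * \<phi> (h i) x)"
  proof
    fix x
    have "(\<Sum>i<q. d i * S i x) = (\<Sum>j<m. (\<Sum>i<q. d i * c i j) * b j x)"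
      unfolding S_def sum_distrib_left sum_distrib_right by (subst sum.swap) (simp add: mult_ac)
    also have "\<dots> = 0" using d(2) by simp
    finally show "z x = (\<Sum>i<q. d i * \<phi> (h i) x)" by (simp add: z_def right_diff_distrib sum_subtractf)
  qed
  obtain i where i: "i < q" "d i \<noteq> 0" using d(1) by auto
  have "ip z (\<phi> (h i)) = (\<Sum>k<q. d k * ip (\<lambda>x. \<phi> (h k) x - S k x) (\<phi> (h i)))"
    unfolding z_def using \<phi>H SH i by (intro form_sum) (auto simp: diff_mem)
  also have "\<dots> = 0"
  proof (intro sum.neutral ballI)
    fix k assume "k \<in> {..<q}"
    then have k: "k < q" by simp
    have "ip (\<lambda>x. \<phi> (h k) x - S k x) (\<phi> (h i)) = 0"
      by (rule null_sum_zero) (use c[OF k] \<phi>H SH k i in \<open>simp_all add: S_def diff_mem\<close>)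
    then show "d k * ip (\<lambda>x. \<phi> (h k) x - S k x) (\<phi> (h i)) = 0" by simp
  qed
  finally have "ip z (\<phi> (h i)) = 0" .
  moreover have "ip z (\<phi> (h i)) = (\<Sum>k<q. d k * ip (\<phi> (h k)) (\<phi> (h i)))"
    unfolding z_eq using \<phi>H i by (intro form_sum) auto
  moreover have "\<dots> = (\<Sum>k<q. if k = i then d k else 0)"
  proof (intro sum.cong refl)
    fix k assume "k \<in> {..<q}"
    then have "ip (\<phi> (h k)) (\<phi> (h i)) = (if h k = h i then 1 else 0)"
      using on hI i by (simp add: orthonormal_def)
    moreover have "h k = h i \<longleftrightarrow> k = i" using h i \<open>k \<in> _\<close> by (auto simp: bij_betw_def inj_on_def q_def)
    ultimately show "d k * ip (\<phi> (h k)) (\<phi> (h i)) = (if k = i then d k else 0)" by simp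
  qed
  ultimately show False using i by simp
qed

text \<open>The \<open>m\<close> coefficients outnumber the orthogonality conditions, so some
  nontrivial combination satisfies them all; independence makes it non-null, hence
  normalisable.\<close>

lemma eigenvector_extension:
  assumes m: "mult \<mu> m" and I: "finite I" "\<And>i. i \<in> I \<Longrightarrow> \<phi> i \<in> H"
    and lt: "card I < m"
  shows "\<exists>v\<in>eig \<mu>. ip v v = 1 \<and> (\<forall>i\<in>I. ip v (\<phi> i) = 0)"
proof -
  from m obtain b where b: "\<And>j. j<m \<Longrightarrow> b j \<in> eig \<mu>"
    and ind: "\<And>c. ip (\<lambda>x. \<Sum>j<m. c j * b j x) (\<lambda>x. \<Sum>j<m. c j * b j x) = 0 \<Longrightarrow> \<forall>j<m. c j = (0::real)"
    unfolding mult_def by blast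
  obtain h where h: "bij_betw h {..<card I} I" using I(1) by (metis bij_betw_from_nat_into_finite)
  obtain c where c: "\<exists>j<m. c j \<noteq> 0" "\<forall>i<card I. (\<Sum>j<m. c j * ip (b j) (\<phi> (h i))) = 0"
    using homogeneous_system_nontrivial[OF lt, of "\<lambda>i j. ip (b j) (\<phi> (h i))"] by blast
  define v where "v = (\<lambda>x. \<Sum>j<m. c j * b j x)"
  have v: "v \<in> eig \<mu>" unfolding v_def using b by (intro eig_sum) auto
  have vH: "v \<in> H" using v by (rule eig_mem)
  have "ip v v \<noteq> 0" using ind[of c] c(1) unfolding v_def by blast
  then have pos: "ip v v > 0" using form_nonneg[OF vH] by simp
  have orth: "ip v (\<phi> i) = 0" if "i \<in> I" for i
  proof -
    have "i \<in> h ` {..<card I}" using bij_betw_imp_surj_on[OF h] that by simp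
    then obtain k where k: "k < card I" "h k = i" by blast
    have "ip v (\<phi> i) = (\<Sum>j<m. c j * ip (b j) (\<phi> i))"
      unfolding v_def using b I that by (intro form_sum) (auto intro: eig_mem)
    then show ?thesis using c(2) k by auto
  qed
  let ?v = "\<lambda>x. (1 / sqrt (ip v v)) * v x"
  have "ip ?v ?v = 1" using vH pos
    by (simp only: form_scale form_scale_right scale_mem) (simp add: field_simps)
  moreover have "?v \<in> eig \<mu>" using eig_sum[of "{0::nat}" "\<lambda>_. v" \<mu> "\<lambda>_. 1 / sqrt (ip v v)"] v by simp
  moreover have "\<forall>i\<in>I. ip ?v (\<phi> i) = 0" using form_scale[OF vH I(2)] orth by (metis mult_zero_right)
  ultimately show ?thesis by blast
qed

text \<open>Only earlier vectors with the same eigenvalue have to be avoided, the others being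
  orthogonal by symmetry of both forms. They are fewer than the multiplicity, because index
  \<open>Suc k\<close> itself is counted in it.\<close>

theorem orthonormal_eigenvectors:
  fixes lam :: "nat \<Rightarrow> real"
  assumes mult: "\<And>i. 1 \<le> i \<Longrightarrow> finite {j. 1 \<le> j \<and> lam j = lam i} \<and> mult (lam i) (card {j. 1 \<le> j \<and> lam j = lam i})"
  shows "\<exists>\<phi>. orthonormal {1..k} \<phi> \<and> (\<forall>i\<in>{1..k}. \<phi> i \<in> eig (lam i))"
proof (induction k)
  case 0 then show ?case by (auto simp: orthonormal_def)
next
  case (Suc k)
  then obtain \<phi> where on: "orthonormal {1..k} \<phi>" and eig: "\<And>i. i\<in>{1..k} \<Longrightarrow> \<phi> i \<in> eig (lam i)" by blast
  let ?M = "{j. 1 \<le> j \<and> lam j = lam (Suc k)}"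
  define I where "I = {i\<in>{1..k}. lam i = lam (Suc k)}"
  have M: "finite ?M" "mult (lam (Suc k)) (card ?M)" using mult[of "Suc k"] by auto
  have "I \<subseteq> ?M" "Suc k \<in> ?M" "Suc k \<notin> I" by (auto simp: I_def)
  then have "I \<subset> ?M" by blast
  then have lt: "card I < card ?M" using M(1) by (rule psubset_card_mono[rotated])
  obtain v where v: "v \<in> eig (lam (Suc k))" "ip v v = 1" "\<forall>i\<in>I. ip v (\<phi> i) = 0"
    using eigenvector_extension[OF M(2) _ _ lt, of \<phi>] on by (auto simp: I_def orthonormal_def)
  have ort: "ip v (\<phi> i) = 0" if "i \<in> {1..k}" for i
  proof (cases "lam i = lam (Suc k)")
    case True then show ?thesis using that v(3) by (auto simp: I_def)
  next
    case False then show ?thesis using eig_orthogonal[OF v(1) eig[OF that]] by simp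
  qed
  have vH: "v \<in> H" using v(1) by (rule eig_mem)
  have "orthonormal (insert (Suc k) {1..k}) (\<phi>(Suc k := v))"
    using ort by (intro orthonormal_insert on vH v(2)) auto
  then have "orthonormal {1..Suc k} (\<phi>(Suc k := v))" by (simp add: atLeastAtMostSuc_conv)
  moreover have "\<forall>i\<in>{1..Suc k}. (\<phi>(Suc k := v)) i \<in> eig (lam i)"
    using eig v(1) by (auto simp: atLeastAtMostSuc_conv)
  ultimately show ?case by blast
qed

text \<open>One half of the min-max principle, from the enumeration alone: a minimiser with value
  \<open>\<mu> < lam k\<close> would be an eigenvector orthogonal to all the listed eigenvectors of
  \<open>\<mu>\<close> and exceed its multiplicity. If \<open>\<mu>\<close> does not occur in the
  list, that multiplicity is 0 and the same count applies.\<close>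

theorem spectral_gap:
  fixes lam :: "nat \<Rightarrow> real"
  assumes mono: "mono_on {1..} lam"
    and complete: "\<And>\<mu>. (\<exists>u\<in>eig \<mu>. ip u u \<noteq> 0) \<Longrightarrow> finite {j. 1 \<le> j \<and> lam j = \<mu>} \<and> mult \<mu> (card {j. 1 \<le> j \<and> lam j = \<mu>})"
    and on: "orthonormal {1..k} \<phi>" and eig: "\<And>i. i\<in>{1..k} \<Longrightarrow> \<phi> i \<in> eig (lam i)"
    and u: "u \<in> orth {1..k} \<phi>" and k: "1 \<le> k"
  shows "lam k * ip u u \<le> E u u"
proof (rule ccontr)
  assume "\<not> ?thesis"
  then have less: "E u u < lam k * ip u u" by simp
  have uH: "u \<in> H" using u by (rule orth_mem)
  have "ip u u \<noteq> 0" using less energy.form_nonneg[OF uH] by auto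
  then have pos: "ip u u > 0" using form_nonneg[OF uH] by simp
  have \<phi>H: "\<phi> i \<in> H" if "i \<in> {1..k}" for i using on that by (simp add: orthonormal_def)
  obtain v where v: "v \<in> orth {1..k} \<phi>" "ip v v = 1" "E v v * ip u u \<le> E u u"
      "\<And>u. u\<in>orth {1..k} \<phi> \<Longrightarrow> E v v * ip u u \<le> E u u"
    using minimizer_exists[OF \<phi>H u pos] by auto
  define \<mu> where "\<mu> = E v v"
  have veig: "v \<in> eig \<mu>" unfolding \<mu>_def
    by (rule minimizer_is_eigenvector[OF _ on eig v(1,2,4)]) simp
  have mu_less: "\<mu> < lam k" using less v(3) pos unfolding \<mu>_def by (smt (verit) mult_right_mono)
  let ?M = "{j. 1 \<le> j \<and> lam j = \<mu>}"
  have M: "finite ?M" "mult \<mu> (card ?M)" using complete[of \<mu>] veig v(2) by (metis zero_neq_one)+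
  \<comment> \<open>Monotonicity puts every index with value \<open>\<mu> < lam k\<close> before
    \<open>k\<close>, so \<open>\<phi>\<close> already supplies as many orthonormal eigenvectors of
    \<open>\<mu>\<close> as its multiplicity.\<close>
  have sub: "?M \<subseteq> {1..k}"
  proof
    fix j assume j: "j \<in> ?M"
    show "j \<in> {1..k}"
    proof (rule ccontr)
      assume "j \<notin> {1..k}"
      then have "k \<le> j" using j by auto
      then have "lam k \<le> lam j" using mono k j by (auto simp: mono_on_def)
      then show False using j mu_less by simp
    qed
  qed
  have vH: "v \<in> H" using v(1) by (rule orth_mem)
  have ort: "ip v (\<phi> i) = 0" if "i \<in> ?M" for i
    using v(1) that sub unfolding orth_def by blast
  \<comment> \<open>\<open>Suc k\<close> serves only as a fresh label for \<open>v\<close>.\<close>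
  have nin: "Suc k \<notin> ?M" using sub by auto
  have "orthonormal (insert (Suc k) ?M) (\<phi>(Suc k := v))"
    by (rule orthonormal_insert[OF orthonormal_subset[OF on sub] nin vH v(2) ort])
  moreover have "(\<phi>(Suc k := v)) i \<in> eig \<mu>" if "i \<in> insert (Suc k) ?M" for i
  proof (cases "i = Suc k")
    case False
    then have i: "i \<in> ?M" using that by blast
    then have "i \<in> {1..k}" using sub by blast
    then show ?thesis using eig[of i] i False by simp
  qed (use veig in simp)
  ultimately have "card (insert (Suc k) ?M) \<le> card ?M"
    using M(1) orthonormal_card_le_mult[OF M(2)] by (metis (no_types, lifting) finite_insert)
  moreover have "Suc k \<notin> ?M" using sub by auto
  ultimately show False using M(1) by simp
qed

text \<open>Both forms split without cross terms along the projection \<open>p\<close>, since the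
  eigenvectors diagonalise them simultaneously. On the remainder the gap makes
  \<open>\<Lambda> * ip - E\<close> nonpositive, and on \<open>p\<close> it equals the weighted
  sum.\<close>

theorem weighted_bessel:
  fixes lam :: "nat \<Rightarrow> real"
  assumes I: "finite I" and on: "orthonormal I \<phi>" and eig: "\<And>i. i\<in>I \<Longrightarrow> \<phi> i \<in> eig (lam i)"
    and gap: "\<And>u. u \<in> orth I \<phi> \<Longrightarrow> \<Lambda> * ip u u \<le> E u u" and f: "f \<in> H"
  shows "\<Lambda> * ip f f - E f f \<le> (\<Sum>i\<in>I. (\<Lambda> - lam i) * (ip f (\<phi> i))^2)"
proof -
  have \<phi>H: "\<phi> i \<in> H" if "i \<in> I" for i using on that by (simp add: orthonormal_def)
  define a where "a i = ip f (\<phi> i)" for i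
  define p where "p = (\<lambda>x. \<Sum>i\<in>I. a i * \<phi> i x)"
  have pH: "p \<in> H" unfolding p_def using I \<phi>H by (rule sum_mem)
  have ip_p: "ip p (\<phi> i) = a i" if "i \<in> I" for i
  proof -
    have "ip p (\<phi> i) = (\<Sum>j\<in>I. a j * ip (\<phi> j) (\<phi> i))"
      unfolding p_def using I \<phi>H that by (intro form_sum) auto
    also have "\<dots> = (\<Sum>j\<in>I. if j = i then a i else 0)"
      using on that by (intro sum.cong) (auto simp: orthonormal_def)
    finally show ?thesis using I that by simp
  qed
  have g: "(\<lambda>x. f x - p x) \<in> orth I \<phi>"
    using f pH \<phi>H by (simp add: orth_def diff_mem form_diff ip_p a_def)
  have fp: "ip f p = (\<Sum>i\<in>I. (a i)^2)"
    unfolding p_def using I \<phi>H f by (subst form_sum_right) (auto simp: a_def power2_eq_square)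
  have pp: "ip p p = (\<Sum>i\<in>I. (a i)^2)"
  proof -
    have "ip p p = (\<Sum>i\<in>I. a i * ip p (\<phi> i))"
      by (subst (2) p_def) (use I \<phi>H pH in \<open>intro form_sum_right\<close>)
    then show ?thesis using ip_p by (simp add: power2_eq_square)
  qed
  have Ef: "E w p = (\<Sum>i\<in>I. lam i * (a i * ip w (\<phi> i)))" if w: "w \<in> H" for w
  proof -
    have "E w p = (\<Sum>i\<in>I. a i * E w (\<phi> i))"
      unfolding p_def using I \<phi>H w by (intro energy.form_sum_right) auto
    also have "\<dots> = (\<Sum>i\<in>I. lam i * (a i * ip w (\<phi> i)))"
    proof (intro sum.cong refl)
      fix i assume i: "i \<in> I"
      show "a i * E w (\<phi> i) = lam i * (a i * ip w (\<phi> i))"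
        using eig_form[OF eig[OF i] w] energy.form_sym[OF w \<phi>H[OF i]] form_sym[OF w \<phi>H[OF i]] by simp
    qed
    finally show ?thesis .
  qed
  have fpE: "E f p = (\<Sum>i\<in>I. lam i * (a i)^2)" using Ef[OF f] by (simp add: a_def power2_eq_square)
  have ppE: "E p p = (\<Sum>i\<in>I. lam i * (a i)^2)" using Ef[OF pH] ip_p by (simp add: power2_eq_square)
  have "\<Lambda> * (ip f f - (\<Sum>i\<in>I. (a i)^2)) \<le> E f f - (\<Sum>i\<in>I. lam i * (a i)^2)"
    using gap[OF g] form_diff_self[OF f pH] energy.form_diff_self[OF f pH] fp pp fpE ppE by simp
  then show ?thesis
    by (simp add: a_def[symmetric] left_diff_distrib sum_subtractf sum_distrib_left[symmetric] algebra_simps)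
qed

end

section \<open>Gaussian integrals and the Plancherel inequality\<close>

lemma integral_product_fst_snd:
  fixes f :: "'a \<Rightarrow> real" and g :: "'b \<Rightarrow> real"
  assumes "sigma_finite_measure M" "sigma_finite_measure N" and f: "integrable M f" and g: "integrable N g"
  shows "integrable (M \<Otimes>\<^sub>M N) (\<lambda>p. f (fst p) * g (snd p))"
    and "(LINT p|(M \<Otimes>\<^sub>M N). f (fst p) * g (snd p)) = integral\<^sup>L M f * integral\<^sup>L N g"
proof -
  interpret pair_sigma_finite M N using assms by (intro pair_sigma_finite.intro)
  have [measurable]: "f \<in> borel_measurable M" "g \<in> borel_measurable N" using f g by auto
  show 1: "integrable (M \<Otimes>\<^sub>M N) (\<lambda>p. f (fst p) * g (snd p))"
    using f g by (intro Fubini_integrable) (auto simp: abs_mult)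
  show "(LINT p|(M \<Otimes>\<^sub>M N). f (fst p) * g (snd p)) = integral\<^sup>L M f * integral\<^sup>L N g"
    using integral_fst'[OF 1] by simp
qed

text \<open>The characteristic function of the standard normal distribution, rescaled by
  \<open>sqrt (2 * t)\<close>.\<close>

lemma gaussian_fourier_1:
  fixes a t :: real
  assumes t: "t > 0"
  shows "has_bochner_integral lborel (\<lambda>x. iexp (a * x) * exp (- t * x^2)) (complex_of_real (sqrt (pi / t) * exp (- (a^2) / (4 * t))))"
proof -
  let ?c = "sqrt (2 * t)"
  have c: "?c \<noteq> 0" "?c > 0" using t by auto
  have c2: "(?c * x)^2 / 2 = t * x^2" for x using t by (simp add: power_mult_distrib)
  define u where "u = a / ?c"
  have uc: "u * (?c * x) = a * x" for x using c by (simp add: u_def)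
  let ?f = "\<lambda>x. std_normal_density x *\<^sub>R iexp (u * x)"
  have f: "integrable lborel ?f"
    by (rule Bochner_Integration.integrable_bound[of _ std_normal_density]) auto
  have "char std_normal_distribution u = (LINT x|lborel. ?f x)"
    unfolding char_def by (subst integral_density) auto
  then have F: "(LINT x|lborel. ?f x) = exp (- (u^2) / 2)"
    by (simp add: char_std_normal_distribution)
  have eq: "?f (0 + ?c * x) = complex_of_real (1 / sqrt (2 * pi)) * (iexp (a * x) * exp (- t * x^2))" for x
  proof -
    have "exp (- ((?c * x)^2) / 2) = exp (- t * x^2)" using c2[of x] by simp
    then show ?thesis
      unfolding add_0 uc std_normal_density_def scaleR_conv_of_real by (simp only: of_real_mult mult_ac)
  qed
  have int: "integrable lborel (\<lambda>x. iexp (a * x) * exp (- t * x^2))"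
  proof -
    have "integrable lborel (\<lambda>x. complex_of_real (sqrt (2 * pi)) * ?f (0 + ?c * x))"
      by (intro integrable_mult_right lborel_integrable_real_affine f c)
    moreover have "complex_of_real (sqrt (2 * pi)) * (complex_of_real (1 / sqrt (2 * pi)) * z) = z" for z
      by (simp add: mult.assoc[symmetric] flip: of_real_mult)
    ultimately show ?thesis unfolding eq by simp
  qed
  have "(LINT x|lborel. ?f x) = ?c *\<^sub>R (LINT x|lborel. ?f (0 + ?c * x))"
    using lborel_integral_real_affine[OF c(1), of ?f 0] c by simp
  also have "\<dots> = complex_of_real (?c / sqrt (2 * pi)) * (LINT x|lborel. iexp (a * x) * exp (- t * x^2))"
    unfolding eq by (simp add: scaleR_conv_of_real)
  finally have "complex_of_real (sqrt (t / pi)) * (LINT x|lborel. iexp (a * x) * exp (- t * x^2)) = exp (- (u^2) / 2)"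
    using F by (simp add: real_sqrt_divide[symmetric])
  moreover have "u^2 / 2 = a^2 / (4 * t)" using t by (simp add: u_def power_divide)
  ultimately have "complex_of_real (sqrt (t / pi)) * (LINT x|lborel. iexp (a * x) * exp (- t * x^2)) = exp (- (a^2) / (4*t))"
    by simp
  then have "complex_of_real (sqrt (pi / t)) * (complex_of_real (sqrt (t / pi)) * (LINT x|lborel. iexp (a * x) * exp (- t * x^2)))
     = complex_of_real (sqrt (pi / t)) * exp (- (a^2) / (4*t))" by simp
  moreover have "sqrt (pi / t) * sqrt (t / pi) = 1" using t by (simp add: real_sqrt_mult[symmetric])
  then have "complex_of_real (sqrt (pi / t)) * (complex_of_real (sqrt (t / pi)) * z) = z" for z
    by (metis (no_types) mult.assoc mult_1 of_real_1 of_real_mult)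
  ultimately show ?thesis using int by (auto simp: has_bochner_integral_iff)
qed

lemma norm_sq_Basis: "(norm x)^2 = (\<Sum>b\<in>Basis. (x \<bullet> b)^2)"
  unfolding power2_norm_eq_inner by (subst euclidean_inner) (simp add: power2_eq_square)

text \<open>Both exponentials factor over the coordinates, and \<open>lborel\<close> is the image of
  a product of one-dimensional measures.\<close>

lemma gaussian_fourier:
  fixes \<xi> :: "'a::euclidean_space"
  assumes t: "t > 0"
  shows "has_bochner_integral lborel (\<lambda>x. iexp (\<xi> \<bullet> x) * exp (- t * (norm x)^2))
      (complex_of_real ((pi / t) powr (DIM('a) / 2) * exp (- ((norm \<xi>)^2) / (4 * t))))"
proof -
  interpret product_sigma_finite "\<lambda>_::'a. lborel :: real measure" by standard
  define f where "f b = (\<lambda>x::real. iexp ((\<xi> \<bullet> b) * x) * exp (- t * x^2))" for b :: 'a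
  let ?P = "\<Pi>\<^sub>M b\<in>(Basis::'a set). (lborel :: real measure)"
  let ?T = "\<lambda>f. \<Sum>b\<in>(Basis::'a set). f b *\<^sub>R b"
  have T[measurable]: "?T \<in> ?P \<rightarrow>\<^sub>M borel" by measurable
  have fi: "integrable lborel (f b)" "integral\<^sup>L lborel (f b) = complex_of_real (sqrt (pi / t) * exp (- ((\<xi> \<bullet> b)^2) / (4 * t)))" for b
    using gaussian_fourier_1[OF t, of "\<xi> \<bullet> b"] by (auto simp: f_def has_bochner_integral_iff)
  let ?g = "\<lambda>x. iexp (\<xi> \<bullet> x) * exp (- t * (norm x)^2)"
  have g[measurable]: "?g \<in> borel_measurable borel"
    by (intro borel_measurable_continuous_onI continuous_intros)
  have eq: "?g (?T y) = (\<Prod>b\<in>Basis. f b (y b))" for y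
  proof -
    have "\<xi> \<bullet> ?T y = (\<Sum>b\<in>Basis. (\<xi> \<bullet> b) * y b)" by (simp add: inner_sum_right mult.commute)
    moreover have "(norm (?T y))^2 = (\<Sum>b\<in>Basis. (y b)^2)"
      by (simp add: norm_sq_Basis)
    ultimately have "?g (?T y) = exp (\<Sum>b\<in>Basis. \<i> * ((\<xi> \<bullet> b) * y b) + complex_of_real (- t * (y b)^2))"
      by (simp add: exp_add[symmetric] exp_of_real[symmetric] sum_subtractf sum_negf sum_distrib_left)
    also have "\<dots> = (\<Prod>b\<in>Basis. f b (y b))"
      by (subst exp_sum) (auto simp: f_def exp_add[symmetric] exp_of_real[symmetric] intro!: prod.cong)
    finally show ?thesis .
  qed
  have int: "integrable ?P (\<lambda>y. ?g (?T y))" unfolding eq by (intro product_integrable_prod fi) auto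
  have "(LINT y|?P. ?g (?T y)) = (\<Prod>b\<in>Basis. complex_of_real (sqrt (pi / t) * exp (- ((\<xi> \<bullet> b)^2) / (4 * t))))"
    unfolding eq by (subst product_integral_prod) (auto simp: fi)
  also have "\<dots> = complex_of_real (\<Prod>b\<in>(Basis::'a set). sqrt (pi / t) * exp (- ((\<xi> \<bullet> b)^2) / (4 * t)))" by simp
  also have "(\<Prod>b\<in>(Basis::'a set). sqrt (pi / t) * exp (- ((\<xi> \<bullet> b)^2) / (4 * t)))
     = sqrt (pi / t) ^ DIM('a) * exp (\<Sum>b\<in>(Basis::'a set). - ((\<xi> \<bullet> b)^2) / (4 * t))"
    by (simp add: prod.distrib exp_sum)
  also have "(\<Sum>b\<in>(Basis::'a set). - ((\<xi> \<bullet> b)^2) / (4 * t)) = - ((norm \<xi>)^2) / (4 * t)"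
    by (simp add: norm_sq_Basis sum_divide_distrib sum_negf)
  also have "sqrt (pi / t) ^ DIM('a) = (pi / t) powr (DIM('a) / 2)"
    using t by (simp add: powr_half_sqrt[symmetric] powr_realpow[symmetric] powr_powr)
  finally have val: "(LINT y|?P. ?g (?T y)) = complex_of_real ((pi / t) powr (DIM('a) / 2) * exp (- ((norm \<xi>)^2) / (4 * t)))" .
  have "integrable (lborel::'a measure) ?g"
    by (subst lborel_eq) (use int T g in \<open>simp add: integrable_distr_eq\<close>)
  moreover have "integral\<^sup>L (lborel::'a measure) ?g = (LINT y|?P. ?g (?T y))"
    by (subst lborel_eq) (use T g in \<open>simp add: integral_distr\<close>)
  ultimately show ?thesis using val by (simp add: has_bochner_integral_iff)
qed

lemma gaussian_cos:
  fixes \<xi> :: "'a::euclidean_space"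
  assumes t: "t > 0"
  shows "has_bochner_integral lborel (\<lambda>x. cos (\<xi> \<bullet> x) * exp (- t * (norm x)^2))
      ((pi / t) powr (DIM('a) / 2) * exp (- ((norm \<xi>)^2) / (4 * t)))"
proof -
  have "has_bochner_integral lborel (\<lambda>x. Re (iexp (\<xi> \<bullet> x) * exp (- t * (norm x)^2)))
      (Re (complex_of_real ((pi / t) powr (DIM('a) / 2) * exp (- ((norm \<xi>)^2) / (4 * t)))))"
    by (rule has_bochner_integral_Re) (rule gaussian_fourier[OF t])
  moreover have "Re (iexp (\<xi> \<bullet> x) * exp (- t * (norm x)^2)) = cos (\<xi> \<bullet> x) * exp (- t * (norm x)^2)" for x
  proof -
    have "Re (iexp (\<xi> \<bullet> x) * complex_of_real r) = cos (\<xi> \<bullet> x) * r" for r by (simp add: Re_exp)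
    from this[of "exp (- t * (norm x)^2)"] show ?thesis by (simp only: exp_of_real)
  qed
  ultimately show ?thesis by simp
qed

lemma gaussian_integral:
  assumes t: "t > 0"
  shows "has_bochner_integral lborel (\<lambda>x::'a::euclidean_space. exp (- t * (norm x)^2)) ((pi / t) powr (DIM('a) / 2))"
  using gaussian_cos[OF t, of "0::'a"] by simp

section \<open>Kernel integrals that yield the symbol of the fractional Laplacian\<close>

lemma nn_integral_powr_exp:
  fixes p a :: real
  assumes p: "p > 0" and a: "a > 0"
  shows "(\<integral>\<^sup>+t. ennreal (t powr (p - 1) * exp (- a * t)) * indicator {0<..} t \<partial>lborel) = ennreal (Gamma p * a powr (- p))"
proof -
  let ?g = "\<lambda>t. ennreal (t powr (p - 1) * exp (- a * t)) * indicator {0<..} t"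
  let ?f = "\<lambda>t::real. ennreal (indicator {0..} t * t powr (p - 1) / exp t)"
  have f[measurable]: "?f \<in> borel_measurable borel" by measurable
  have "ennreal (Gamma p) = (\<integral>\<^sup>+t. ?f t \<partial>lborel)" using Gamma_conv_nn_integral_real[OF p] by simp
  also have "\<dots> = ennreal \<bar>a\<bar> * (\<integral>\<^sup>+t. ?f (0 + a * t) \<partial>lborel)"
    using a by (intro nn_integral_real_affine) auto
  also have "(\<integral>\<^sup>+t. ?f (0 + a * t) \<partial>lborel)
     = (\<integral>\<^sup>+t. ennreal (a powr (p - 1)) * (?g t) \<partial>lborel)"
  proof (intro nn_integral_cong_AE AE_I[where N = "{0}"])
    show "{t \<in> space lborel. \<not> ?f (0 + a * t) =
        ennreal (a powr (p - 1)) * (?g t)} \<subseteq> {0}"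
    proof safe
      fix t :: real assume "\<not> ?f (0 + a * t) = ennreal (a powr (p - 1)) * (?g t)"
      then show "t = 0"
      proof (rule contrapos_np)
        assume "t \<noteq> 0"
        then show "?f (0 + a * t) = ennreal (a powr (p - 1)) * (?g t)"
          using a by (cases "t > 0")
            (auto simp: indicator_def zero_le_mult_iff powr_mult exp_minus divide_inverse ennreal_mult[symmetric] mult_ac)
      qed
    qed
  qed auto
  also have "\<dots> = ennreal (a powr (p - 1)) * (\<integral>\<^sup>+t. ?g t \<partial>lborel)"
    by (intro nn_integral_cmult) measurable
  finally have "ennreal (Gamma p) = ennreal (a powr p) * (\<integral>\<^sup>+t. ?g t \<partial>lborel)"
    (is "_ = _ * ?I")
    using a by (simp add: mult.assoc[symmetric] ennreal_mult[symmetric] powr_mult_base)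
  then have "ennreal (a powr (- p)) * ennreal (Gamma p) = ennreal (a powr (- p)) * ennreal (a powr p) * ?I"
    by (simp add: mult.assoc)
  also have "ennreal (a powr (- p)) * ennreal (a powr p) = 1"
    using a by (simp add: ennreal_mult[symmetric] powr_add[symmetric])
  finally show ?thesis using p Gamma_real_pos[of p] by (simp add: ennreal_mult mult.commute less_imp_le)
qed

lemma nn_integral_powr_Ioo:
  fixes p c :: real
  assumes p: "p > 0" and c: "c \<ge> 0"
  shows "(\<integral>\<^sup>+t. ennreal (t powr (p - 1)) * indicator {0<..<c} t \<partial>lborel) = ennreal (c powr p / p)"
proof -
  have "(\<integral>\<^sup>+t. ennreal (t powr (p - 1)) * indicator {0<..<c} t \<partial>lborel) = (\<integral>\<^sup>+t. ennreal (t powr (p - 1)) * indicator {0..c} t \<partial>lborel)"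
  proof (rule nn_integral_cong_AE)
    have "AE t in lborel. t \<noteq> 0 \<and> t \<noteq> c" using AE_lborel_singleton[of 0] AE_lborel_singleton[of c] by eventually_elim auto
    then show "AE t in lborel. ennreal (t powr (p - 1)) * indicator {0<..<c} t = ennreal (t powr (p - 1)) * indicator {0..c} t"
      by eventually_elim (auto simp: indicator_def)
  qed
  also have "\<dots> = ennreal (c powr (p - 1 + 1) / (p - 1 + 1))"
    using p c by (intro nn_integral_has_integral_lebesgue' has_integral_powr_from_0) auto
  finally show ?thesis by simp
qed

lemma nn_integral_exp_Ioo:
  fixes c :: real
  assumes c: "c \<ge> 0"
  shows "(\<integral>\<^sup>+v. ennreal (exp (- v)) * indicator {0<..<c} v \<partial>lborel) = ennreal (1 - exp (- c))"
proof -
  have "(\<integral>\<^sup>+t. ennreal (exp (- t)) * indicator {0<..<c} t \<partial>lborel) = (\<integral>\<^sup>+t. ennreal (exp (- t)) * indicator {0..c} t \<partial>lborel)"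
  proof (rule nn_integral_cong_AE)
    have "AE t in lborel. t \<noteq> 0 \<and> t \<noteq> c" using AE_lborel_singleton[of 0] AE_lborel_singleton[of c] by eventually_elim auto
    then show "AE t in lborel. ennreal (exp (- t)) * indicator {0<..<c} t = ennreal (exp (- t)) * indicator {0..c} t"
      by eventually_elim (auto simp: indicator_def)
  qed
  also have "\<dots> = ennreal (- exp (- c) - (- exp (- 0)))"
    using c by (intro nn_integral_FTC_Icc) (auto intro!: derivative_eq_intros)
  finally show ?thesis by simp
qed

text \<open>With \<open>1 - exp (- b / t)\<close> written as the integral of
  \<open>exp (- v)\<close> over \<open>0 < v < b / t\<close>, the order of integration is exchanged:
  the condition becomes \<open>t < b / v\<close>, which leaves a pure power in \<open>t\<close> and
  then a Gamma integral in \<open>v\<close>.\<close>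

lemma nn_integral_one_minus_exp:
  fixes b s :: real
  assumes s: "0 < s" "s < 1" and b: "b \<ge> 0"
  shows "(\<integral>\<^sup>+t. ennreal (t powr (s - 1) * (1 - exp (- b / t))) * indicator {0<..} t \<partial>lborel)
     = ennreal (b powr s * Gamma (1 - s) / s)"
proof -
  let ?F = "\<lambda>t v. ennreal (t powr (s - 1)) * indicator {0<..} t * (ennreal (exp (- v)) * indicator {0<..<b/t} v)"
  have "(\<integral>\<^sup>+t. ennreal (t powr (s - 1) * (1 - exp (- b / t))) * indicator {0<..} t \<partial>lborel)
    = (\<integral>\<^sup>+t. (\<integral>\<^sup>+v. ?F t v \<partial>lborel) \<partial>lborel)"
  proof (intro nn_integral_cong)
    fix t :: real
    show "ennreal (t powr (s - 1) * (1 - exp (- b / t))) * indicator {0<..} t =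
       (\<integral>\<^sup>+v. ?F t v \<partial>lborel)"
      using b nn_integral_exp_Ioo[of "b/t"]
      by (cases "t > 0") (auto simp: nn_integral_cmult ennreal_mult)
  qed
  also have "\<dots> = (\<integral>\<^sup>+v. (\<integral>\<^sup>+t. ?F t v \<partial>lborel) \<partial>lborel)"
    by (rule lborel_pair.Fubini') (measurable; simp only: greaterThanLessThan_iff; measurable)
  also have "\<dots> = (\<integral>\<^sup>+v. ennreal (b powr s / s) * (ennreal (v powr ((1 - s) - 1) * exp (- 1 * v)) * indicator {0<..} v) \<partial>lborel)"
  proof (intro nn_integral_cong)
    fix v :: real
    show "(\<integral>\<^sup>+t. ?F t v \<partial>lborel)
      = ennreal (b powr s / s) * (ennreal (v powr ((1 - s) - 1) * exp (- 1 * v)) * indicator {0<..} v)"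
    proof (cases "v > 0")
      case True
      have "(\<integral>\<^sup>+t. ?F t v \<partial>lborel)
        = (\<integral>\<^sup>+t. ennreal (exp (- v)) * (ennreal (t powr (s - 1)) * indicator {0<..<b/v} t) \<partial>lborel)"
        using True by (intro nn_integral_cong) (auto simp: indicator_def field_simps)
      also have "\<dots> = ennreal (exp (- v)) * ennreal ((b / v) powr s / s)"
        using True s b by (subst nn_integral_cmult) (auto simp: nn_integral_powr_Ioo)
      also have "\<dots> = ennreal (b powr s / s) * ennreal (v powr (- s) * exp (- v))"
        using True s b by (simp add: ennreal_mult[symmetric] powr_divide powr_minus powr_mult inverse_powr field_simps)
      finally show ?thesis using True by simp
    qed simp
  qed
  also have "\<dots> = ennreal (b powr s / s) * ennreal (Gamma (1 - s) * 1 powr (- (1 - s)))"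
    using s nn_integral_powr_exp[of "1 - s" 1] by (subst nn_integral_cmult) auto
  also have "\<dots> = ennreal (b powr s * Gamma (1 - s) / s)"
    using s Gamma_real_pos[of "1 - s"] by (simp add: ennreal_mult[symmetric] less_imp_le)
  finally show ?thesis .
qed

text \<open>Gaussian subordination:
  \<open>\<Gamma>(\<beta>) \<bar>z\<bar>\<^sup>-\<^sup>2\<^sup>\<beta> = \<integral>\<^sub>0\<^sup>\<infinity> t\<^sup>\<beta>\<^sup>-\<^sup>1 exp(-t\<bar>z\<bar>\<^sup>2) dt\<close> with \<open>\<beta> = N/2 + s\<close>.\<close>

theorem nn_integral_one_minus_cos:
  fixes \<xi> :: "'a::euclidean_space" and s :: real
  assumes s: "0 < s" "s < 1"
  shows "(\<integral>\<^sup>+z. ennreal ((1 - cos (\<xi> \<bullet> z)) / norm z powr (real DIM('a) + 2 * s)) \<partial>lborel)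
     = ennreal (norm \<xi> powr (2 * s) / frac_const DIM('a) s)"
proof -
  define N where "N = real DIM('a)"
  have N: "N > 0" by (simp add: N_def)
  define \<beta> where "\<beta> = (N + 2 * s) / 2"
  have \<beta>: "\<beta> > 0" using N s by (simp add: \<beta>_def)
  have G: "Gamma \<beta> > 0" using \<beta> by (rule Gamma_real_pos)
  define F where "F = (\<lambda>(z::'a) (t::real). ennreal (1 - cos (\<xi> \<bullet> z)) * (ennreal (t powr (\<beta> - 1) * exp (- ((norm z)^2) * t)) * indicator {0<..} t))"
  have F[measurable]: "case_prod F \<in> borel_measurable (lborel \<Otimes>\<^sub>M lborel)"
    unfolding F_def by measurable
  have "ennreal (Gamma \<beta>) * (\<integral>\<^sup>+z. ennreal ((1 - cos (\<xi> \<bullet> z)) / norm z powr (N + 2 * s)) \<partial>lborel)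
      = (\<integral>\<^sup>+z. ennreal (Gamma \<beta>) * ennreal ((1 - cos (\<xi> \<bullet> z)) / norm z powr (N + 2 * s)) \<partial>lborel)"
    by (rule nn_integral_cmult[symmetric]) measurable
  also have "\<dots> = (\<integral>\<^sup>+z. (\<integral>\<^sup>+t. F z t \<partial>lborel) \<partial>lborel)"
  proof (intro nn_integral_cong)
    fix z :: 'a
    show "ennreal (Gamma \<beta>) * ennreal ((1 - cos (\<xi> \<bullet> z)) / norm z powr (N + 2 * s)) = (\<integral>\<^sup>+t. F z t \<partial>lborel)"
    proof (cases "z = 0")
      case False
      have "(\<integral>\<^sup>+t. F z t \<partial>lborel) = ennreal (1 - cos (\<xi> \<bullet> z)) * ennreal (Gamma \<beta> * ((norm z)^2) powr (- \<beta>))"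
        unfolding F_def using False nn_integral_powr_exp[OF \<beta>, of "(norm z)^2"] by (subst nn_integral_cmult) auto
      also have "((norm z)^2) powr (- \<beta>) = (norm z powr 2) powr (- \<beta>)" using False by simp
      also have "\<dots> = norm z powr (- (N + 2 * s))" unfolding powr_powr
        by (rule arg_cong[where f = "\<lambda>e. norm z powr e"]) (simp add: \<beta>_def field_simps)
      also have "\<dots> = 1 / norm z powr (N + 2 * s)" by (rule powr_minus_divide)
      finally show ?thesis using G by (simp add: ennreal_mult[symmetric] mult_ac)
    qed (simp add: F_def)
  qed
  also have "\<dots> = (\<integral>\<^sup>+t. (\<integral>\<^sup>+z. F z t \<partial>lborel) \<partial>lborel)"
    by (rule lborel_pair.Fubini'[symmetric]) (use F in simp)
  also have "\<dots> = (\<integral>\<^sup>+t. ennreal (pi powr (N / 2)) * (ennreal (t powr (s - 1) * (1 - exp (- ((norm \<xi>)^2 / 4) / t))) * indicator {0<..} t) \<partial>lborel)"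
  proof (intro nn_integral_cong)
    fix t :: real
    show "(\<integral>\<^sup>+z. F z t \<partial>lborel) = ennreal (pi powr (N / 2)) * (ennreal (t powr (s - 1) * (1 - exp (- ((norm \<xi>)^2 / 4) / t))) * indicator {0<..} t)"
    proof (cases "t > 0")
      case True
      have "has_bochner_integral lborel (\<lambda>z::'a. exp (- t * (norm z)^2) - cos (\<xi> \<bullet> z) * exp (- t * (norm z)^2))
         ((pi / t) powr (N / 2) - (pi / t) powr (N / 2) * exp (- ((norm \<xi>)^2) / (4 * t)))"
        unfolding N_def by (intro has_bochner_integral_diff gaussian_integral gaussian_cos True)
      then have hb: "has_bochner_integral lborel (\<lambda>z::'a. (1 - cos (\<xi> \<bullet> z)) * exp (- t * (norm z)^2))
         ((pi / t) powr (N / 2) * (1 - exp (- ((norm \<xi>)^2) / (4 * t))))"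
        by (simp add: algebra_simps)
      have "(\<integral>\<^sup>+z. F z t \<partial>lborel) = (\<integral>\<^sup>+z. ennreal (t powr (\<beta> - 1)) * ennreal ((1 - cos (\<xi> \<bullet> z)) * exp (- t * (norm z)^2)) \<partial>lborel)"
        using True by (intro nn_integral_cong) (simp add: F_def ennreal_mult[symmetric] mult_ac)
      also have "\<dots> = ennreal (t powr (\<beta> - 1)) * ennreal ((pi / t) powr (N / 2) * (1 - exp (- ((norm \<xi>)^2) / (4 * t))))"
        using hb by (subst nn_integral_cmult) (auto simp: has_bochner_integral_iff nn_integral_eq_integral)
      also have "\<dots> = ennreal ((t powr (\<beta> - 1) * (pi / t) powr (N / 2)) * (1 - exp (- ((norm \<xi>)^2) / (4 * t))))"
        using True by (simp add: ennreal_mult[symmetric] mult_ac)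
      \<comment> \<open>The dimension drops out, as \<open>\<beta> - 1 - N / 2 = s - 1\<close>; what
        remains is the one-dimensional integral already evaluated.\<close>
      also have "t powr (\<beta> - 1) * (pi / t) powr (N / 2) = pi powr (N / 2) * t powr (s - 1)"
      proof -
        have "\<beta> - 1 = N / 2 + (s - 1)" by (simp add: \<beta>_def field_simps)
        then have "t powr (\<beta> - 1) = t powr (N / 2) * t powr (s - 1)" by (simp only: powr_add)
        then show ?thesis using True by (simp add: powr_divide)
      qed
      finally show ?thesis using True by (simp add: ennreal_mult[symmetric] mult_ac)
    qed (simp add: F_def)
  qed
  also have "\<dots> = ennreal (pi powr (N / 2)) * ennreal (((norm \<xi>)^2 / 4) powr s * Gamma (1 - s) / s)"
    using s nn_integral_one_minus_exp[of s "(norm \<xi>)^2 / 4"] by (subst nn_integral_cmult) auto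
  also have "((norm \<xi>)^2 / 4) powr s = norm \<xi> powr (2 * s) / 2 powr (2 * s)"
  proof -
    have "(norm \<xi>)^2 / 4 = (norm \<xi> / 2) powr 2" by (simp add: power_divide)
    then have "((norm \<xi>)^2 / 4) powr s = (norm \<xi> / 2) powr (2 * s)" by (simp only: powr_powr)
    then show ?thesis by (simp add: powr_divide)
  qed
  finally have eq: "ennreal (Gamma \<beta>) * (\<integral>\<^sup>+z. ennreal ((1 - cos (\<xi> \<bullet> z)) / norm z powr (N + 2 * s)) \<partial>lborel)
     = ennreal (pi powr (N / 2) * (norm \<xi> powr (2 * s) / 2 powr (2 * s) * Gamma (1 - s) / s))" (is "_ * ?I = _")
    using s Gamma_real_pos[of "1 - s"] by (simp add: ennreal_mult[symmetric] less_imp_le)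
  have "?I = ennreal (1 / Gamma \<beta>) * (ennreal (Gamma \<beta>) * ?I)"
    using G by (simp add: mult.assoc[symmetric] ennreal_mult[symmetric])
  also have "\<dots> = ennreal (1 / Gamma \<beta> * (pi powr (N / 2) * (norm \<xi> powr (2 * s) / 2 powr (2 * s) * Gamma (1 - s) / s)))"
    unfolding eq using G s Gamma_real_pos[of "1 - s"] by (intro ennreal_mult[symmetric]) (auto simp: less_imp_le)
  \<comment> \<open>Here the normalisation \<open>frac_const\<close> shows its purpose: it gives the
    operator the symbol \<open>norm \<xi> powr (2 * s)\<close> with coefficient one.\<close>
  also have "1 / Gamma \<beta> * (pi powr (N / 2) * (norm \<xi> powr (2 * s) / 2 powr (2 * s) * Gamma (1 - s) / s))
      = norm \<xi> powr (2 * s) / frac_const DIM('a) s"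
    using G s Gamma_real_pos[of "1 - s"]
    by (simp add: frac_const_def \<beta>_def N_def powr_minus field_simps)
  finally show ?thesis by (simp add: N_def)
qed


text \<open>Layer-cake formula in place of polar coordinates: the power is the integral of
  \<open>p * v powr (p - 1)\<close> up to \<open>norm \<xi>\<close>, and for fixed \<open>v\<close>
  what remains is the volume of a spherical shell.\<close>

lemma nn_integral_norm_powr_ball:
  fixes p r :: real
  assumes p: "p > 0" and r: "r > 0"
  shows "(\<integral>\<^sup>+\<xi>. ennreal (norm \<xi> powr p) * indicator (ball (0::'a::euclidean_space) r) \<xi> \<partial>lborel)
    = ennreal (unit_ball_vol DIM('a) * real DIM('a) / (real DIM('a) + p) * r powr (real DIM('a) + p))"
proof -
  define N where "N = real DIM('a)"
  define \<omega> where "\<omega> = unit_ball_vol N"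
  have N: "N > 0" by (simp add: N_def)
  have \<omega>: "\<omega> > 0" using N by (simp add: \<omega>_def)
  let ?F = "\<lambda>(\<xi>::'a) v. ennreal p * (ennreal (v powr (p - 1)) * indicator {v. 0 < v \<and> v < norm \<xi>} v) * indicator (ball (0::'a) r) \<xi>"
  let ?H = "\<lambda>v. ennreal (\<omega> * p * (r powr N * v powr (p - 1) - v powr (N + p - 1))) * indicator {0..r} v"
  have "(\<integral>\<^sup>+\<xi>. ennreal (norm \<xi> powr p) * indicator (ball (0::'a) r) \<xi> \<partial>lborel)
    = (\<integral>\<^sup>+\<xi>. (\<integral>\<^sup>+v. ?F \<xi> v \<partial>lborel) \<partial>lborel)"
  proof (intro nn_integral_cong)
    fix \<xi> :: 'a
    have "{v. 0 < v \<and> v < norm \<xi>} = {0<..<norm \<xi>}" by auto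
    then show "ennreal (norm \<xi> powr p) * indicator (ball (0::'a) r) \<xi> =
      (\<integral>\<^sup>+v. ?F \<xi> v \<partial>lborel)"
      using p nn_integral_powr_Ioo[of p "norm \<xi>"]
      by (simp add: nn_integral_cmult nn_integral_multc ennreal_mult[symmetric])
  qed
  also have "\<dots> = (\<integral>\<^sup>+v. (\<integral>\<^sup>+\<xi>. ?F \<xi> v \<partial>lborel) \<partial>lborel)"
    by (rule lborel_pair.Fubini'[symmetric]) (unfold indicator_def of_bool_def mem_Collect_eq mem_ball, measurable)
  also have "\<dots> = (\<integral>\<^sup>+v. ?H v \<partial>lborel)"
  proof (rule nn_integral_cong_AE)
    have ae: "AE v in lborel. v \<noteq> 0 \<and> v \<noteq> r"
      using AE_lborel_singleton[of 0] AE_lborel_singleton[of r] by eventually_elim auto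
    show "AE v in lborel. (\<integral>\<^sup>+\<xi>. ?F \<xi> v \<partial>lborel)
      = ?H v"
      using ae
    proof eventually_elim
      case (elim v)
      have "(\<integral>\<^sup>+\<xi>. ?F \<xi> v \<partial>lborel)
         = (\<integral>\<^sup>+\<xi>. ennreal (p * v powr (p - 1)) * indicator {0<..} v * indicator (ball (0::'a) r - cball 0 v) \<xi> \<partial>lborel)"
        using p by (intro nn_integral_cong) (auto simp: indicator_def ennreal_mult)
      also have "\<dots> = ennreal (p * v powr (p - 1)) * indicator {0<..} v * emeasure lborel (ball (0::'a) r - cball 0 v)"
        by (intro nn_integral_cmult_indicator) simp
      also have "\<dots> = ?H v"
      proof (cases "0 < v \<and> v < r")
        case True
        have "emeasure lborel (ball (0::'a) r - cball 0 v) = emeasure lborel (ball (0::'a) r) - emeasure lborel (cball (0::'a) v)"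
          using True by (intro emeasure_Diff) (auto simp: emeasure_cball)
        also have "\<dots> = ennreal (\<omega> * r powr N - \<omega> * v powr N)"
          using True by (simp add: emeasure_ball emeasure_cball \<omega>_def N_def powr_realpow ennreal_minus)
        finally show ?thesis using True p \<omega>
          by (simp add: ennreal_mult'[symmetric] powr_diff powr_add field_simps)
      next
        case False
        then consider "v < 0" | "v > r" using elim by linarith
        then show ?thesis
        proof cases
          case 2
          then have "ball (0::'a) r - cball 0 v = {}" by auto
          then show ?thesis using 2 by (simp only: emeasure_empty) simp
        qed simp
      qed
      finally show ?case .
    qed
  qed
  also have "\<dots> = ennreal (\<omega> * p * (r powr N * (r powr (p - 1 + 1) / (p - 1 + 1)) - r powr (N + p - 1 + 1) / (N + p - 1 + 1)))"
  proof (intro nn_integral_has_integral_lebesgue' has_integral_mult_right has_integral_diff has_integral_powr_from_0)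
    fix v assume v: "v \<in> {0..r}"
    have "v powr (N + p - 1) = v powr N * v powr (p - 1)" by (simp add: powr_add[symmetric] algebra_simps)
    also have "\<dots> \<le> r powr N * v powr (p - 1)" using v N by (intro mult_right_mono powr_mono2) auto
    finally show "0 \<le> \<omega> * p * (r powr N * v powr (p - 1) - v powr (N + p - 1))"
      using \<omega> p by simp
  qed (use p N r in auto)
  also have "\<omega> * p * (r powr N * (r powr (p - 1 + 1) / (p - 1 + 1)) - r powr (N + p - 1 + 1) / (N + p - 1 + 1))
     = \<omega> * N / (N + p) * r powr (N + p)"
  proof -
    have "p * (A / p - A / (N + p)) = N / (N + p) * A" for A
    proof -
      have "N + p \<noteq> 0" using p N by simp
      then show ?thesis using p by (simp add: right_diff_distrib) (simp add: field_simps)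
    qed
    from this[of "r powr (N + p)"] show ?thesis by (simp add: powr_add mult.assoc)
  qed
  finally show ?thesis by (simp add: N_def \<omega>_def)
qed

section \<open>Plancherel's inequality for real functions\<close>

lemma nn_integral_lborel_translate:
  fixes f :: "'a::euclidean_space \<Rightarrow> ennreal"
  assumes [measurable]: "f \<in> borel_measurable borel"
  shows "(\<integral>\<^sup>+x. f (c + x) \<partial>lborel) = (\<integral>\<^sup>+x. f x \<partial>lborel)"
  by (subst (2) lborel_distr_plus[of c, symmetric]) (simp add: nn_integral_distr)

lemma nn_integral_lborel_reflect:
  fixes f :: "'a::euclidean_space \<Rightarrow> ennreal"
  assumes [measurable]: "f \<in> borel_measurable borel"
  shows "(\<integral>\<^sup>+x. f (c - x) \<partial>lborel) = (\<integral>\<^sup>+x. f x \<partial>lborel)"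
proof -
  have "(lborel :: 'a measure) = distr lborel borel (\<lambda>x. c + (-1) *\<^sub>R x)"
    using lborel_affine[of "-1" c] by (simp add: density_1)
  then have "(\<integral>\<^sup>+x. f x \<partial>lborel) = (\<integral>\<^sup>+x. f x \<partial>distr lborel borel (\<lambda>x. c + (-1) *\<^sub>R x))" by simp
  also have "\<dots> = (\<integral>\<^sup>+x. f (c - x) \<partial>lborel)" by (subst nn_integral_distr) auto
  finally show ?thesis by simp
qed

text \<open>Squared modulus of the unnormalised Fourier transform of a real function, which is why
  Plancherel carries a power of \<open>2 * pi\<close>.\<close>

definition fourier_sq :: "('a::euclidean_space \<Rightarrow> real) \<Rightarrow> 'a \<Rightarrow> real" where
  "fourier_sq g \<xi> = (LINT x|lborel. g x * cos (\<xi> \<bullet> x))^2 + (LINT x|lborel. g x * sin (\<xi> \<bullet> x))^2"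

lemma fourier_sq_nonneg: "fourier_sq g \<xi> \<ge> 0"
  by (simp add: fourier_sq_def)

lemma borel_measurable_fourier_sq[measurable]:
  assumes [measurable]: "g \<in> borel_measurable borel"
  shows "fourier_sq g \<in> borel_measurable borel"
  unfolding fourier_sq_def by measurable

lemma fourier_sq_eq:
  assumes g: "integrable lborel g"
  shows "fourier_sq g \<xi> = (LINT p|(lborel \<Otimes>\<^sub>M lborel). g (fst p) * g (snd p) * cos (\<xi> \<bullet> (fst p - snd p)))"
proof -
  have [measurable]: "g \<in> borel_measurable borel" using g by auto
  have c: "integrable lborel (\<lambda>x. g x * cos (\<xi> \<bullet> x))"
    by (rule Bochner_Integration.integrable_bound[OF g]) (auto simp: abs_mult mult_left_le)
  have s: "integrable lborel (\<lambda>x. g x * sin (\<xi> \<bullet> x))"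
    by (rule Bochner_Integration.integrable_bound[OF g]) (auto simp: abs_mult mult_left_le)
  note C = integral_product_fst_snd[OF sigma_finite_lborel sigma_finite_lborel c c]
  note S = integral_product_fst_snd[OF sigma_finite_lborel sigma_finite_lborel s s]
  have "fourier_sq g \<xi> = (LINT p|(lborel \<Otimes>\<^sub>M lborel). g (fst p) * cos (\<xi> \<bullet> fst p) * (g (snd p) * cos (\<xi> \<bullet> snd p)) + g (fst p) * sin (\<xi> \<bullet> fst p) * (g (snd p) * sin (\<xi> \<bullet> snd p)))"
    unfolding Bochner_Integration.integral_add[OF C(1) S(1)] C(2) S(2) by (simp add: fourier_sq_def power2_eq_square)
  also have "\<dots> = (LINT p|(lborel \<Otimes>\<^sub>M lborel). g (fst p) * g (snd p) * cos (\<xi> \<bullet> (fst p - snd p)))"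
    by (intro Bochner_Integration.integral_cong) (auto simp: inner_diff_right cos_diff algebra_simps)
  finally show ?thesis .
qed

text \<open>Only an inequality is needed. Expanding the square and integrating in \<open>\<xi>\<close> first leaves
  \<open>\<integral>\<integral> g(x) g(y) G(x - y)\<close> with a positive Gaussian \<open>G\<close>, to which
  \<open>g(x) g(y) \<le> (g(x)\<^sup>2 + g(y)\<^sup>2)/2\<close> applies.\<close>

lemma plancherel_gaussian:
  fixes g :: "'a::euclidean_space \<Rightarrow> real"
  assumes g: "integrable lborel g" and g2: "integrable lborel (\<lambda>x. (g x)^2)" and e: "e > 0"
  shows "(\<integral>\<^sup>+\<xi>. ennreal (fourier_sq g \<xi> * exp (- e * (norm \<xi>)^2)) \<partial>lborel) \<le> ennreal ((2 * pi) powr DIM('a) * (LINT x|lborel. (g x)^2))"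
proof -
  have [measurable]: "g \<in> borel_measurable borel" using g by auto
  define N where "N = real DIM('a)"
  \<comment> \<open>\<open>G\<close> is the Fourier transform of the damping factor; its mass is
    \<open>(2 * pi) powr N\<close> for every \<open>e\<close>, so the bound survives the removal of
    the damping.\<close>
  define G where "G z = (pi / e) powr (N / 2) * exp (- ((norm z)^2) / (4 * e))" for z :: 'a
  have [measurable]: "G \<in> borel_measurable borel" unfolding G_def by measurable
  have G0: "G z \<ge> 0" for z by (simp add: G_def)
  have Gint: "(\<integral>\<^sup>+z. ennreal (G z) \<partial>lborel) = ennreal ((2 * pi) powr N)"
  proof -
    have "has_bochner_integral lborel (\<lambda>z::'a. (pi / e) powr (N / 2) * exp (- (1 / (4 * e)) * (norm z)^2)) ((pi / e) powr (N / 2) * (pi / (1 / (4 * e))) powr (N / 2))"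
      unfolding N_def using e by (intro has_bochner_integral_mult_right gaussian_integral) auto
    moreover have "(pi / e) powr (N / 2) * (pi / (1 / (4 * e))) powr (N / 2) = (2 * pi) powr N"
    proof -
      have "(pi / e) powr (N / 2) * (pi / (1 / (4 * e))) powr (N / 2) = ((2 * pi) powr 2) powr (N / 2)"
        using e by (subst powr_mult[symmetric]) (auto simp: power2_eq_square mult_ac)
      then show ?thesis by (simp only: powr_powr) simp
    qed
    ultimately have "has_bochner_integral lborel G ((2 * pi) powr N)"
      unfolding G_def by simp
    then show ?thesis using G0 by (simp add: has_bochner_integral_iff nn_integral_eq_integral)
  qed
  define P where "P = (lborel \<Otimes>\<^sub>M lborel :: ('a \<times> 'a) measure)"
  interpret P: sigma_finite_measure P unfolding P_def lborel_prod by (rule sigma_finite_lborel)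
  interpret LP: pair_sigma_finite lborel P ..
  define k where "k p = g (fst p) * g (snd p)" for p
  let ?H = "\<lambda>p. ((g (fst p))^2 / 2 + (g (snd p))^2 / 2) * G (fst p - snd p)" and ?J = "\<integral>\<^sup>+x. ennreal ((g x)^2 / 2) * ennreal ((2 * pi) powr N) \<partial>lborel"
  have kint: "integrable P k" unfolding k_def P_def
    by (rule integral_product_fst_snd(1)[OF sigma_finite_lborel sigma_finite_lborel g g])
  have [measurable]: "k \<in> borel_measurable P" using kint by auto
  let ?F = "\<lambda>\<xi> p. k p * cos (\<xi> \<bullet> (fst p - snd p)) * exp (- e * (norm \<xi>)^2)"
  have eint: "integrable lborel (\<lambda>\<xi>::'a. exp (- e * (norm \<xi>)^2))"
    using gaussian_integral[OF e, where 'a='a] by (simp add: has_bochner_integral_iff)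
  have Fint: "integrable (lborel \<Otimes>\<^sub>M P) (\<lambda>(\<xi>, p). ?F \<xi> p)"
  proof (rule Bochner_Integration.integrable_bound)
    show "integrable (lborel \<Otimes>\<^sub>M P) (\<lambda>q. exp (- e * (norm (fst q :: 'a))^2) * k (snd q))"
      by (rule integral_product_fst_snd(1)[OF sigma_finite_lborel P.sigma_finite_measure_axioms eint kint])
    have "(\<lambda>q. fst (snd q) - snd (snd q)) \<in> lborel \<Otimes>\<^sub>M P \<rightarrow>\<^sub>M (borel :: 'a measure)"
      unfolding P_def by measurable
    then show "(\<lambda>(\<xi>, p). ?F \<xi> p) \<in> borel_measurable (lborel \<Otimes>\<^sub>M P)" by measurable
    show "AE q in lborel \<Otimes>\<^sub>M P. norm (case q of (\<xi>, p) \<Rightarrow> ?F \<xi> p) \<le> norm (exp (- e * (norm (fst q :: 'a))^2) * k (snd q))"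
    proof (intro AE_I2)
      fix q :: "'a \<times> 'a \<times> 'a"
      have "\<bar>k (snd q)\<bar> * \<bar>cos (fst q \<bullet> (fst (snd q) - snd (snd q)))\<bar> \<le> \<bar>k (snd q)\<bar>"
        by (intro mult_left_le) auto
      then show "norm (case q of (\<xi>, p) \<Rightarrow> ?F \<xi> p) \<le> norm (exp (- e * (norm (fst q))^2) * k (snd q))"
        by (simp add: case_prod_beta abs_mult mult.commute[of "exp _"] mult_right_mono)
    qed
  qed
  have inner: "(LINT \<xi>|lborel. ?F \<xi> p) = k p * G (fst p - snd p)" for p
    using gaussian_cos[OF e, of "fst p - snd p"] by (simp add: has_bochner_integral_iff inner_commute mult.assoc G_def N_def)
  have fint: "integrable lborel (\<lambda>\<xi>. LINT p|P. ?F \<xi> p)" using LP.integrable_fst[OF Fint] .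
  have eqf: "(LINT p|P. ?F \<xi> p) = fourier_sq g \<xi> * exp (- e * (norm \<xi>)^2)" for \<xi>
    by (simp add: fourier_sq_eq[OF g] P_def k_def)
  have "(\<integral>\<^sup>+\<xi>. ennreal (fourier_sq g \<xi> * exp (- e * (norm \<xi>)^2)) \<partial>lborel) = ennreal (LINT \<xi>|lborel. (LINT p|P. ?F \<xi> p))"
    unfolding eqf by (intro nn_integral_eq_integral fint[unfolded eqf]) (auto simp: fourier_sq_nonneg)
  also have "(LINT \<xi>|lborel. (LINT p|P. ?F \<xi> p)) = (LINT p|P. (LINT \<xi>|lborel. ?F \<xi> p))"
    by (rule LP.Fubini_integral[OF Fint, symmetric])
  also have "\<dots> = (LINT p|P. k p * G (fst p - snd p))" unfolding inner ..
  also have "ennreal \<dots> \<le> (\<integral>\<^sup>+p. ennreal (?H p) \<partial>P)"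
  proof -
    have int: "integrable P (\<lambda>p. k p * G (fst p - snd p))" using LP.integrable_snd[OF Fint] unfolding inner .
    have "ennreal (LINT p|P. k p * G (fst p - snd p)) \<le> ennreal (norm (LINT p|P. k p * G (fst p - snd p)))"
      by (intro ennreal_leI) simp
    also have "\<dots> \<le> (\<integral>\<^sup>+p. norm (k p * G (fst p - snd p)) \<partial>P)" by (rule integral_norm_bound_ennreal[OF int])
    also have "\<dots> \<le> (\<integral>\<^sup>+p. ennreal (?H p) \<partial>P)"
    proof (intro nn_integral_mono ennreal_leI)
      fix p
      have "0 \<le> (\<bar>g (fst p)\<bar> - \<bar>g (snd p)\<bar>)^2" by simp
      then have "\<bar>k p\<bar> \<le> (g (fst p))^2 / 2 + (g (snd p))^2 / 2"
        by (simp add: power2_diff k_def abs_mult)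
      then show "norm (k p * G (fst p - snd p)) \<le> ?H p"
        using G0[of "fst p - snd p"] by (simp add: abs_mult mult_right_mono)
    qed
    finally show ?thesis .
  qed
  also have "\<dots> = (\<integral>\<^sup>+p. ennreal ((g (fst p))^2 / 2) * ennreal (G (fst p - snd p)) \<partial>P) + (\<integral>\<^sup>+p. ennreal ((g (snd p))^2 / 2) * ennreal (G (fst p - snd p)) \<partial>P)"
    unfolding P_def
    by (subst nn_integral_add[symmetric])
       (auto simp: ennreal_mult[symmetric] G0 ennreal_plus[symmetric] distrib_right simp del: ennreal_plus intro!: nn_integral_cong)
  also have "(\<integral>\<^sup>+p. ennreal ((g (fst p))^2 / 2) * ennreal (G (fst p - snd p)) \<partial>P) = ?J"
    unfolding P_def
    by (subst lborel.nn_integral_fst[symmetric])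
       (auto simp: nn_integral_cmult nn_integral_lborel_reflect[of "\<lambda>z. ennreal (G z)"] Gint)
  also have "(\<integral>\<^sup>+p. ennreal ((g (snd p))^2 / 2) * ennreal (G (fst p - snd p)) \<partial>P) = ?J"
    unfolding P_def
    by (subst lborel_pair.nn_integral_snd[symmetric])
       (auto simp: nn_integral_cmult Gint nn_integral_lborel_translate[of "\<lambda>z. ennreal (G z)" "- c" for c, simplified])
  also have "?J = ennreal ((LINT x|lborel. (g x)^2) / 2) * ennreal ((2 * pi) powr N)"
    using g2 by (subst nn_integral_multc) (auto simp: nn_integral_eq_integral)
  finally show ?thesis
    by (simp add: ennreal_mult[symmetric] ennreal_plus[symmetric] N_def mult.commute del: ennreal_plus)
qed

text \<open>On the ball the damping is at least \<open>exp (- e * r^2)\<close>, which the factor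
  \<open>exp (e * r^2)\<close> compensates; then \<open>e\<close> tends to 0.\<close>

theorem plancherel_ball_le:
  fixes g :: "'a::euclidean_space \<Rightarrow> real"
  assumes g: "integrable lborel g" and g2: "integrable lborel (\<lambda>x. (g x)^2)"
  shows "(\<integral>\<^sup>+\<xi>. ennreal (fourier_sq g \<xi>) * indicator (ball 0 r) \<xi> \<partial>lborel) \<le> ennreal ((2 * pi) powr DIM('a) * (LINT x|lborel. (g x)^2))"
    (is "?I \<le> ennreal ?B")
proof (rule LIMSEQ_le_const)
  have [measurable]: "g \<in> borel_measurable borel" using g by auto
  let ?e = "\<lambda>n. 1 / real (Suc n)"
  have "(\<lambda>n. exp (?e n * r^2) * ?B) \<longlonglongrightarrow> exp (0 * r^2) * ?B"
    by (intro tendsto_intros LIMSEQ_Suc[OF lim_1_over_n])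
  then show "(\<lambda>n. ennreal (exp (?e n * r^2) * ?B)) \<longlonglongrightarrow> ennreal ?B"
    by (intro tendsto_ennrealI) simp
  show "\<exists>N. \<forall>n\<ge>N. ?I \<le> ennreal (exp (?e n * r^2) * ?B)"
  proof (intro exI allI impI)
    fix n :: nat
    define e where "e = ?e n"
    have e: "e > 0" by (simp add: e_def)
    have "?I \<le> (\<integral>\<^sup>+\<xi>. ennreal (exp (e * r^2)) * ennreal (fourier_sq g \<xi> * exp (- e * (norm \<xi>)^2)) \<partial>lborel)"
    proof (intro nn_integral_mono)
      fix \<xi> :: 'a
      show "ennreal (fourier_sq g \<xi>) * indicator (ball 0 r) \<xi> \<le> ennreal (exp (e * r^2)) * ennreal (fourier_sq g \<xi> * exp (- e * (norm \<xi>)^2))"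
      proof (cases "\<xi> \<in> ball 0 r")
        case True
        then have "(norm \<xi>)^2 \<le> r^2" by (intro power_mono) auto
        then have "1 \<le> exp (e * r^2) * exp (- e * (norm \<xi>)^2)"
          using e by (simp add: exp_add[symmetric])
        then have "fourier_sq g \<xi> * 1 \<le> fourier_sq g \<xi> * (exp (e * r^2) * exp (- e * (norm \<xi>)^2))"
          by (intro mult_left_mono fourier_sq_nonneg)
        then show ?thesis using True by (simp add: ennreal_mult[symmetric] fourier_sq_nonneg mult_ac)
      qed simp
    qed
    also have "\<dots> = ennreal (exp (e * r^2)) * (\<integral>\<^sup>+\<xi>. ennreal (fourier_sq g \<xi> * exp (- e * (norm \<xi>)^2)) \<partial>lborel)"
      by (intro nn_integral_cmult) measurable
    also have "\<dots> \<le> ennreal (exp (e * r^2)) * ennreal ?B" by (intro mult_left_mono plancherel_gaussian g g2 e) simp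
    also have "\<dots> = ennreal (exp (e * r^2) * ?B)" by (subst ennreal_mult) auto
    finally show "?I \<le> ennreal (exp (?e n * r^2) * ?B)" by (simp add: e_def)
  qed
qed

section \<open>Convergence in \<open>L\<^sup>2\<close>\<close>

lemma sigma_finite_lebesgue: "sigma_finite_measure (lebesgue :: 'a::euclidean_space measure)"
proof
  obtain A :: "'a set set" where A: "countable A" "A \<subseteq> sets lborel" "\<Union>A = space lborel" "\<forall>a\<in>A. emeasure lborel a \<noteq> \<infinity>"
    using lborel.sigma_finite_countable by blast
  then show "\<exists>A::'a set set. countable A \<and> A \<subseteq> sets lebesgue \<and> \<Union>A = space lebesgue \<and> (\<forall>a\<in>A. emeasure lebesgue a \<noteq> \<infinity>)"
    by (intro exI[of _ A]) (auto simp: emeasure_completion subset_eq)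
qed

definition square_integrable :: "'a measure \<Rightarrow> ('a \<Rightarrow> real) \<Rightarrow> bool" where
  "square_integrable M f \<longleftrightarrow> f \<in> borel_measurable M \<and> integrable M (\<lambda>x. (f x)^2)"

lemma square_integrable_measurable: "square_integrable M f \<Longrightarrow> f \<in> borel_measurable M"
  by (simp add: square_integrable_def)

lemma square_integrable_iff_nn_integral:
  "square_integrable M f \<longleftrightarrow> f \<in> borel_measurable M \<and> (\<integral>\<^sup>+x. ennreal ((f x)^2) \<partial>M) < \<infinity>"
  unfolding square_integrable_def integrable_iff_bounded by auto

lemma square_integrable_mult:
  assumes "square_integrable M f" "square_integrable M g"
  shows "integrable M (\<lambda>x. f x * g x)"
proof (rule Bochner_Integration.integrable_bound)
  show "integrable M (\<lambda>x. (f x)^2 + (g x)^2)" using assms by (auto simp: square_integrable_def)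
  show "(\<lambda>x. f x * g x) \<in> borel_measurable M" using assms by (auto simp: square_integrable_def)
  have "\<bar>a * b\<bar> \<le> \<bar>a^2 + b^2\<bar>" for a b :: real
  proof -
    have "0 \<le> (\<bar>a\<bar> - \<bar>b\<bar>)^2" by simp
    also have "\<dots> = a^2 + b^2 - 2 * \<bar>a * b\<bar>" by (simp add: power2_diff abs_mult)
    finally show ?thesis by linarith
  qed
  then show "AE x in M. norm (f x * g x) \<le> norm ((f x)^2 + (g x)^2)" by simp
qed

lemma square_integrable_comb:
  assumes "square_integrable M f" "square_integrable M g"
  shows "square_integrable M (\<lambda>x. a * f x + b * g x)"
proof -
  have "integrable M (\<lambda>x. a^2 * (f x)^2 + 2 * a * b * (f x * g x) + b^2 * (g x)^2)"
    using assms square_integrable_mult[OF assms] by (auto simp: square_integrable_def)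
  moreover have "a^2 * (f x)^2 + 2 * a * b * (f x * g x) + b^2 * (g x)^2 = (a * f x + b * g x)^2" for x
    by (simp add: power2_eq_square algebra_simps)
  ultimately show ?thesis using assms by (auto simp: square_integrable_def)
qed

text \<open>A nonnegative multiple of an \<open>L\<^sup>2\<close> product pulled back along a linear
  map is positive semidefinite. The energy uses \<open>gagliardo s\<close> for that map, the plain
  product the identity.\<close>

lemma psd_form_integral:
  assumes zero: "(\<lambda>x. 0) \<in> H"
    and comb: "\<And>a b u v. u \<in> H \<Longrightarrow> v \<in> H \<Longrightarrow> (\<lambda>x. a * u x + b * v x) \<in> H"
    and T: "\<And>u. u \<in> H \<Longrightarrow> square_integrable M (T u)"
    and T_lin: "\<And>a b u v x. u \<in> H \<Longrightarrow> v \<in> H \<Longrightarrow> T (\<lambda>x. a * u x + b * v x) x = a * T u x + b * T v x"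
    and c: "c \<ge> 0"
    and B: "\<And>u v. u \<in> H \<Longrightarrow> v \<in> H \<Longrightarrow> B u v = c * (LINT x|M. T u x * T v x)"
  shows "psd_form H B"
proof
  fix a b u v w assume u: "u \<in> H" and v: "v \<in> H" and w: "w \<in> H"
  have "(LINT x|M. T (\<lambda>x. a * u x + b * v x) x * T w x) = (LINT x|M. a * (T u x * T w x) + b * (T v x * T w x))"
    using u v by (simp add: T_lin algebra_simps)
  also have "\<dots> = a * (LINT x|M. T u x * T w x) + b * (LINT x|M. T v x * T w x)"
    using square_integrable_mult[OF T[OF u] T[OF w]] square_integrable_mult[OF T[OF v] T[OF w]] by simp
  finally show "B (\<lambda>x. a * u x + b * v x) w = a * B u w + b * B v w"
    using u v w comb by (simp add: B algebra_simps)
next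
  fix u v assume "u \<in> H" "v \<in> H"
  then show "B u v = B v u" by (simp add: B mult.commute)
next
  fix u assume "u \<in> H"
  then show "0 \<le> B u u" using c by (simp add: B)
qed (use zero comb in auto)

text \<open>Riesz-Fischer, with the almost everywhere convergent subsequence kept in the conclusion
  because Fatou's lemma for the energy needs pointwise convergence.\<close>

lemma L2_Cauchy_convergent:
  fixes u :: "nat \<Rightarrow> 'a \<Rightarrow> real"
  assumes u: "\<And>n. square_integrable M (u n)"
    and cauchy: "\<And>e. e > 0 \<Longrightarrow> \<exists>K. \<forall>m\<ge>K. \<forall>n\<ge>K. (LINT x|M. (u m x - u n x)^2) < e"
  shows "\<exists>v r. strict_mono (r :: nat \<Rightarrow> nat) \<and> v \<in> borel_measurable M \<and> (AE x in M. (\<lambda>n. u (r n) x) \<longlonglongrightarrow> v x) \<and>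
    square_integrable M v \<and> (\<lambda>n. LINT x|M. (u n x - v x)^2) \<longlonglongrightarrow> 0"
proof -
  have um[measurable]: "u n \<in> borel_measurable M" for n using u by (rule square_integrable_measurable)
  have dsq: "square_integrable M (\<lambda>x. u m x - u n x)" for m n
    using square_integrable_comb[OF u[of m] u[of n], of 1 "-1"] by simp
  have di: "integrable M (\<lambda>x. (u m x - u n x)^2)" for m n
    using dsq by (simp add: square_integrable_def)
  have nn: "(\<integral>\<^sup>+x. ennreal ((u m x - u n x)^2) \<partial>M) = ennreal (LINT x|M. (u m x - u n x)^2)" for m n
    by (intro nn_integral_eq_integral di) simp
  \<comment> \<open>The rate 1/16 leaves room for the weights \<open>4 ^ n\<close>: the weighted
    squares still have summable integrals, so almost everywhere the increments are eventually at
    most \<open>(1/2) ^ n\<close>.\<close>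
  define K where "K n = (SOME K. \<forall>l\<ge>K. \<forall>m\<ge>K. (LINT x|M. (u l x - u m x)^2) < (1/16) ^ n)" for n
  have K: "(LINT x|M. (u l x - u m x)^2) < (1/16) ^ n" if "l \<ge> K n" "m \<ge> K n" for l m n
    using someI_ex[OF cauchy[of "(1/16) ^ n"]] that unfolding K_def by auto
  define r where "r = rec_nat (K 0) (\<lambda>n k. max (Suc k) (K (Suc n)))"
  have r_Suc: "r (Suc n) = max (Suc (r n)) (K (Suc n))" for n by (simp add: r_def)
  have r_mono: "strict_mono r" by (rule strict_monoI_Suc) (simp add: r_Suc)
  have r_ge: "r n \<ge> K n" for n by (cases n) (auto simp: r_def)
  define d where "d n x = u (r (Suc n)) x - u (r n) x" for n x
  have [measurable]: "d n \<in> borel_measurable M" for n unfolding d_def by measurable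
  have d_small: "(\<integral>\<^sup>+x. ennreal ((d n x)^2) \<partial>M) \<le> ennreal ((1/16) ^ n)" for n
  proof -
    have "r (Suc n) \<ge> K n" using r_ge[of n] r_mono by (meson le_trans lessI less_imp_le strict_mono_less)
    then show ?thesis unfolding d_def nn using K[of n "r (Suc n)" "r n"] r_ge[of n] by (intro ennreal_leI) simp
  qed
  have "(\<integral>\<^sup>+x. (\<Sum>n. ennreal (4 ^ n * (d n x)^2)) \<partial>M) = (\<Sum>n. \<integral>\<^sup>+x. ennreal (4 ^ n * (d n x)^2) \<partial>M)"
    by (rule nn_integral_suminf) measurable
  also have "\<dots> \<le> (\<Sum>n. ennreal ((1/4) ^ n))"
  proof (intro suminf_le)
    fix n
    have "(\<integral>\<^sup>+x. ennreal (4 ^ n * (d n x)^2) \<partial>M) = ennreal (4 ^ n) * (\<integral>\<^sup>+x. ennreal ((d n x)^2) \<partial>M)"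
      by (simp add: ennreal_mult nn_integral_cmult)
    also have "\<dots> \<le> ennreal (4 ^ n) * ennreal ((1/16) ^ n)" by (intro mult_left_mono d_small) simp
    also have "\<dots> = ennreal ((1/4) ^ n)" by (simp add: ennreal_mult[symmetric] power_mult_distrib[symmetric])
    finally show "(\<integral>\<^sup>+x. ennreal (4 ^ n * (d n x)^2) \<partial>M) \<le> ennreal ((1/4) ^ n)" .
  qed auto
  also have "\<dots> = ennreal (\<Sum>n. (1/4) ^ n)" by (intro suminf_ennreal2 summable_geometric) auto
  also have "\<dots> < \<infinity>" by simp
  finally have "AE x in M. (\<Sum>n. ennreal (4 ^ n * (d n x)^2)) \<noteq> \<infinity>"
    by (intro nn_integral_PInf_AE) auto
  then have conv: "AE x in M. convergent (\<lambda>n. u (r n) x)"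
  proof eventually_elim
    case (elim x)
    have "summable (\<lambda>n. 4 ^ n * (d n x)^2)"
      using elim by (intro summable_suminf_not_top) auto
    then have "(\<lambda>n. 4 ^ n * (d n x)^2) \<longlonglongrightarrow> 0" by (rule summable_LIMSEQ_zero)
    then have "eventually (\<lambda>n. 4 ^ n * (d n x)^2 < 1) sequentially" by (rule order_tendstoD) simp
    then have "eventually (\<lambda>n. norm (d n x) \<le> (1/2) ^ n) sequentially"
    proof eventually_elim
      case (elim n)
      then have "(2 ^ n * \<bar>d n x\<bar>)^2 < 1"
        by (simp add: power_mult_distrib power_mult[symmetric] power_even_eq[symmetric] mult.commute[of n 2] power_mult)
      then have "2 ^ n * \<bar>d n x\<bar> < 1" by (simp add: abs_square_less_1)
      then show ?case by (simp add: power_one_over field_simps)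
    qed
    then have "summable (\<lambda>n. d n x)" by (rule summable_comparison_test_ev) (simp add: summable_geometric)
    then have "convergent (\<lambda>n. \<Sum>k<n. d k x)" by (simp add: summable_iff_convergent)
    then have "convergent (\<lambda>n. u (r n) x - u (r 0) x)"
      unfolding d_def sum_lessThan_telescope[of "\<lambda>n. u (r n) x"] .
    then have "convergent (\<lambda>n. (u (r n) x - u (r 0) x) + u (r 0) x)" by (intro convergent_add convergent_const)
    then show ?case by simp
  qed
  define v where "v x = lim (\<lambda>n. u (r n) x)" for x
  have vm[measurable]: "v \<in> borel_measurable M" unfolding v_def by measurable
  have lim: "AE x in M. (\<lambda>n. u (r n) x) \<longlonglongrightarrow> v x"
    using conv by eventually_elim (simp add: v_def convergent_LIMSEQ_iff)
  have fatou: "(\<integral>\<^sup>+x. ennreal ((u m x - v x)^2) \<partial>M) \<le> ennreal e" if e: "e > 0" and m: "\<And>n. n \<ge> L \<Longrightarrow> (LINT x|M. (u m x - u n x)^2) < e" for m e L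
  proof -
    have "(\<integral>\<^sup>+x. ennreal ((u m x - v x)^2) \<partial>M) = (\<integral>\<^sup>+x. liminf (\<lambda>n. ennreal ((u m x - u (r n) x)^2)) \<partial>M)"
    proof (rule nn_integral_cong_AE)
      show "AE x in M. ennreal ((u m x - v x)^2) = liminf (\<lambda>n. ennreal ((u m x - u (r n) x)^2))"
        using lim
      proof eventually_elim
        case (elim x)
        have "(\<lambda>n. ennreal ((u m x - u (r n) x)^2)) \<longlonglongrightarrow> ennreal ((u m x - v x)^2)"
          by (intro tendsto_ennrealI tendsto_intros elim)
        then show ?case by (rule lim_imp_Liminf[OF sequentially_bot, symmetric])
      qed
    qed
    also have "\<dots> \<le> liminf (\<lambda>n. \<integral>\<^sup>+x. ennreal ((u m x - u (r n) x)^2) \<partial>M)"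
      by (rule nn_integral_liminf) measurable
    also have "\<dots> \<le> ennreal e"
    proof (rule Liminf_le)
      show "\<forall>\<^sub>F n in sequentially. (\<integral>\<^sup>+x. ennreal ((u m x - u (r n) x)^2) \<partial>M) \<le> ennreal e"
        using eventually_ge_at_top[of L]
      proof eventually_elim
        case (elim n)
        then have "r n \<ge> L" using seq_suble[OF r_mono, of n] by simp
        then show ?case unfolding nn using m[of "r n"] by (intro ennreal_leI) simp
      qed
    qed simp
    finally show ?thesis .
  qed
  obtain L where L: "\<And>m n. m \<ge> L \<Longrightarrow> n \<ge> L \<Longrightarrow> (LINT x|M. (u m x - u n x)^2) < 1"
    using cauchy[of 1] by auto
  have "(\<integral>\<^sup>+x. ennreal ((u L x - v x)^2) \<partial>M) \<le> ennreal 1" by (rule fatou[where L = L]) (use L in auto)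
  then have "square_integrable M (\<lambda>x. u L x - v x)"
    by (simp add: square_integrable_iff_nn_integral le_less_trans[OF _ ennreal_one_less_top])
  from square_integrable_comb[OF u[of L] this, of 1 "-1"] have v: "square_integrable M v" by simp
  have dv: "square_integrable M (\<lambda>x. u n x - v x)" for n
    using square_integrable_comb[OF u[of n] v, of 1 "-1"] by simp
  have "(\<lambda>n. LINT x|M. (u n x - v x)^2) \<longlonglongrightarrow> 0"
  proof (rule LIMSEQ_I)
    fix e :: real assume e: "e > 0"
    obtain L where L: "\<And>m n. m \<ge> L \<Longrightarrow> n \<ge> L \<Longrightarrow> (LINT x|M. (u m x - u n x)^2) < e / 2"
      using cauchy[of "e / 2"] e by auto
    show "\<exists>n0. \<forall>n\<ge>n0. norm ((LINT x|M. (u n x - v x)^2) - 0) < e"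
    proof (intro exI allI impI)
      fix n assume n: "n \<ge> L"
      have "(\<integral>\<^sup>+x. ennreal ((u n x - v x)^2) \<partial>M) \<le> ennreal (e / 2)"
        by (rule fatou[where L = L]) (use L n e in auto)
      moreover have "(\<integral>\<^sup>+x. ennreal ((u n x - v x)^2) \<partial>M) = ennreal (LINT x|M. (u n x - v x)^2)"
        using dv by (intro nn_integral_eq_integral) (auto simp: square_integrable_def)
      ultimately have "(LINT x|M. (u n x - v x)^2) \<le> e / 2" using e by simp
      then show "norm ((LINT x|M. (u n x - v x)^2) - 0) < e" using e by simp
    qed
  qed
  then show ?thesis using r_mono vm lim v by blast
qed

section \<open>The Gagliardo energy\<close>

lemma lebesgue_pair_sigma_finite:
  "pair_sigma_finite (lebesgue :: 'a::euclidean_space measure) (lebesgue :: 'b::euclidean_space measure)"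
  by (intro pair_sigma_finite.intro sigma_finite_lebesgue)

text \<open>Product of two completed measures, matching the iterated Lebesgue integrals of the
  definitions; both factors are sigma-finite, so Fubini and Tonelli apply directly.\<close>

abbreviation leb2 :: "('a::euclidean_space \<times> 'a) measure" where
  "leb2 \<equiv> lebesgue \<Otimes>\<^sub>M lebesgue"

text \<open>The square root of the kernel is built into the difference, so that the energy is the squared
  \<open>L\<^sup>2\<close> norm of \<open>gagliardo s u\<close>.\<close>

definition gagliardo :: "real \<Rightarrow> ('a::euclidean_space \<Rightarrow> real) \<Rightarrow> 'a \<times> 'a \<Rightarrow> real" where
  "gagliardo s u p = (u (fst p) - u (snd p)) * norm (fst p - snd p) powr (- ((real DIM('a) + 2 * s) / 2))"

lemma gagliardo_mult:
  fixes u w :: "'a::euclidean_space \<Rightarrow> real"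
  shows "gagliardo s u (x, y) * gagliardo s w (x, y) = (u x - u y) * (w x - w y) / norm (x - y) powr (real DIM('a) + 2 * s)"
proof -
  let ?e = "- ((real DIM('a) + 2 * s) / 2)"
  have "gagliardo s u (x, y) * gagliardo s w (x, y) = (u x - u y) * (w x - w y) * (norm (x - y) powr ?e * norm (x - y) powr ?e)"
    by (simp add: gagliardo_def mult_ac)
  also have "norm (x - y) powr ?e * norm (x - y) powr ?e = norm (x - y) powr (- (real DIM('a) + 2 * s))"
    by (simp only: powr_add[symmetric]) (rule arg_cong[where f = "\<lambda>e. norm (x - y) powr e"], simp add: field_simps)
  finally show ?thesis by (simp only: powr_minus_divide times_divide_eq_right mult_1_right)
qed

lemma gagliardo_sq:
  fixes u :: "'a::euclidean_space \<Rightarrow> real"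
  shows "(gagliardo s u (x, y))^2 = \<bar>u x - u y\<bar>^2 / norm (x - y) powr (real DIM('a) + 2 * s)"
  unfolding power2_eq_square gagliardo_mult by simp

lemma gagliardo_comb: "gagliardo s (\<lambda>x. a * u x + b * v x) p = a * gagliardo s u p + b * gagliardo s v p"
  by (simp add: gagliardo_def algebra_simps)

lemma fst_snd_lebesgue_borel [measurable]:
  "fst \<in> leb2 \<rightarrow>\<^sub>M (borel :: 'a::euclidean_space measure)"
  "snd \<in> leb2 \<rightarrow>\<^sub>M (borel :: 'a::euclidean_space measure)"
proof -
  have id: "(\<lambda>x. x) \<in> lebesgue \<rightarrow>\<^sub>M (borel :: 'a measure)" by (rule measurable_completion) simp
  show "fst \<in> leb2 \<rightarrow>\<^sub>M (borel :: 'a::euclidean_space measure)"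
    by (rule measurable_compose[OF measurable_fst id])
  show "snd \<in> leb2 \<rightarrow>\<^sub>M (borel :: 'a::euclidean_space measure)"
    by (rule measurable_compose[OF measurable_snd id])
qed

lemma gagliardo_measurable [measurable]:
  assumes [measurable]: "u \<in> borel_measurable (lebesgue :: 'a::euclidean_space measure)"
  shows "gagliardo s u \<in> borel_measurable leb2"
  unfolding gagliardo_def by measurable

lemma gagliardo_nn_integral:
  fixes u :: "'a::euclidean_space \<Rightarrow> real"
  assumes [measurable]: "u \<in> borel_measurable lebesgue"
  shows "(\<integral>\<^sup>+ y. (\<integral>\<^sup>+ x. ennreal (\<bar>u x - u y\<bar>\<^sup>2 / norm (x - y) powr (real DIM('a) + 2 * s)) \<partial>lebesgue) \<partial>lebesgue)
     = (\<integral>\<^sup>+p. ennreal ((gagliardo s u p)^2) \<partial>leb2)"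
proof -
  interpret pair_sigma_finite "lebesgue :: 'a measure" "lebesgue :: 'a measure" by (rule lebesgue_pair_sigma_finite)
  show ?thesis by (subst nn_integral_snd[symmetric]) (simp_all add: gagliardo_sq)
qed

lemma H0s_iff:
  "u \<in> H0s s \<Omega> \<longleftrightarrow> u \<in> borel_measurable lebesgue \<and> (\<forall>x. x \<notin> \<Omega> \<longrightarrow> u x = 0) \<and> square_integrable leb2 (gagliardo s u)"
proof (cases "u \<in> borel_measurable lebesgue")
  case True
  show ?thesis
    using gagliardo_nn_integral[OF True, of s] True
    by (simp add: H0s_def square_integrable_iff_nn_integral)
qed (simp add: H0s_def)

lemma frac_form_eq:
  assumes u: "u \<in> H0s s \<Omega>" and w: "w \<in> H0s s \<Omega>"
  shows "frac_form s u w = frac_const CARD('n) s / 2 * (LINT p|leb2. gagliardo s u p * gagliardo s (w :: real ^ 'n \<Rightarrow> real) p)"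
proof -
  interpret pair_sigma_finite "lebesgue :: (real ^ 'n) measure" "lebesgue :: (real ^ 'n) measure" by (rule lebesgue_pair_sigma_finite)
  have int: "integrable leb2 (\<lambda>p. gagliardo s u p * gagliardo s w p)"
    using u w by (intro square_integrable_mult) (auto simp: H0s_iff)
  have "(LINT p|leb2. gagliardo s u p * gagliardo s w p) = (LINT y|lebesgue. LINT x|lebesgue. gagliardo s u (x, y) * gagliardo s w (x, y))"
    using integral_snd[of "\<lambda>x y. gagliardo s u (x, y) * gagliardo s w (x, y)"] int by (simp add: case_prod_beta')
  then show ?thesis by (simp add: frac_form_def gagliardo_mult)
qed

lemma frac_const_pos: "0 < s \<Longrightarrow> s < 1 \<Longrightarrow> frac_const N s > 0"
  unfolding frac_const_def by (intro divide_pos_pos mult_pos_pos Gamma_real_pos) auto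

lemma H0s_comb: "u \<in> H0s s \<Omega> \<Longrightarrow> v \<in> H0s s \<Omega> \<Longrightarrow> (\<lambda>x. a * u x + b * v x) \<in> H0s s \<Omega>"
  unfolding H0s_iff gagliardo_comb by (auto intro: square_integrable_comb)

lemma H0s_zero: "(\<lambda>x. 0) \<in> H0s s \<Omega>"
  by (simp add: H0s_iff gagliardo_def square_integrable_def)

lemma psd_frac_form:
  assumes "0 < s" "s < 1"
  shows "psd_form (H0s s \<Omega> :: (real ^ 'n \<Rightarrow> real) set) (frac_form s)"
proof (rule psd_form_integral[where M = leb2 and T = "gagliardo s" and c = "frac_const CARD('n) s / 2"])
  show "0 \<le> frac_const CARD('n) s / 2" using frac_const_pos[OF assms, of "CARD('n)"] by simp
qed (auto intro: H0s_comb H0s_zero simp: H0s_iff[THEN iffD1] frac_form_eq gagliardo_comb)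

text \<open>Points far away from \<open>\<Omega>\<close>, where \<open>u\<close> vanishes, already contribute a multiple of
  \<open>(u x)\<^sup>2\<close> to the energy.\<close>

lemma H0s_square_integrable:
  fixes u :: "real ^ 'n \<Rightarrow> real"
  assumes s: "0 < s" and bdd: "bounded \<Omega>" and u: "u \<in> H0s s \<Omega>"
  shows "square_integrable lebesgue u"
proof -
  have um[measurable]: "u \<in> borel_measurable lebesgue" using u by (simp add: H0s_iff)
  obtain \<rho> where \<rho>: "\<rho> > 0" "\<And>x. x \<in> \<Omega> \<Longrightarrow> norm x < \<rho>"
    using bdd by (metis bounded_pos_less)
  define N where "N = real CARD('n)"
  \<comment> \<open>The annulus surrounds \<open>\<Omega>\<close>, so \<open>u\<close> vanishes on
    it, yet its points are within \<open>3 * \<rho>\<close> of every point of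
    \<open>\<Omega>\<close>. The kernel is thus at least \<open>c\<close> there, and the energy
    dominates \<open>c\<close> times the volume of \<open>A\<close> times the squared norm of
    \<open>u\<close>.\<close>
  define A where "A = (ball 0 (2 * \<rho>) - ball 0 \<rho> :: (real ^ 'n) set)"
  have A[measurable]: "A \<in> sets lebesgue" by (simp add: A_def)
  have Am: "emeasure lebesgue A \<noteq> 0" "emeasure lebesgue A < \<infinity>"
  proof -
    have "ball (((3/2) * \<rho>) *\<^sub>R axis undefined 1) (\<rho>/4) \<subseteq> A"
    proof
      fix y :: "real ^ 'n" assume "y \<in> ball (((3/2) * \<rho>) *\<^sub>R axis undefined 1) (\<rho>/4)"
      then have "norm (((3/2) * \<rho>) *\<^sub>R axis undefined 1 - y) < \<rho>/4" by (simp add: dist_norm)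
      moreover have "norm (((3/2) * \<rho>) *\<^sub>R axis undefined 1 :: real ^ 'n) = (3/2) * \<rho>" using \<rho> by simp
      ultimately have "norm y < 2 * \<rho>" "norm y \<ge> \<rho>"
        using norm_triangle_ineq2[of "((3/2) * \<rho>) *\<^sub>R axis undefined 1" y] norm_triangle_ineq2[of y "((3/2) * \<rho>) *\<^sub>R axis undefined 1"] \<rho>
        by (auto simp: norm_minus_commute)
      then show "y \<in> A" by (simp add: A_def)
    qed
    then have "emeasure lebesgue (ball (((3/2) * \<rho>) *\<^sub>R axis undefined 1 :: real ^ 'n) (\<rho>/4)) \<le> emeasure lebesgue A"
      by (intro emeasure_mono) auto
    moreover have "emeasure lebesgue (ball (((3/2) * \<rho>) *\<^sub>R axis undefined 1 :: real ^ 'n) (\<rho>/4)) > 0"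
      using \<rho> by (simp add: emeasure_ball)
    ultimately show "emeasure lebesgue A \<noteq> 0" by auto
    have "emeasure lebesgue A \<le> emeasure lebesgue (ball (0 :: real ^ 'n) (2 * \<rho>))"
      by (intro emeasure_mono) (auto simp: A_def)
    also have "\<dots> < \<infinity>" using \<rho> by (simp add: emeasure_ball)
    finally show "emeasure lebesgue A < \<infinity>" .
  qed
  define c where "c = 1 / (3 * \<rho>) powr (N + 2 * s)"
  have c: "c > 0" using \<rho> by (simp add: c_def)
  have "ennreal c * emeasure lebesgue A * (\<integral>\<^sup>+x. ennreal ((u x)^2) \<partial>lebesgue)
     = (\<integral>\<^sup>+ y. ennreal c * (\<integral>\<^sup>+ x. ennreal ((u x)^2) \<partial>lebesgue) * indicator A y \<partial>lebesgue)"
    by (subst nn_integral_cmult_indicator) (auto simp: mult_ac)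
  also have "\<dots> = (\<integral>\<^sup>+ y. (\<integral>\<^sup>+ x. ennreal c * ennreal ((u x)^2) * indicator A y \<partial>lebesgue) \<partial>lebesgue)"
    by (simp add: nn_integral_cmult nn_integral_multc)
  also have "\<dots> \<le> (\<integral>\<^sup>+ y. (\<integral>\<^sup>+ x. ennreal (\<bar>u x - u y\<bar>\<^sup>2 / norm (x - y) powr (N + 2 * s)) \<partial>lebesgue) \<partial>lebesgue)"
  proof (intro nn_integral_mono)
    fix x y :: "real ^ 'n"
    show "ennreal c * ennreal ((u x)^2) * indicator A y \<le> ennreal (\<bar>u x - u y\<bar>\<^sup>2 / norm (x - y) powr (N + 2 * s))"
    proof (cases "x \<in> \<Omega> \<and> y \<in> A")
      case True
      then have y: "y \<notin> \<Omega>" "norm y < 2 * \<rho>" "norm y \<ge> \<rho>" and x: "norm x < \<rho>" using \<rho>(2)[of x] \<rho>(2)[of y] by (auto simp: A_def)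
      have ne: "norm (x - y) > 0" using x y by auto
      have "norm (x - y) \<le> 3 * \<rho>" using norm_triangle_ineq4[of x y] x y by linarith
      then have "norm (x - y) powr (N + 2 * s) \<le> (3 * \<rho>) powr (N + 2 * s)"
        using s by (intro powr_mono2) (auto simp: N_def)
      then have "c \<le> 1 / norm (x - y) powr (N + 2 * s)"
        using ne \<rho> unfolding c_def by (intro divide_left_mono) auto
      then have "c * (u x)^2 \<le> 1 / norm (x - y) powr (N + 2 * s) * (u x)^2" by (intro mult_right_mono) auto
      moreover have "u y = 0" using u y by (simp add: H0s_iff)
      ultimately show ?thesis using True c by (simp add: ennreal_mult[symmetric])
    next
      case False
      then have "u x = 0 \<or> y \<notin> A" using u by (auto simp: H0s_iff)
      then show ?thesis by auto
    qed
  qed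
  also have "\<dots> < \<infinity>" using u by (simp add: H0s_def N_def)
  finally have "ennreal c * emeasure lebesgue A * (\<integral>\<^sup>+x. ennreal ((u x)^2) \<partial>lebesgue) < \<infinity>" .
  then have "(\<integral>\<^sup>+x. ennreal ((u x)^2) \<partial>lebesgue) < \<infinity>"
    using Am c by (auto simp: ennreal_mult_less_top ennreal_mult_eq_top_iff less_top top_unique)
  then show ?thesis by (simp add: square_integrable_iff_nn_integral)
qed

lemma set_integral_H0s:
  assumes "u \<in> H0s s \<Omega>"
  shows "(LINT x:\<Omega>|lebesgue. u x * w x) = (LINT x|lebesgue. u x * w x)"
  unfolding set_lebesgue_integral_def
  using assms by (intro Bochner_Integration.integral_cong) (auto simp: H0s_iff indicator_def)

lemma psd_L2:
  assumes "0 < s" "bounded \<Omega>"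
  shows "psd_form (H0s s \<Omega> :: (real ^ 'n \<Rightarrow> real) set) (\<lambda>u w. LINT x|lebesgue. u x * w x)"
  by (rule psd_form_integral[where M = lebesgue and T = "\<lambda>u. u" and c = 1])
    (use H0s_square_integrable[OF assms] in \<open>auto intro: H0s_comb H0s_zero\<close>)

text \<open>Off \<open>\<Omega>\<close> the \<open>L\<^sup>2\<close> limit is only almost everywhere zero and has to be corrected; the bound on
  its energy is Fatou's lemma for the iterated integral.\<close>

lemma H0s_closed:
  fixes u :: "nat \<Rightarrow> real ^ 'n \<Rightarrow> real"
  assumes s: "0 < s" "s < 1" and bdd: "bounded \<Omega>" and meas: "\<Omega> \<in> sets lebesgue"
    and u: "\<And>n. u n \<in> H0s s \<Omega>"
    and cauchy: "\<And>e. e > 0 \<Longrightarrow> \<exists>K. \<forall>m\<ge>K. \<forall>n\<ge>K. (LINT x|lebesgue. (u m x - u n x) * (u m x - u n x)) < e"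
    and E: "(\<lambda>n. frac_form s (u n) (u n)) \<longlonglongrightarrow> \<mu>"
  shows "\<exists>v\<in>H0s s \<Omega>. (\<lambda>n. LINT x|lebesgue. (u n x - v x) * (u n x - v x)) \<longlonglongrightarrow> 0 \<and> frac_form s v v \<le> \<mu>"
proof -
  define N where "N = real CARD('n)"
  let ?c = "frac_const CARD('n) s / 2"
  have c: "?c > 0" using frac_const_pos[OF s] by simp
  have um[measurable]: "u n \<in> borel_measurable lebesgue" for n using u by (simp add: H0s_iff)
  obtain v0 r where r: "strict_mono (r :: nat \<Rightarrow> nat)" and v0[measurable]: "v0 \<in> borel_measurable lebesgue"
    and ae: "AE x in lebesgue. (\<lambda>n. u (r n) x) \<longlonglongrightarrow> v0 x" and v0s: "square_integrable lebesgue v0"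
    and lim: "(\<lambda>n. LINT x|lebesgue. (u n x - v0 x)^2) \<longlonglongrightarrow> 0"
    using L2_Cauchy_convergent[of lebesgue u] H0s_square_integrable[OF s(1) bdd u] cauchy
    by (auto simp: power2_eq_square)
  define v where "v x = indicator \<Omega> x * v0 x" for x
  have [measurable]: "v \<in> borel_measurable lebesgue" unfolding v_def using meas by measurable
  have aev: "AE x in lebesgue. (\<lambda>n. u (r n) x) \<longlonglongrightarrow> v x"
    using ae
  proof eventually_elim
    case (elim x)
    show ?case
    proof (cases "x \<in> \<Omega>")
      case False
      then have "u (r n) x = 0" for n using u by (simp add: H0s_iff)
      then show ?thesis using False by (simp add: v_def)
    qed (use elim in \<open>simp add: v_def\<close>)
  qed
  have v_eq: "AE x in lebesgue. v x = v0 x"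
    using ae aev by eventually_elim (rule LIMSEQ_unique)
  let ?I = "\<lambda>u x y. ennreal (\<bar>u x - u y\<bar>\<^sup>2 / norm (x - y) powr (N + 2 * s))"
  let ?G = "\<lambda>n. \<integral>\<^sup>+p. ennreal ((gagliardo s (u n) p)^2) \<partial>leb2"
  interpret pair_sigma_finite "lebesgue :: (real ^ 'n) measure" "lebesgue :: (real ^ 'n) measure" by (rule lebesgue_pair_sigma_finite)
  have G: "?G n = ennreal (frac_form s (u n) (u n) / ?c)" for n
  proof -
    have "?G n = ennreal (LINT p|leb2. (gagliardo s (u n) p)^2)"
      using u by (intro nn_integral_eq_integral) (auto simp: H0s_iff square_integrable_def)
    then show ?thesis using c by (simp add: frac_form_eq[OF u u] power2_eq_square)
  qed
  \<comment> \<open>The comparison is made in iterated form so that exceptional null sets are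
    handled one variable at a time; Fatou itself is then applied on the product.\<close>
  have "(\<integral>\<^sup>+ y. (\<integral>\<^sup>+ x. ?I v x y \<partial>lebesgue) \<partial>lebesgue) \<le> (\<integral>\<^sup>+ y. (\<integral>\<^sup>+ x. liminf (\<lambda>n. ?I (u (r n)) x y) \<partial>lebesgue) \<partial>lebesgue)"
  proof (rule nn_integral_mono_AE)
    show "AE y in lebesgue. (\<integral>\<^sup>+ x. ?I v x y \<partial>lebesgue) \<le> (\<integral>\<^sup>+ x. liminf (\<lambda>n. ?I (u (r n)) x y) \<partial>lebesgue)"
      using aev
    proof eventually_elim
      case (elim y)
      show ?case
      proof (rule nn_integral_mono_AE)
        show "AE x in lebesgue. ?I v x y \<le> liminf (\<lambda>n. ?I (u (r n)) x y)"
          using aev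
        proof eventually_elim
          case (elim x)
          have "(\<lambda>n. \<bar>u (r n) x - u (r n) y\<bar>\<^sup>2 * (1 / norm (x - y) powr (N + 2 * s))) \<longlonglongrightarrow> \<bar>v x - v y\<bar>\<^sup>2 * (1 / norm (x - y) powr (N + 2 * s))"
            by (intro tendsto_intros elim \<open>(\<lambda>n. u (r n) y) \<longlonglongrightarrow> v y\<close>)
          then have "(\<lambda>n. ?I (u (r n)) x y) \<longlonglongrightarrow> ?I v x y" by (intro tendsto_ennrealI) simp
          then show ?case by (simp only: lim_imp_Liminf[OF sequentially_bot] order_refl)
        qed
      qed
    qed
  qed
  also have "\<dots> = (\<integral>\<^sup>+p. liminf (\<lambda>n. ennreal ((gagliardo s (u (r n)) p)^2)) \<partial>leb2)"
    by (subst nn_integral_snd[symmetric]) (simp_all add: gagliardo_sq N_def)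
  also have "\<dots> \<le> liminf (\<lambda>n. ?G (r n))" by (rule nn_integral_liminf) measurable
  also have "\<dots> = ennreal (\<mu> / ?c)"
  proof -
    have "(\<lambda>n. frac_form s (u n) (u n) * (1 / ?c)) \<longlonglongrightarrow> \<mu> * (1 / ?c)" by (intro tendsto_intros E)
    then have "(\<lambda>n. ?G n) \<longlonglongrightarrow> ennreal (\<mu> / ?c)" unfolding G by (intro tendsto_ennrealI) simp
    from LIMSEQ_subseq_LIMSEQ[OF this r] show ?thesis
      by (intro lim_imp_Liminf[OF sequentially_bot]) (simp add: o_def)
  qed
  finally have fin: "(\<integral>\<^sup>+p. ennreal ((gagliardo s v p)^2) \<partial>leb2) \<le> ennreal (\<mu> / ?c)"
    by (simp add: gagliardo_nn_integral[symmetric] N_def)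
  then have vH: "v \<in> H0s s \<Omega>"
    by (simp add: H0s_iff v_def[of x for x] square_integrable_iff_nn_integral le_less_trans[OF fin])
  have \<mu>: "\<mu> \<ge> 0"
    using psd_form.form_nonneg[OF psd_frac_form[OF s] u] by (intro LIMSEQ_le_const[OF E]) auto
  have "ennreal (LINT p|leb2. (gagliardo s v p)^2) = (\<integral>\<^sup>+p. ennreal ((gagliardo s v p)^2) \<partial>leb2)"
    using vH by (intro nn_integral_eq_integral[symmetric]) (auto simp: H0s_iff square_integrable_def)
  then have "(LINT p|leb2. (gagliardo s v p)^2) \<le> \<mu> / ?c" using fin \<mu> c by (metis ennreal_le_iff divide_nonneg_pos)
  then have "frac_form s v v \<le> \<mu>" using c by (simp add: frac_form_eq[OF vH vH] power2_eq_square field_simps)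
  moreover have "(LINT x|lebesgue. (u n x - v x) * (u n x - v x)) = (LINT x|lebesgue. (u n x - v0 x)^2)" for n
    using v_eq by (intro integral_cong_AE) (auto simp: power2_eq_square)
  ultimately show ?thesis using vH lim by (intro bexI[of _ v] conjI) simp_all
qed

section \<open>Compactness by a Poincare inequality on a grid\<close>

text \<open>Half-open cubes of side \<open>h\<close>, indexed by the floors of the scaled
  coordinates, so that every point lies in exactly one cell.\<close>

definition grid_cell :: "real \<Rightarrow> int ^ 'n \<Rightarrow> (real ^ 'n) set" where
  "grid_cell h m = {x. \<forall>i. \<lfloor>x $ i / h\<rfloor> = m $ i}"

lemma grid_cell_sandwich:
  assumes h: "h > 0"
  shows "box (\<chi> i. real_of_int (m $ i) * h) (\<chi> i. (real_of_int (m $ i) + 1) * h) \<subseteq> grid_cell h m"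
    and "grid_cell h m \<subseteq> cbox (\<chi> i. real_of_int (m $ i) * h) (\<chi> i. (real_of_int (m $ i) + 1) * h)"
  using h by (auto simp: grid_cell_def mem_box_cart floor_eq_iff field_simps less_imp_le)

lemma grid_cell_measurable [measurable]: "grid_cell h m \<in> sets borel"
proof -
  have "grid_cell h m = {x \<in> space borel. \<forall>i. \<lfloor>x $ i / h\<rfloor> = m $ i}" by (simp add: grid_cell_def)
  also have "\<dots> \<in> sets borel" by measurable
  finally show ?thesis .
qed

lemma grid_cell_measure:
  fixes m :: "int ^ 'n"
  assumes h: "h > 0"
  shows "emeasure lebesgue (grid_cell h m) = ennreal (h ^ CARD('n))"
proof -
  let ?a = "\<chi> i. real_of_int (m $ i) * h" and ?b = "\<chi> i. (real_of_int (m $ i) + 1) * h"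
  have le: "?a \<bullet> b \<le> ?b \<bullet> b" if "b \<in> Basis" for b
    using that h by (auto simp: Basis_vec_def inner_axis algebra_simps)
  have c: "emeasure lebesgue (cbox ?a ?b) = ennreal (h ^ CARD('n))"
  proof -
    have "measure lborel (cbox ?a ?b) = (\<Prod>i\<in>UNIV. ?b $ i - ?a $ i)"
      using h by (intro content_cbox_cart) (auto simp: interval_eq_empty_cart algebra_simps not_less)
    also have "\<dots> = h ^ CARD('n)" by (simp add: algebra_simps)
    finally have "emeasure lborel (cbox ?a ?b) = ennreal (h ^ CARD('n))"
      using emeasure_lborel_cbox_finite[of ?a ?b] by (subst emeasure_eq_ennreal_measure) (auto simp: less_top)
    then show ?thesis by simp
  qed
  have b: "emeasure lebesgue (box ?a ?b) = emeasure lebesgue (cbox ?a ?b)"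
    by (simp add: emeasure_lborel_box_eq emeasure_lborel_cbox_eq)
  show ?thesis
  proof (rule antisym)
    show "emeasure lebesgue (grid_cell h m) \<le> ennreal (h ^ CARD('n))"
      unfolding c[symmetric] by (intro emeasure_mono grid_cell_sandwich h) auto
    show "ennreal (h ^ CARD('n)) \<le> emeasure lebesgue (grid_cell h m)"
      unfolding c[symmetric] b[symmetric] by (intro emeasure_mono grid_cell_sandwich h) auto
  qed
qed

lemma grid_cell_diameter:
  fixes x y :: "real ^ 'n"
  assumes h: "h > 0" and "x \<in> grid_cell h m" "y \<in> grid_cell h m"
  shows "norm (x - y) \<le> real CARD('n) * h"
proof -
  have "norm (x - y) \<le> (\<Sum>i\<in>UNIV. \<bar>(x - y) $ i\<bar>)" by (rule norm_le_l1_cart)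
  also have "\<dots> \<le> (\<Sum>i\<in>(UNIV::'n set). h)"
  proof (intro sum_mono)
    fix i :: 'n
    have "real_of_int (m $ i) * h \<le> x $ i" "x $ i \<le> (real_of_int (m $ i) + 1) * h"
      "real_of_int (m $ i) * h \<le> y $ i" "y $ i \<le> (real_of_int (m $ i) + 1) * h"
      using grid_cell_sandwich(2)[OF h, of m] assms by (auto simp: subset_iff mem_box_cart)
    then show "\<bar>(x - y) $ i\<bar> \<le> h" by (simp add: algebra_simps abs_le_iff)
  qed
  finally show ?thesis by simp
qed

lemma finite_grid:
  fixes \<Omega> :: "(real ^ 'n) set"
  assumes h: "h > 0" and bdd: "bounded \<Omega>"
  shows "finite {m. grid_cell h m \<inter> \<Omega> \<noteq> {}}"
proof -
  obtain B where B: "\<And>x. x \<in> \<Omega> \<Longrightarrow> norm x \<le> B" using bdd by (auto simp: bounded_iff)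
  define K where "K = {\<lfloor>- B / h\<rfloor>..\<lfloor>B / h\<rfloor>}"
  have "{m. grid_cell h m \<inter> \<Omega> \<noteq> {}} \<subseteq> (\<lambda>f. \<chi> i. f i) ` (UNIV \<rightarrow>\<^sub>E K)"
  proof
    fix m :: "int ^ 'n" assume "m \<in> {m. grid_cell h m \<inter> \<Omega> \<noteq> {}}"
    then obtain x where x: "x \<in> grid_cell h m" "x \<in> \<Omega>" by auto
    have "m $ i \<in> K" for i
    proof -
      have "\<bar>x $ i\<bar> \<le> B" using B[OF x(2)] component_le_norm_cart[of x i] by linarith
      then have "- B \<le> x $ i" "x $ i \<le> B" by auto
      then have "- B / h \<le> x $ i / h" "x $ i / h \<le> B / h" using h by (simp_all only: divide_right_mono less_imp_le)
      moreover have "m $ i = \<lfloor>x $ i / h\<rfloor>" using x by (simp add: grid_cell_def)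
      ultimately show ?thesis unfolding K_def by (simp add: floor_mono)
    qed
    then show "m \<in> (\<lambda>f. \<chi> i. f i) ` (UNIV \<rightarrow>\<^sub>E K)"
      by (intro image_eqI[of _ _ "\<lambda>i. m $ i"]) (auto simp: vec_eq_iff)
  qed
  moreover have "finite ((\<lambda>f. \<chi> i. f i) ` (UNIV \<rightarrow>\<^sub>E K) :: (int ^ 'n) set)"
    by (intro finite_imageI finite_PiE) (auto simp: K_def)
  ultimately show ?thesis by (rule finite_subset)
qed

text \<open>Expanding the square gives an exact variance identity: the double integral measures how
  far \<open>u\<close> is from its mean on \<open>A\<close>. Its nonnegativity yields the
  Cauchy-Schwarz bound in the last conclusion.\<close>

lemma cell_poincare:
  fixes u :: "'a::euclidean_space \<Rightarrow> real"
  assumes u: "square_integrable lebesgue u" and A[measurable]: "A \<in> sets lebesgue" and Af: "emeasure lebesgue A = ennreal V" "V > 0"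
  shows "integrable lebesgue (\<lambda>x. indicator A x * u x)"
    and "integrable lebesgue (\<lambda>x. indicator A x * (u x)^2)"
    and "integrable leb2 (\<lambda>p. indicator A (fst p) * indicator A (snd p) * (u (fst p) - u (snd p))^2)"
    and "(LINT p|leb2. indicator A (fst p) * indicator A (snd p) * (u (fst p) - u (snd p))^2) =
      2 * V * (LINT x|lebesgue. indicator A x * (u x)^2) - 2 * (LINT x|lebesgue. indicator A x * u x)^2"
    and "(LINT x|lebesgue. indicator A x * u x)^2 \<le> V * (LINT x|lebesgue. (u x)^2)"
proof -
  let ?d = "\<lambda>p. indicator A (fst p) * indicator A (snd p) * (u (fst p) - u (snd p))^2" and ?m = "LINT x|lebesgue. indicator A x * u x" and ?q = "LINT x|lebesgue. indicator A x * (u x)^2"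
  have [measurable]: "u \<in> borel_measurable lebesgue" using u by (rule square_integrable_measurable)
  have i0: "integrable lebesgue (indicator A :: 'a \<Rightarrow> real)" "(LINT x|lebesgue. indicator A x) = V"
    using Af by (auto simp: measure_def)
  have isq: "square_integrable lebesgue (indicator A :: 'a \<Rightarrow> real)"
    using i0 by (auto simp: square_integrable_def power2_eq_square indicator_inter_arith[symmetric])
  show i1: "integrable lebesgue (\<lambda>x. indicator A x * u x)" by (rule square_integrable_mult[OF isq u])
  show i2: "integrable lebesgue (\<lambda>x. indicator A x * (u x)^2)"
  proof -
    have "integrable lebesgue (\<lambda>x. (u x)^2 * indicator A x)"
      using u A by (intro integrable_real_mult_indicator) (auto simp: square_integrable_def)
    then show ?thesis by (simp only: mult.commute)
  qed
  note S = sigma_finite_lebesgue sigma_finite_lebesgue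
  note P1 = integral_product_fst_snd[OF S i2 i0(1)] and P2 = integral_product_fst_snd[OF S i1 i1] and P3 = integral_product_fst_snd[OF S i0(1) i2]
  have eq: "?d p =
     indicator A (fst p) * (u (fst p))^2 * indicator A (snd p) - 2 * (indicator A (fst p) * u (fst p) * (indicator A (snd p) * u (snd p)))
       + indicator A (fst p) * (indicator A (snd p) * (u (snd p))^2)" for p
    by (simp add: power2_eq_square algebra_simps)
  show "integrable leb2 (\<lambda>p. ?d p)"
    unfolding eq by (intro Bochner_Integration.integrable_add Bochner_Integration.integrable_diff integrable_mult_right P1(1) P2(1) P3(1))
  have "(LINT p|leb2. ?d p) =
      ?q * V - 2 * (?m * ?m) + V * ?q"
    unfolding eq using P1 P2 P3 i0(2)
    by (simp add: Bochner_Integration.integral_add Bochner_Integration.integral_diff)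
  then show eq2: "(LINT p|leb2. ?d p) =
      2 * V * ?q - 2 * ?m^2"
    by (simp add: power2_eq_square)
  have "0 \<le> (LINT p|leb2. ?d p)" by simp
  then have "?m^2 \<le> V * ?q"
    unfolding eq2 by simp
  also have "\<dots> \<le> V * (LINT x|lebesgue. (u x)^2)"
    using Af(2) u i2 by (intro mult_left_mono integral_mono) (auto simp: square_integrable_def indicator_def)
  finally show "?m^2 \<le> V * (LINT x|lebesgue. (u x)^2)" .
qed

text \<open>Two points of a cell are at distance at most \<open>CARD('n) * h\<close>, so inserting
  the kernel costs at most the factor \<open>D\<close>, and the variance on each cell is bounded by
  its share of the energy. After division by \<open>h ^ CARD('n)\<close> the energy has a
  coefficient of order \<open>h powr (2 * s)\<close>.\<close>

lemma grid_poincare: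
  fixes u :: "real ^ 'n \<Rightarrow> real"
  assumes s: "0 < s" and bdd: "bounded \<Omega>" and u: "u \<in> H0s s \<Omega>" and h: "h > 0"
  shows "(LINT x|lebesgue. (u x)^2) \<le>
     (real CARD('n) * h) powr (real CARD('n) + 2 * s) / (2 * h ^ CARD('n)) * (LINT p|leb2. (gagliardo s u p)^2)
     + (\<Sum>A\<in>grid_cell h ` {m. grid_cell h m \<inter> \<Omega> \<noteq> {}}. (LINT x|lebesgue. indicator A x * u x)^2) / h ^ CARD('n)"
proof -
  let ?J = "grid_cell h ` {m. grid_cell h m \<inter> \<Omega> \<noteq> {}}"
  define V where "V = h ^ CARD('n)"
  define D where "D = (real CARD('n) * h) powr (real CARD('n) + 2 * s)"
  have V: "V > 0" using h by (simp add: V_def)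
  let ?d = "\<lambda>A p. indicator A (fst p) * indicator A (snd p) * (u (fst p) - u (snd p))^2" and ?m = "\<lambda>A. LINT x|lebesgue. indicator A x * u x"
  have fin: "finite ?J" using finite_grid[OF h bdd] by simp
  have sq: "square_integrable lebesgue u" by (rule H0s_square_integrable[OF s bdd u])
  have J: "A \<in> sets lebesgue" "emeasure lebesgue A = ennreal V" if "A \<in> ?J" for A
    using that by (auto simp: V_def grid_cell_measure[OF h] simp del: emeasure_completion)
  note C = cell_poincare[OF sq J V]
  have uniq: "A = B" if "A \<in> ?J" "B \<in> ?J" "x \<in> A" "x \<in> B" for A B x
  proof -
    from that obtain k l where "A = grid_cell h k" "B = grid_cell h l" by auto
    then have "k = l" using that by (auto simp: grid_cell_def vec_eq_iff)
    then show ?thesis using \<open>A = _\<close> \<open>B = _\<close> by simp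
  qed
  have cover: "(\<Sum>A\<in>?J. indicator A x * (u x)^2) = (u x)^2" for x
  proof (cases "x \<in> \<Omega>")
    case True
    define A where "A = grid_cell h (\<chi> i. \<lfloor>x $ i / h\<rfloor>)"
    have xA: "x \<in> A" by (simp add: A_def grid_cell_def)
    have AJ: "A \<in> ?J" using xA True unfolding A_def by blast
    have "(\<Sum>B\<in>?J. indicator B x * (u x)^2) = indicator A x * (u x)^2 + (\<Sum>B\<in>?J - {A}. indicator B x * (u x)^2)"
      by (rule sum.remove[OF fin AJ])
    also have "(\<Sum>B\<in>?J - {A}. indicator B x * (u x)^2) = 0"
      using uniq[OF _ AJ _ xA] by (intro sum.neutral ballI) (auto simp: indicator_def)
    finally show ?thesis using xA by simp
  next
    case False then show ?thesis using u by (simp add: H0s_iff)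
  qed
  \<comment> \<open>At most one cell contains both points of a pair; pairs in different cells
    contribute 0 on the left.\<close>
  have pair_le: "(\<Sum>A\<in>?J. ?d A p) \<le> D * (gagliardo s u p)^2" for p
  proof (cases "\<exists>A\<in>?J. fst p \<in> A \<and> snd p \<in> A")
    case True
    then obtain A where A: "A \<in> ?J" "fst p \<in> A" "snd p \<in> A" by auto
    have "(\<Sum>B\<in>?J. ?d B p)
       = ?d A p + (\<Sum>B\<in>?J - {A}. ?d B p)"
      by (rule sum.remove[OF fin A(1)])
    also have "(\<Sum>B\<in>?J - {A}. ?d B p) = 0"
      using uniq[OF _ A(1) _ A(2)] by (intro sum.neutral ballI) (auto simp: indicator_def)
    finally have "(\<Sum>B\<in>?J. ?d B p) = (u (fst p) - u (snd p))^2"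
      using A by simp
    also have "\<dots> \<le> D * (gagliardo s u p)^2"
    proof (cases "fst p = snd p")
      case False
      have "norm (fst p - snd p) \<le> real CARD('n) * h" using A grid_cell_diameter[OF h] by auto
      then have "norm (fst p - snd p) powr (real CARD('n) + 2 * s) \<le> D"
        unfolding D_def using s by (intro powr_mono2) auto
      then have "1 \<le> D / norm (fst p - snd p) powr (real CARD('n) + 2 * s)" using False by simp
      then have "(u (fst p) - u (snd p))^2 * 1 \<le> (u (fst p) - u (snd p))^2 * (D / norm (fst p - snd p) powr (real CARD('n) + 2 * s))"
        by (intro mult_left_mono) auto
      then show ?thesis using gagliardo_sq[of s u "fst p" "snd p"] by (simp add: mult.commute)
    qed (simp add: D_def)
    finally show ?thesis .
  next
    case False
    then have "(\<Sum>A\<in>?J. ?d A p) = 0"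
      by (intro sum.neutral ballI) (auto simp: indicator_def)
    then show ?thesis by (simp add: D_def)
  qed
  have "2 * V * (LINT x|lebesgue. (u x)^2) - 2 * (\<Sum>A\<in>?J. (?m A)^2)
    = (\<Sum>A\<in>?J. 2 * V * (LINT x|lebesgue. indicator A x * (u x)^2) - 2 * (?m A)^2)"
  proof -
    have "(LINT x|lebesgue. (u x)^2) = (LINT x|lebesgue. (\<Sum>A\<in>?J. indicator A x * (u x)^2))" by (simp only: cover)
    also have "\<dots> = (\<Sum>A\<in>?J. LINT x|lebesgue. indicator A x * (u x)^2)"
      by (intro Bochner_Integration.integral_sum C(2))
    finally show ?thesis by (simp add: sum_subtractf sum_distrib_left)
  qed
  also have "\<dots> = (\<Sum>A\<in>?J. LINT p|leb2. ?d A p)"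
    by (intro sum.cong refl C(4)[symmetric])
  also have "\<dots> = (LINT p|leb2. (\<Sum>A\<in>?J. ?d A p))"
    by (intro Bochner_Integration.integral_sum[symmetric] C(3))
  also have "\<dots> \<le> (LINT p|leb2. D * (gagliardo s u p)^2)"
    using u by (intro integral_mono pair_le Bochner_Integration.integrable_sum C(3)) (auto simp: H0s_iff square_integrable_def)
  also have "\<dots> = D * (LINT p|leb2. (gagliardo s u p)^2)" by simp
  finally have "2 * V * (LINT x|lebesgue. (u x)^2) \<le> D * (LINT p|leb2. (gagliardo s u p)^2) + 2 * (\<Sum>A\<in>?J. (?m A)^2)"
    by simp
  then show ?thesis using V unfolding V_def[symmetric] D_def[symmetric] by (simp add: field_simps)
qed

text \<open>Scaled cell integrals are the finitely many functionals. A fine grid makes the energy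
  coefficient in the Poincare inequality as small as wanted, which is the compactness of the
  embedding.\<close>

theorem compact_form_H0s:
  fixes \<Omega> :: "(real ^ 'n) set"
  assumes s: "0 < s" "s < 1" and bdd: "bounded \<Omega>" and meas: "\<Omega> \<in> sets lebesgue"
  shows "compact_form (H0s s \<Omega>) (frac_form s) (\<lambda>u w. LINT x|lebesgue. u x * w x)"
proof (intro compact_form.intro psd_frac_form psd_L2 s bdd compact_form_axioms.intro)
  fix L :: real
  let ?ip = "\<lambda>u w :: real ^ 'n \<Rightarrow> real. LINT x|lebesgue. u x * w x"
  let ?N = "real CARD('n)"
  let ?c = "frac_const CARD('n) s"
  have c: "?c > 0" by (rule frac_const_pos[OF s])
  define L' where "L' = \<bar>L\<bar> + 1"
  have L': "L' > 0" "L \<le> L'" by (auto simp: L'_def)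
  \<comment> \<open>Chosen so that the Gagliardo coefficient
    \<open>L' * (?N * h) powr (?N + 2 * s) / (2 * h ^ CARD('n))\<close> equals \<open>?c / 2\<close>
    and that term becomes \<open>frac_form s u u\<close>. Solving for \<open>h\<close> divides by
    the level, hence the strictly positive \<open>L'\<close> in place of \<open>L\<close>.\<close>
  define h where "h = (?c / (L' * ?N powr (?N + 2 * s))) powr (1 / (2 * s))"
  have h: "h > 0" using c L' by (simp add: h_def)
  have hs: "h powr (2 * s) = ?c / (L' * ?N powr (?N + 2 * s))"
    using s c L' by (simp add: h_def powr_powr)
  have hN: "h ^ CARD('n) = h powr ?N" using h by (simp add: powr_realpow)
  define J where "J = grid_cell h ` {m. grid_cell h m \<inter> \<Omega> \<noteq> {}}"
  define \<theta> where "\<theta> A u = sqrt (L' / h ^ CARD('n)) * (LINT x|lebesgue. indicator A x * u x)" for A and u :: "real ^ 'n \<Rightarrow> real"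
  have J: "A \<in> sets lebesgue" "emeasure lebesgue A = ennreal (h ^ CARD('n))" if "A \<in> J" for A
    using that by (auto simp: J_def grid_cell_measure[OF h] simp del: emeasure_completion)
  have V: "h ^ CARD('n) > 0" using h by simp
  have sq: "square_integrable lebesgue u" if "u \<in> H0s s \<Omega>" for u by (rule H0s_square_integrable[OF s(1) bdd that])
  have 1: "(\<theta> A u)^2 \<le> L' * ?ip u u" if "A \<in> J" "u \<in> H0s s \<Omega>" for A u
  proof -
    have "(\<theta> A u)^2 = L' / h ^ CARD('n) * (LINT x|lebesgue. indicator A x * u x)^2"
      using L' h by (simp add: \<theta>_def power_mult_distrib)
    also have "\<dots> \<le> L' / h ^ CARD('n) * (h ^ CARD('n) * (LINT x|lebesgue. (u x)^2))"
      using L' h cell_poincare(5)[OF sq[OF that(2)] J[OF that(1)] V] by (intro mult_left_mono) auto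
    finally show ?thesis using h by (simp add: power2_eq_square)
  qed
  have 2: "\<theta> A (\<lambda>x. u x - v x) = \<theta> A u - \<theta> A v" if "A \<in> J" "u \<in> H0s s \<Omega>" "v \<in> H0s s \<Omega>" for A u v
  proof -
    have "(LINT x|lebesgue. indicator A x * (u x - v x)) = (LINT x|lebesgue. indicator A x * u x - indicator A x * v x)"
      by (simp add: right_diff_distrib)
    also have "\<dots> = (LINT x|lebesgue. indicator A x * u x) - (LINT x|lebesgue. indicator A x * v x)"
      by (intro Bochner_Integration.integral_diff cell_poincare(1)[OF sq J V] that)
    finally show ?thesis by (simp add: \<theta>_def right_diff_distrib)
  qed
  have 3: "L * ?ip u u \<le> frac_form s u u + (\<Sum>A\<in>J. (\<theta> A u)^2)" if u: "u \<in> H0s s \<Omega>" for u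
  proof -
    let ?G = "LINT p|leb2. (gagliardo s u p)^2"
    have "L * ?ip u u \<le> L' * (LINT x|lebesgue. (u x)^2)"
      using L' by (simp add: power2_eq_square mult_right_mono)
    also have "\<dots> \<le> L' * ((?N * h) powr (?N + 2 * s) / (2 * h ^ CARD('n)) * ?G
        + (\<Sum>A\<in>J. (LINT x|lebesgue. indicator A x * u x)^2) / h ^ CARD('n))"
      unfolding J_def using L' by (intro mult_left_mono grid_poincare[OF s(1) bdd u h]) auto
    also have "\<dots> = L' * ((?N * h) powr (?N + 2 * s) / (2 * h ^ CARD('n))) * ?G + (\<Sum>A\<in>J. (\<theta> A u)^2)"
      using L' h by (simp add: \<theta>_def power_mult_distrib distrib_left sum_distrib_left sum_divide_distrib)
    also have "L' * ((?N * h) powr (?N + 2 * s) / (2 * h ^ CARD('n))) = L' * ?N powr (?N + 2 * s) * h powr (2 * s) / 2"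
      using h unfolding hN by (simp add: powr_mult powr_add field_simps)
    also have "\<dots> = ?c / 2" using L' by (simp add: hs)
    also have "?c / 2 * ?G = frac_form s u u" by (simp add: frac_form_eq[OF u u] power2_eq_square)
    finally show ?thesis .
  qed
  have fin: "finite J" unfolding J_def using finite_grid[OF h bdd] by simp
  show "\<exists>(J :: (real ^ 'n) set set) \<theta> C. finite J \<and>
      (\<forall>j\<in>J. \<forall>u\<in>H0s s \<Omega>. (\<theta> j u)^2 \<le> C * ?ip u u) \<and>
      (\<forall>j\<in>J. \<forall>u\<in>H0s s \<Omega>. \<forall>v\<in>H0s s \<Omega>. \<theta> j (\<lambda>x. u x - v x) = \<theta> j u - \<theta> j v) \<and>
      (\<forall>u\<in>H0s s \<Omega>. L * ?ip u u \<le> frac_form s u u + (\<Sum>j\<in>J. (\<theta> j u)^2))"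
    by (rule exI[of _ J], rule exI[of _ \<theta>], rule exI[of _ L'], intro conjI ballI)
      (use fin 1 2 3 in \<open>simp_all\<close>)
qed (rule H0s_closed[OF s bdd meas])

section \<open>From the abstract form to the Dirichlet eigenvalues\<close>

lemma H0s_null_iff:
  fixes u :: "real ^ 'n \<Rightarrow> real"
  assumes "0 < s" "bounded \<Omega>" "u \<in> H0s s \<Omega>"
  shows "(LINT x|lebesgue. u x * u x) = 0 \<longleftrightarrow> (AE x in lebesgue. u x = 0)"
proof -
  have "integrable lebesgue (\<lambda>x. u x * u x)"
    by (intro square_integrable_mult H0s_square_integrable[OF assms])
  then show ?thesis by (subst integral_nonneg_eq_0_iff_AE) auto
qed

text \<open>The spectral input of the trial-function argument. The proof translates almost
  everywhere statements about eigenfunctions into \<open>ip\<close>-null ones, which square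
  integrability on \<open>H0s s \<Omega>\<close> makes legitimate.\<close>

theorem dirichlet_weighted_bessel:
  fixes \<Omega> :: "(real ^ 'n) set"
  assumes s: "0 < s" "s < 1" and bdd: "bounded \<Omega>" and meas: "\<Omega> \<in> sets lebesgue"
    and lam: "eigenvalue_sequence s \<Omega> lam" and k: "1 \<le> k"
  shows "\<exists>\<phi>. (\<forall>i\<in>{1..k}. \<phi> i \<in> H0s s \<Omega> \<and> (LINT x|lebesgue. (\<phi> i x)^2) = 1) \<and>
    (\<forall>f\<in>H0s s \<Omega>. lam k * (LINT x|lebesgue. (f x)^2) - frac_form s f f
        \<le> (\<Sum>i\<in>{1..k}. (lam k - lam i) * (LINT x|lebesgue. f x * \<phi> i x)^2))"
proof -
  let ?ip = "\<lambda>u w :: real ^ 'n \<Rightarrow> real. LINT x|lebesgue. u x * w x"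
  interpret cf: compact_form "H0s s \<Omega>" "frac_form s" ?ip
    by (rule compact_form_H0s[OF s bdd meas])
  have eig: "eigenspace s \<Omega> \<mu> = cf.eig \<mu>" for \<mu>
    unfolding eigenspace_def cf.eig_def by (auto simp: set_integral_H0s)
  have null: "(AE x in lebesgue. u x = 0) \<longleftrightarrow> ?ip u u = 0" if "u \<in> H0s s \<Omega>" for u
    using H0s_null_iff[OF s(1) bdd that] by simp
  have mult: "cf.mult \<mu> m" if hm: "has_multiplicity s \<Omega> \<mu> m" for \<mu> m
  proof -
    from hm obtain b where b: "\<And>j. j < m \<Longrightarrow> b j \<in> cf.eig \<mu>"
      and ind: "\<And>c. (AE x in lebesgue. (\<Sum>j<m. c j * b j x) = 0) \<Longrightarrow> \<forall>j<m. c j = (0::real)"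
      and sp: "\<And>u. u \<in> cf.eig \<mu> \<Longrightarrow> \<exists>c. AE x in lebesgue. u x = (\<Sum>j<m. c j * b j x)"
      unfolding has_multiplicity_def eig by blast
    have bH: "b j \<in> H0s s \<Omega>" if "j < m" for j using cf.eig_mem[OF b[OF that]] .
    have S: "(\<lambda>x. \<Sum>j<m. c j * b j x) \<in> H0s s \<Omega>" for c
      using bH by (intro cf.sum_mem) auto
    show ?thesis
      unfolding cf.mult_def
    proof (intro exI[of _ b] conjI allI impI ballI)
      fix j assume "j < m" then show "b j \<in> cf.eig \<mu>" by (rule b)
    next
      fix c :: "nat \<Rightarrow> real" and j assume *: "?ip (\<lambda>x. \<Sum>j<m. c j * b j x) (\<lambda>x. \<Sum>j<m. c j * b j x) = 0" and j: "j < m"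
      have "AE x in lebesgue. (\<Sum>j<m. c j * b j x) = 0" using null[OF S[of c]] * by simp
      then show "c j = 0" using ind j by blast
    next
      fix u assume u: "u \<in> cf.eig \<mu>"
      obtain c where c: "AE x in lebesgue. u x = (\<Sum>j<m. c j * b j x)" using sp[OF u] by blast
      have "AE x in lebesgue. u x - (\<Sum>j<m. c j * b j x) = 0" using c by eventually_elim simp
      then show "\<exists>c. ?ip (\<lambda>x. u x - (\<Sum>j<m. c j * b j x)) (\<lambda>x. u x - (\<Sum>j<m. c j * b j x)) = 0"
        using null[OF cf.diff_mem[OF cf.eig_mem[OF u] S[of c]]] by (intro exI[of _ c]) simp
    qed
  qed
  have complete: "finite {j. 1 \<le> j \<and> lam j = \<mu>} \<and> cf.mult \<mu> (card {j. 1 \<le> j \<and> lam j = \<mu>})"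
    if nz: "\<exists>u\<in>cf.eig \<mu>. ?ip u u \<noteq> 0" for \<mu>
  proof -
    from nz obtain u where u: "u \<in> cf.eig \<mu>" "?ip u u \<noteq> 0" by (elim bexE) (rule that)
    have "eigenvalue s \<Omega> \<mu>"
      unfolding eigenvalue_def eigenfunction_def eig using u null[OF cf.eig_mem[OF u(1)]] by blast
    then show ?thesis using lam mult unfolding eigenvalue_sequence_def by blast
  qed
  have mult_lam: "finite {j. 1 \<le> j \<and> lam j = lam i} \<and> cf.mult (lam i) (card {j. 1 \<le> j \<and> lam j = lam i})" if "1 \<le> i" for i
    using lam mult that unfolding eigenvalue_sequence_def by blast
  have mono: "mono_on {1..} lam" using lam by (simp add: eigenvalue_sequence_def)
  obtain \<phi> where on: "cf.orthonormal {1..k} \<phi>" and \<phi>: "\<And>i. i \<in> {1..k} \<Longrightarrow> \<phi> i \<in> cf.eig (lam i)"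
    using cf.orthonormal_eigenvectors[of lam, OF mult_lam] by blast
  have gap: "lam k * ?ip u u \<le> frac_form s u u" if "u \<in> cf.orth {1..k} \<phi>" for u
    by (rule cf.spectral_gap[OF mono complete on \<phi> that k])
  have "lam k * ?ip f f - frac_form s f f \<le> (\<Sum>i\<in>{1..k}. (lam k - lam i) * (?ip f (\<phi> i))^2)" if "f \<in> H0s s \<Omega>" for f
    by (rule cf.weighted_bessel[OF _ on \<phi> gap that]) simp
  then show ?thesis using on unfolding cf.orthonormal_def by (intro exI[of _ \<phi>]) (simp add: power2_eq_square)
qed

section \<open>Trial functions\<close>

lemma nn_integral_lebesgue_pair:
  fixes f :: "'a::euclidean_space \<Rightarrow> 'a \<Rightarrow> ennreal"
  assumes [measurable]: "case_prod f \<in> borel_measurable (borel \<Otimes>\<^sub>M borel)"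
  shows "(\<integral>\<^sup>+y. (\<integral>\<^sup>+x. f x y \<partial>lebesgue) \<partial>lebesgue) = (\<integral>\<^sup>+y. (\<integral>\<^sup>+x. f x y \<partial>lborel) \<partial>lborel)"
proof -
  have "(\<integral>\<^sup>+x. f x y \<partial>lebesgue) = (\<integral>\<^sup>+x. f x y \<partial>lborel)" for y
    by (rule nn_integral_completion) measurable
  moreover have "(\<integral>\<^sup>+y. (\<integral>\<^sup>+x. f x y \<partial>lborel) \<partial>lebesgue) = (\<integral>\<^sup>+y. (\<integral>\<^sup>+x. f x y \<partial>lborel) \<partial>lborel)"
    by (rule nn_integral_completion) measurable
  ultimately show ?thesis by simp
qed

text \<open>Kept as an extended value over \<open>lborel\<close>, without the factor
  \<open>frac_const / 2\<close>, so that trial functions can be estimated before they are known to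
  lie in \<open>H0s s \<Omega>\<close>.\<close>

definition energy :: "real \<Rightarrow> ('a::euclidean_space \<Rightarrow> real) \<Rightarrow> ennreal" where
  "energy s u = (\<integral>\<^sup>+y. (\<integral>\<^sup>+x. ennreal ((u x - u y)^2 / norm (x - y) powr (real DIM('a) + 2 * s)) \<partial>lborel) \<partial>lborel)"

lemma energy_eq_gagliardo:
  fixes u :: "'a::euclidean_space \<Rightarrow> real"
  assumes [measurable]: "u \<in> borel_measurable borel"
  shows "energy s u = (\<integral>\<^sup>+p. ennreal ((gagliardo s u p)^2) \<partial>leb2)"
proof -
  have "u \<in> borel_measurable lebesgue" by (rule measurable_completion) simp
  from gagliardo_nn_integral[OF this, of s] show ?thesis
    unfolding energy_def by (subst (asm) nn_integral_lebesgue_pair) simp_all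
qed

lemma H0s_if_energy_finite:
  fixes u :: "real ^ 'n \<Rightarrow> real"
  assumes u: "u \<in> borel_measurable borel" "\<And>x. x \<notin> \<Omega> \<Longrightarrow> u x = 0" and fin: "energy s u < \<infinity>"
  shows "u \<in> H0s s \<Omega>" "ennreal (frac_form s u u) = ennreal (frac_const CARD('n) s / 2) * energy s u"
proof -
  have m: "u \<in> borel_measurable lebesgue" using u(1) by (intro measurable_completion) simp
  show H: "u \<in> H0s s \<Omega>"
    using u(2) m fin unfolding energy_eq_gagliardo[OF u(1)]
    by (simp add: H0s_iff square_integrable_iff_nn_integral)
  have int: "integrable leb2 (\<lambda>p. (gagliardo s u p)^2)" using H by (simp add: H0s_iff square_integrable_def)
  have "energy s u = ennreal (LINT p|leb2. (gagliardo s u p)^2)"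
    unfolding energy_eq_gagliardo[OF u(1)] by (intro nn_integral_eq_integral int) simp
  then show "ennreal (frac_form s u u) = ennreal (frac_const CARD('n) s / 2) * energy s u"
    unfolding frac_form_eq[OF H H] power2_eq_square by (simp add: ennreal_mult''[symmetric])
qed

text \<open>The product formula behind this estimate is
  \<open>\<bar>w(x) e\<^sup>i\<^sup>\<xi>\<^sup>x - w(y) e\<^sup>i\<^sup>\<xi>\<^sup>y\<bar>\<^sup>2 = (w(x) - w(y))\<^sup>2 cos(\<xi>(x - y)) + (w(x)\<^sup>2 + w(y)\<^sup>2)(1 - cos(\<xi>(x - y)))\<close>.\<close>

lemma energy_modulated_le:
  fixes w :: "'a::euclidean_space \<Rightarrow> real"
  assumes s: "0 < s" "s < 1" and [measurable]: "w \<in> borel_measurable borel"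
  shows "energy s (\<lambda>x. w x * cos (\<xi> \<bullet> x)) + energy s (\<lambda>x. w x * sin (\<xi> \<bullet> x))
    \<le> energy s w + 2 * (\<integral>\<^sup>+x. ennreal ((w x)^2) \<partial>lborel) * ennreal (norm \<xi> powr (2 * s) / frac_const DIM('a) s)"
proof -
  let ?K = "\<lambda>x y :: 'a. norm (x - y) powr (real DIM('a) + 2 * s)"
  let ?A = "\<lambda>x y. (w x * cos (\<xi> \<bullet> x) - w y * cos (\<xi> \<bullet> y))^2" and ?B = "\<lambda>x y. (w x * sin (\<xi> \<bullet> x) - w y * sin (\<xi> \<bullet> y))^2"
  let ?c = "\<lambda>x. w x * cos (\<xi> \<bullet> x)" and ?s = "\<lambda>x. w x * sin (\<xi> \<bullet> x)"
  define k where "k z = ennreal ((1 - cos (\<xi> \<bullet> z)) / norm z powr (real DIM('a) + 2 * s))" for z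
  have [measurable]: "k \<in> borel_measurable borel" unfolding k_def by measurable
  define \<kappa> where "\<kappa> = ennreal (norm \<xi> powr (2 * s) / frac_const DIM('a) s)"
  have \<kappa>: "(\<integral>\<^sup>+z. k z \<partial>lborel) = \<kappa>" unfolding k_def \<kappa>_def by (rule nn_integral_one_minus_cos[OF s])
  have ennreal_sum: "ennreal a + ennreal b \<le> ennreal p + (ennreal q * ennreal t + ennreal r * ennreal t)"
    if "a + b \<le> p + (q * t + r * t)" "0 \<le> a" "0 \<le> b" "0 \<le> p" "0 \<le> q" "0 \<le> t" "0 \<le> r" for a b p q t r :: real
    using that by (simp add: ennreal_mult[symmetric] ennreal_plus[symmetric] del: ennreal_plus)
  have "energy s ?c + energy s ?s
     = (\<integral>\<^sup>+y. (\<integral>\<^sup>+x. ennreal (?A x y / ?K x y)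
          + ennreal (?B x y / ?K x y) \<partial>lborel) \<partial>lborel)"
    unfolding energy_def by (simp add: nn_integral_add)
  also have "\<dots> \<le> (\<integral>\<^sup>+y. (\<integral>\<^sup>+x. ennreal ((w x - w y)^2 / ?K x y) + (ennreal ((w x)^2) * k (x - y) + ennreal ((w y)^2) * k (x - y)) \<partial>lborel) \<partial>lborel)"
  proof (intro nn_integral_mono)
    fix x y :: 'a
    define C where "C = cos (\<xi> \<bullet> (x - y))"
    have C: "C = cos (\<xi> \<bullet> x) * cos (\<xi> \<bullet> y) + sin (\<xi> \<bullet> x) * sin (\<xi> \<bullet> y)" "C \<le> 1"
      unfolding C_def by (simp_all only: inner_diff_right cos_diff[symmetric] cos_le_one)
    have cs: "(cos (\<xi> \<bullet> z))^2 = 1 - (sin (\<xi> \<bullet> z))^2" for z by (simp add: cos_squared_eq)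
    have "?A x y + ?B x y
      = (w x)^2 + (w y)^2 - 2 * w x * w y * C"
      by (simp add: C power2_diff power_mult_distrib cs algebra_simps)
    also have "\<dots> = (w x - w y)^2 * C + ((w x)^2 + (w y)^2) * (1 - C)" by (simp add: power2_diff algebra_simps)
    \<comment> \<open>\<open>C \<le> 1\<close> discards the oscillation of the first term, whose
      cost becomes the energy of \<open>w\<close> itself.\<close>
    also have "\<dots> \<le> (w x - w y)^2 + ((w x)^2 + (w y)^2) * (1 - C)" using C(2) by (simp add: mult_left_le)
    finally have "(?A x y + ?B x y) / ?K x y
      \<le> ((w x - w y)^2 + ((w x)^2 + (w y)^2) * (1 - C)) / ?K x y" by (intro divide_right_mono) auto
    then have le: "?A x y / ?K x y + ?B x y / ?K x y
      \<le> (w x - w y)^2 / ?K x y + ((w x)^2 * ((1 - C) / ?K x y) + (w y)^2 * ((1 - C) / ?K x y))"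
      by (simp add: add_divide_distrib distrib_right)
    have kC: "k (x - y) = ennreal ((1 - C) / ?K x y)" by (simp add: k_def C_def)
    have nn: "(1 - C) / ?K x y \<ge> 0" using C(2) by simp
    show "ennreal (?A x y / ?K x y)
          + ennreal (?B x y / ?K x y)
       \<le> ennreal ((w x - w y)^2 / ?K x y) + (ennreal ((w x)^2) * k (x - y) + ennreal ((w y)^2) * k (x - y))"
      unfolding kC by (rule ennreal_sum[OF le]) (use nn in auto)
  qed
  also have "\<dots> = energy s w + ((\<integral>\<^sup>+y. (\<integral>\<^sup>+x. ennreal ((w x)^2) * k (x - y) \<partial>lborel) \<partial>lborel) + (\<integral>\<^sup>+y. (\<integral>\<^sup>+x. ennreal ((w y)^2) * k (x - y) \<partial>lborel) \<partial>lborel))"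
    unfolding energy_def by (simp add: nn_integral_add)
  also have "(\<integral>\<^sup>+y. (\<integral>\<^sup>+x. ennreal ((w x)^2) * k (x - y) \<partial>lborel) \<partial>lborel) = (\<integral>\<^sup>+x. (\<integral>\<^sup>+y. ennreal ((w x)^2) * k (x - y) \<partial>lborel) \<partial>lborel)"
    by (rule lborel_pair.Fubini') measurable
  also have "\<dots> = (\<integral>\<^sup>+x. ennreal ((w x)^2) \<partial>lborel) * \<kappa>"
    by (simp add: nn_integral_cmult nn_integral_multc nn_integral_lborel_reflect \<kappa>)
  also have "(\<integral>\<^sup>+y. (\<integral>\<^sup>+x. ennreal ((w y)^2) * k (x - y) \<partial>lborel) \<partial>lborel) = (\<integral>\<^sup>+x. ennreal ((w x)^2) \<partial>lborel) * \<kappa>"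
  proof -
    have "(\<integral>\<^sup>+x. k (x - y) \<partial>lborel) = \<kappa>" for y
      using nn_integral_lborel_translate[of k "- y"] by (simp add: \<kappa>)
    then show ?thesis by (simp add: nn_integral_cmult nn_integral_multc)
  qed
  finally show ?thesis unfolding \<kappa>_def[symmetric] by (simp only: mult_2 distrib_right)
qed

text \<open>Eigenfunctions are only Lebesgue measurable, while the Fourier estimates are over
  \<open>lborel\<close>; \<open>g\<close> is \<open>w\<close> times a Borel representative of
  \<open>\<phi>\<close>. Bounded support makes it integrable, and
  \<open>\<bar>w x\<bar> \<le> 1\<close> keeps its norm below that of \<open>\<phi>\<close>.\<close>

lemma fourier_modulated:
  fixes w \<phi> :: "'a::euclidean_space \<Rightarrow> real"
  assumes w[measurable]: "w \<in> borel_measurable borel" and w1: "\<And>x. \<bar>w x\<bar> \<le> 1" and bdd: "bounded \<Omega>" and w0: "\<And>x. x \<notin> \<Omega> \<Longrightarrow> w x = 0"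
    and \<phi>: "square_integrable lebesgue \<phi>"
  obtains g where "integrable lborel g" "integrable lborel (\<lambda>x. (g x)^2)" "(LINT x|lborel. (g x)^2) \<le> (LINT x|lebesgue. (\<phi> x)^2)"
    "\<And>\<xi>. (LINT x|lebesgue. w x * cos (\<xi> \<bullet> x) * \<phi> x)^2 + (LINT x|lebesgue. w x * sin (\<xi> \<bullet> x) * \<phi> x)^2 = fourier_sq g \<xi>"
proof -
  have \<phi>m: "\<phi> \<in> borel_measurable lebesgue" using \<phi> by (rule square_integrable_measurable)
  obtain \<phi>' where \<phi>'[measurable]: "\<phi>' \<in> borel_measurable lborel" and ae: "AE x in lborel. \<phi> x = \<phi>' x"
    using completion_ex_borel_measurable_real[OF \<phi>m] by blast
  then have ae': "AE x in lebesgue. \<phi> x = \<phi>' x" by (intro AE_completion)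
  have [measurable]: "\<phi>' \<in> borel_measurable lebesgue" "w \<in> borel_measurable lebesgue" "\<phi> \<in> borel_measurable lebesgue"
    using \<phi>m by (auto intro: measurable_completion)
  define g where "g x = w x * \<phi>' x" for x
  have [measurable]: "g \<in> borel_measurable borel" unfolding g_def by measurable
  have "integrable lebesgue (\<lambda>x. (\<phi>' x)^2)"
    using \<phi> ae' by (subst integrable_cong_AE[where g = "\<lambda>x. (\<phi> x)^2"]) (auto simp: square_integrable_def)
  then have i2: "integrable lborel (\<lambda>x. (\<phi>' x)^2)" by (subst (asm) integrable_completion) simp_all
  have "(LINT x|lebesgue. (\<phi> x)^2) = (LINT x|lebesgue. (\<phi>' x)^2)"
    using ae' by (intro integral_cong_AE) auto
  also have "\<dots> = (LINT x|lborel. (\<phi>' x)^2)" by (rule integral_completion) simp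
  finally have L2: "(LINT x|lebesgue. (\<phi> x)^2) = (LINT x|lborel. (\<phi>' x)^2)" .
  have gle: "(g x)^2 \<le> (\<phi>' x)^2" for x
    using w1[of x] mult_right_mono[of "\<bar>w x\<bar>" 1 "\<bar>\<phi>' x\<bar>"] by (simp add: g_def abs_le_square_iff[symmetric] abs_mult)
  have g2: "integrable lborel (\<lambda>x. (g x)^2)"
    by (rule Bochner_Integration.integrable_bound[OF i2]) (use gle in auto)
  obtain \<rho> where \<rho>: "\<rho> > 0" "\<And>x. x \<in> \<Omega> \<Longrightarrow> norm x < \<rho>"
    using bdd by (metis bounded_pos_less)
  have g1: "integrable lborel g"
  proof -
    have "square_integrable lborel (indicator (ball 0 \<rho>) :: 'a \<Rightarrow> real)"
      using \<rho> by (simp add: square_integrable_def power2_eq_square indicator_inter_arith[symmetric] emeasure_ball borel_measurable_indicator)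
    moreover have "square_integrable lborel g" using g2 by (simp add: square_integrable_def)
    ultimately have "integrable lborel (\<lambda>x. indicator (ball 0 \<rho>) x * g x)" by (rule square_integrable_mult)
    moreover have "indicator (ball 0 \<rho>) x * g x = g x" for x
      using w0[of x] \<rho>(2)[of x] by (cases "x \<in> \<Omega>") (auto simp: g_def)
    ultimately show ?thesis by simp
  qed
  have four: "(LINT x|lebesgue. w x * f x * \<phi> x) = (LINT x|lborel. g x * f x)" if [measurable]: "f \<in> borel_measurable borel" for f
  proof -
    have [measurable]: "f \<in> borel_measurable lebesgue" by (rule measurable_completion) simp
    have "(LINT x|lebesgue. w x * f x * \<phi> x) = (LINT x|lebesgue. g x * f x)"
      using ae' by (intro integral_cong_AE) (auto simp: g_def)
    also have "\<dots> = (LINT x|lborel. g x * f x)" by (rule integral_completion) simp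
    finally show ?thesis .
  qed
  show ?thesis
  proof (rule that[OF g1 g2])
    show "(LINT x|lborel. (g x)^2) \<le> (LINT x|lebesgue. (\<phi> x)^2)"
      unfolding L2 by (intro integral_mono g2 i2 gle)
    show "(LINT x|lebesgue. w x * cos (\<xi> \<bullet> x) * \<phi> x)^2 + (LINT x|lebesgue. w x * sin (\<xi> \<bullet> x) * \<phi> x)^2 = fourier_sq g \<xi>" for \<xi>
      unfolding fourier_sq_def by (simp add: four)
  qed
qed

text \<open>The cutoff stays arbitrary, with its energy bound \<open>W\<close> and squared norm
  \<open>X\<close> free. The term with \<open>r powr (2 * s)\<close> is the average of
  \<open>norm \<xi> powr (2 * s)\<close> over the ball of radius \<open>r\<close>; the other is the
  cutoff energy per unit of squared norm.\<close>

theorem eigenvalue_sum_le: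
  fixes \<Omega> :: "(real ^ 'n) set" and w :: "real ^ 'n \<Rightarrow> real"
  assumes s: "0 < s" "s < 1" and bdd: "bounded \<Omega>" and meas: "\<Omega> \<in> sets lebesgue"
    and lam: "eigenvalue_sequence s \<Omega> lam" and k: "1 \<le> k"
    and w[measurable]: "w \<in> borel_measurable borel" and w1: "\<And>x. \<bar>w x\<bar> \<le> 1" and w0: "\<And>x. x \<notin> \<Omega> \<Longrightarrow> w x = 0"
    and W: "energy s w \<le> ennreal W" "W \<ge> 0"
    and X: "X = (LINT x|lborel. (w x)^2)" "X > 0"
    and r: "r > 0" "unit_ball_vol CARD('n) * r ^ CARD('n) * X = (2 * pi) ^ CARD('n) * real k"
  shows "(\<Sum>i=1..k. lam i) \<le> real k * (real CARD('n) / (real CARD('n) + 2 * s) * r powr (2 * s) + frac_const CARD('n) s * W / (2 * X))"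
proof -
  define N where "N = real CARD('n)"
  have N: "N > 0" by (simp add: N_def)
  let ?c = "frac_const CARD('n) s"
  have c: "?c > 0" by (rule frac_const_pos[OF s])
  define \<Lambda> where "\<Lambda> = lam k"
  define P where "P = (2 * pi) ^ CARD('n)"
  have P: "P > 0" by (simp add: P_def)
  have mono: "lam i \<le> \<Lambda>" if "i \<in> {1..k}" for i
    using lam that unfolding eigenvalue_sequence_def mono_on_def \<Lambda>_def by auto
  obtain \<phi> where \<phi>: "\<And>i. i \<in> {1..k} \<Longrightarrow> \<phi> i \<in> H0s s \<Omega>" "\<And>i. i \<in> {1..k} \<Longrightarrow> (LINT x|lebesgue. (\<phi> i x)^2) = 1"
    and bessel: "\<And>f. f \<in> H0s s \<Omega> \<Longrightarrow> \<Lambda> * (LINT x|lebesgue. (f x)^2) - frac_form s f f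
        \<le> (\<Sum>i\<in>{1..k}. (\<Lambda> - lam i) * (LINT x|lebesgue. f x * \<phi> i x)^2)"
    using dirichlet_weighted_bessel[OF s bdd meas lam k] unfolding \<Lambda>_def by blast
  let ?a = "\<lambda>i \<xi>. (LINT x|lebesgue. w x * cos (\<xi> \<bullet> x) * \<phi> i x)^2 + (LINT x|lebesgue. w x * sin (\<xi> \<bullet> x) * \<phi> i x)^2"
  let ?G = "\<lambda>i g. integrable lborel g \<and> integrable lborel (\<lambda>x. (g x)^2) \<and> (LINT x|lborel. (g x)^2) \<le> 1 \<and> (\<forall>\<xi>. ?a i \<xi> = fourier_sq g \<xi>)"
  have "\<forall>i\<in>{1..k}. \<exists>g. ?G i g"
  proof
    fix i assume i: "i \<in> {1..k}"
    show "\<exists>g. ?G i g"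
      by (rule fourier_modulated[OF w w1 bdd w0 H0s_square_integrable[OF s(1) bdd \<phi>(1)[OF i]]]) (use \<phi>(2)[OF i] in auto)
  qed
  from bchoice[OF this] obtain g where G: "\<forall>i\<in>{1..k}. ?G i (g i)"
    by (elim exE) (rule that)
  then have g: "integrable lborel (g i)" "integrable lborel (\<lambda>x. (g i x)^2)" "(LINT x|lborel. (g i x)^2) \<le> 1"
      "?a i \<xi> = fourier_sq (g i) \<xi>"
    if "i \<in> {1..k}" for i \<xi>
    using that by simp_all
  \<comment> \<open>Positivity of \<open>X\<close> forces integrability, as the Bochner integral of
    a non-integrable function is 0 by default.\<close>
  have w2: "integrable lborel (\<lambda>x. (w x)^2)"
    using X not_integrable_integral_eq by fastforce
  have nnX: "(\<integral>\<^sup>+x. ennreal ((w x)^2) \<partial>lborel) = ennreal X"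
    unfolding X by (intro nn_integral_eq_integral w2) simp
  let ?\<nu> = "\<lambda>\<xi> :: real ^ 'n. norm \<xi> powr (2 * s)"
  let ?W = "\<lambda>\<xi>. W + 2 * X * (?\<nu> \<xi> / ?c)" and ?S = "\<lambda>\<xi>. \<Sum>i\<in>{1..k}. (\<Lambda> - lam i) * fourier_sq (g i) \<xi>"
  have pointwise: "\<Lambda> * X - ?c / 2 * W - X * ?\<nu> \<xi> \<le> ?S \<xi>" for \<xi>
  proof -
    let ?f = "\<lambda>x. w x * cos (\<xi> \<bullet> x)" and ?h = "\<lambda>x. w x * sin (\<xi> \<bullet> x)"
    have le: "energy s ?f + energy s ?h \<le> ennreal (?W \<xi>)"
    proof -
      have "energy s ?f + energy s ?h \<le> energy s w + 2 * ennreal X * ennreal (?\<nu> \<xi> / ?c)"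
        using energy_modulated_le[OF s w, of \<xi>] unfolding nnX by simp
      also have "\<dots> \<le> ennreal W + 2 * ennreal X * ennreal (?\<nu> \<xi> / ?c)" by (intro add_right_mono W)
      also have "\<dots> = ennreal (?W \<xi>)"
        using W(2) X(2) c by (simp add: ennreal_mult[symmetric] ennreal_plus[symmetric] ennreal_numeral[symmetric] del: ennreal_plus ennreal_numeral)
      finally show ?thesis .
    qed
    then have fin: "energy s ?f < \<infinity>" "energy s ?h < \<infinity>"
      by (auto simp: less_top[symmetric] top_unique)
    have fH: "?f \<in> H0s s \<Omega>" "ennreal (frac_form s ?f ?f) = ennreal (?c / 2) * energy s ?f"
      using w0 by (intro H0s_if_energy_finite[where \<Omega> = \<Omega>, OF _ _ fin(1)]; simp)+
    have hH: "?h \<in> H0s s \<Omega>" "ennreal (frac_form s ?h ?h) = ennreal (?c / 2) * energy s ?h"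
      using w0 by (intro H0s_if_energy_finite[where \<Omega> = \<Omega>, OF _ _ fin(2)]; simp)+
    have nn: "frac_form s ?f ?f \<ge> 0" "frac_form s ?h ?h \<ge> 0"
      using psd_form.form_nonneg[OF psd_frac_form[OF s]] fH hH by auto
    have "ennreal (frac_form s ?f ?f + frac_form s ?h ?h) = ennreal (?c / 2) * (energy s ?f + energy s ?h)"
      using nn by (simp add: ennreal_plus fH hH distrib_left)
    also have "\<dots> \<le> ennreal (?c / 2) * ennreal (?W \<xi>)" by (intro mult_left_mono le) simp
    also have "\<dots> = ennreal (?c / 2 * (?W \<xi>))"
      using c W X by (intro ennreal_mult[symmetric]) auto
    finally have "frac_form s ?f ?f + frac_form s ?h ?h \<le> ?c / 2 * (?W \<xi>)"
      using c W X by (subst (asm) ennreal_le_iff) auto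
    also have "\<dots> = ?c / 2 * W + X * ?\<nu> \<xi>" using c by (simp add: field_simps)
    finally have en: "frac_form s ?f ?f + frac_form s ?h ?h \<le> ?c / 2 * W + X * ?\<nu> \<xi>" .
    have L2: "(LINT x|lebesgue. (?f x)^2) + (LINT x|lebesgue. (?h x)^2) = X"
    proof -
      have "integrable lborel (\<lambda>x. (?f x)^2)" "integrable lborel (\<lambda>x. (?h x)^2)"
        by (rule Bochner_Integration.integrable_bound[OF w2]; simp add: power_mult_distrib mult_left_le abs_square_le_1)+
      then have "(LINT x|lborel. (?f x)^2) + (LINT x|lborel. (?h x)^2) = (LINT x|lborel. (?f x)^2 + (?h x)^2)" by simp
      also have "\<dots> = X"
      proof -
        have "(?f x)^2 + (?h x)^2 = (w x)^2" for x
          by (simp add: power_mult_distrib cos_squared_eq algebra_simps)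
        then show ?thesis by (simp add: X(1))
      qed
      moreover have "(LINT x|lebesgue. (?f x)^2) = (LINT x|lborel. (?f x)^2)" "(LINT x|lebesgue. (?h x)^2) = (LINT x|lborel. (?h x)^2)"
        by (rule integral_completion; measurable)+
      ultimately show ?thesis by simp
    qed
    have "\<Lambda> * X - (?c / 2 * W + X * ?\<nu> \<xi>) \<le> (\<Lambda> * (LINT x|lebesgue. (?f x)^2) - frac_form s ?f ?f) + (\<Lambda> * (LINT x|lebesgue. (?h x)^2) - frac_form s ?h ?h)"
      using en unfolding L2[symmetric] by (simp add: distrib_left)
    also have "\<dots> \<le> (\<Sum>i\<in>{1..k}. (\<Lambda> - lam i) * (LINT x|lebesgue. ?f x * \<phi> i x)^2) + (\<Sum>i\<in>{1..k}. (\<Lambda> - lam i) * (LINT x|lebesgue. ?h x * \<phi> i x)^2)"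
      by (intro add_mono bessel fH hH)
    also have "\<dots> = ?S \<xi>"
      unfolding sum.distrib[symmetric] by (intro sum.cong refl) (simp only: distrib_left[symmetric] g(4))
    finally show ?thesis by simp
  qed
  let ?B = "ball (0 :: real ^ 'n) r"
  let ?I = "\<lambda>i \<xi>. indicator ?B \<xi> * fourier_sq (g i) \<xi>"
  have B[measurable]: "?B \<in> sets borel" by simp
  define V where "V = unit_ball_vol N * r ^ CARD('n)"
  have V: "V > 0" "measure lborel ?B = V" using r N by (simp_all add: V_def N_def content_ball)
  have VX: "V * X = P * real k" using r(2) by (simp add: V_def N_def P_def)
  have plan: "integrable lborel (\<lambda>\<xi>. ?I i \<xi>)" "(LINT \<xi>|lborel. ?I i \<xi>) \<le> P" if i: "i \<in> {1..k}" for i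
  proof -
    have [measurable]: "g i \<in> borel_measurable borel" using g(1)[OF i] by auto
    have "(\<integral>\<^sup>+\<xi>. ennreal (fourier_sq (g i) \<xi>) * indicator ?B \<xi> \<partial>lborel) \<le> ennreal ((2 * pi) powr DIM(real ^ 'n) * (LINT x|lborel. (g i x)^2))"
      by (intro plancherel_ball_le g i)
    also have "\<dots> \<le> ennreal P"
      using g(3)[OF i] by (intro ennreal_leI) (simp add: P_def powr_realpow mult_left_le)
    finally have le: "(\<integral>\<^sup>+\<xi>. ennreal (?I i \<xi>) \<partial>lborel) \<le> ennreal P"
      by (simp add: ennreal_mult'' ennreal_indicator mult.commute fourier_sq_nonneg ennreal_mult)
    show int: "integrable lborel (\<lambda>\<xi>. ?I i \<xi>)"
    proof (rule integrableI_nonneg)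
      show "(\<lambda>\<xi>. ?I i \<xi>) \<in> borel_measurable lborel"
        using borel_measurable_fourier_sq[OF \<open>g i \<in> borel_measurable borel\<close>]
        by (intro borel_measurable_times borel_measurable_indicator) auto
    qed (auto simp: fourier_sq_nonneg le_less_trans[OF le])
    have "ennreal (LINT \<xi>|lborel. ?I i \<xi>) \<le> ennreal P"
      using le by (subst nn_integral_eq_integral[symmetric, OF int]) (auto simp: fourier_sq_nonneg)
    then show "(LINT \<xi>|lborel. ?I i \<xi>) \<le> P" using P by (subst (asm) ennreal_le_iff) auto
  qed
  have iB: "integrable lborel (indicator ?B :: real ^ 'n \<Rightarrow> real)" using r by (simp add: emeasure_ball)
  define Q where "Q = unit_ball_vol N * N / (N + 2 * s) * r powr (N + 2 * s)"
  have Q0: "Q \<ge> 0" using N s by (simp add: Q_def)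
  have rad: "has_bochner_integral lborel (\<lambda>\<xi>. indicator ?B \<xi> * ?\<nu> \<xi>) Q"
  proof (rule has_bochner_integral_nn_integral)
    show "(\<integral>\<^sup>+\<xi>. ennreal (indicator ?B \<xi> * ?\<nu> \<xi>) \<partial>lborel) = ennreal Q"
      using nn_integral_norm_powr_ball[of "2 * s" r, where 'a = "real ^ 'n"] s r
      by (simp add: Q_def N_def ennreal_mult ennreal_indicator mult.commute)
    show "(\<lambda>\<xi>. indicator ?B \<xi> * ?\<nu> \<xi>) \<in> borel_measurable lborel" by measurable
  qed (use Q0 in auto)
  let ?L = "\<lambda>\<xi>. (\<Lambda> * X - ?c / 2 * W) * indicator ?B \<xi> - X * (indicator ?B \<xi> * ?\<nu> \<xi>)"
  have "(\<Lambda> * X - ?c / 2 * W) * V - X * Q = (LINT \<xi>|lborel. ?L \<xi>)"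
    using rad iB V by (simp add: has_bochner_integral_iff)
  also have "\<dots> \<le> (LINT \<xi>|lborel. (\<Sum>i\<in>{1..k}. (\<Lambda> - lam i) * (?I i \<xi>)))"
  proof (rule integral_mono)
    show "integrable lborel (\<lambda>\<xi>. ?L \<xi>)"
      using rad iB by (intro Bochner_Integration.integrable_diff integrable_mult_right) (auto simp: has_bochner_integral_iff)
    show "integrable lborel (\<lambda>\<xi>. \<Sum>i\<in>{1..k}. (\<Lambda> - lam i) * (?I i \<xi>))"
      by (intro Bochner_Integration.integrable_sum integrable_mult_right plan)
    fix \<xi> :: "real ^ 'n"
    have "indicator ?B \<xi> * (\<Lambda> * X - ?c / 2 * W - X * ?\<nu> \<xi>) \<le> indicator ?B \<xi> * ?S \<xi>"
      by (intro mult_left_mono pointwise) simp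
    then show "?L \<xi>
       \<le> (\<Sum>i\<in>{1..k}. (\<Lambda> - lam i) * (?I i \<xi>))"
      by (simp add: sum_distrib_left algebra_simps)
  qed
  also have "\<dots> = (\<Sum>i\<in>{1..k}. (\<Lambda> - lam i) * (LINT \<xi>|lborel. ?I i \<xi>))"
    using plan by (subst Bochner_Integration.integral_sum) auto
  \<comment> \<open>The weights are nonnegative because \<open>\<Lambda>\<close> is the largest of
    the first \<open>k\<close> values, so each Fourier mass may be replaced by its upper bound
    \<open>P\<close>.\<close>
  also have "\<dots> \<le> (\<Sum>i\<in>{1..k}. (\<Lambda> - lam i) * P)"
    using mono plan by (intro sum_mono mult_left_mono) auto
  also have "\<dots> = (\<Sum>i\<in>{1..k}. \<Lambda> - lam i) * P" by (rule sum_distrib_right[symmetric])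
  also have "\<dots> = real k * \<Lambda> * P - P * (\<Sum>i\<in>{1..k}. lam i)"
    by (simp add: sum_subtractf left_diff_distrib)
  finally have "P * (\<Sum>i\<in>{1..k}. lam i) \<le> real k * \<Lambda> * P - \<Lambda> * (V * X) + ?c / 2 * W * V + X * Q"
    by (simp add: algebra_simps)
  \<comment> \<open>The radius was chosen to give \<open>V * X = P * real k\<close>: the two
    \<open>\<Lambda>\<close> terms cancel, and the result contains no trace of
    \<open>\<Lambda>\<close>.\<close>
  also have "real k * \<Lambda> * P - \<Lambda> * (V * X) + ?c / 2 * W * V + X * Q = ?c / 2 * W * V + X * Q" unfolding VX by simp
  also have "X * Q = V * X * (N / (N + 2 * s) * r powr (2 * s))"
    using r(1) by (simp add: Q_def V_def N_def powr_add powr_realpow field_simps)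
  also have "?c / 2 * W * V = V * X * (?c * W / (2 * X))" using X(2) by simp
  also have "V * X * (?c * W / (2 * X)) + V * X * (N / (N + 2 * s) * r powr (2 * s)) = P * (real k * (N / (N + 2 * s) * r powr (2 * s) + ?c * W / (2 * X)))"
    unfolding VX by (simp add: algebra_simps)
  finally show ?thesis using P by (simp add: N_def)
qed

section \<open>Cutoff functions and the eigenvalue sum\<close>

text \<open>Averaging \<open>1 - cos(\<xi>z)\<close> over a Gaussian in \<open>\<xi>\<close> reduces this to the case of a single frequency.\<close>

lemma nn_integral_one_minus_gauss_le:
  assumes s: "0 < s" "s < 1" and d: "\<delta> > 0"
  shows "(\<integral>\<^sup>+z. ennreal ((1 - exp (- ((norm z)^2) / (4 * \<delta>))) / norm (z :: 'a::euclidean_space) powr (real DIM('a) + 2 * s)) \<partial>lborel)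
    \<le> ennreal (2 * 2 powr (real DIM('a) / 2) * \<delta> powr (- s) / frac_const DIM('a) s)"
proof -
  define N where "N = real DIM('a)"
  define c where "c = frac_const DIM('a) s"
  have c: "c > 0" unfolding c_def by (rule frac_const_pos[OF s])
  let ?h = "\<lambda>z::'a. ennreal ((1 - exp (- ((norm z)^2) / (4 * \<delta>))) / norm z powr (N + 2 * s))"
  let ?F = "\<lambda>(z::'a) \<xi>. ennreal (exp (- \<delta> * (norm \<xi>)^2)) * ennreal ((1 - cos (\<xi> \<bullet> z)) / norm z powr (N + 2 * s))"
  let ?J = "\<integral>\<^sup>+z. ?h z \<partial>lborel"
  let ?g = "(pi / \<delta>) powr (N / 2)"
  have g: "?g > 0" using d by simp
  have avg: "ennreal ?g * ?h z
     = (\<integral>\<^sup>+\<xi>. ?F z \<xi> \<partial>lborel)" for z :: 'a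
  proof -
    have "has_bochner_integral lborel (\<lambda>\<xi>::'a. exp (- \<delta> * (norm \<xi>)^2) - cos (z \<bullet> \<xi>) * exp (- \<delta> * (norm \<xi>)^2))
         (?g - ?g * exp (- ((norm z)^2) / (4 * \<delta>)))"
      unfolding N_def by (intro has_bochner_integral_diff gaussian_integral gaussian_cos d)
    then have hb: "has_bochner_integral lborel (\<lambda>\<xi>::'a. exp (- \<delta> * (norm \<xi>)^2) * (1 - cos (\<xi> \<bullet> z)))
         (?g * (1 - exp (- ((norm z)^2) / (4 * \<delta>))))"
      by (simp add: algebra_simps inner_commute)
    have "(\<integral>\<^sup>+\<xi>. ?F z \<xi> \<partial>lborel)
      = (\<integral>\<^sup>+\<xi>. ennreal (exp (- \<delta> * (norm \<xi>)^2) * (1 - cos (\<xi> \<bullet> z))) * ennreal (1 / norm z powr (N + 2 * s)) \<partial>lborel)"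
      by (intro nn_integral_cong) (simp add: ennreal_mult[symmetric])
    also have "\<dots> = ennreal (?g * (1 - exp (- ((norm z)^2) / (4 * \<delta>)))) * ennreal (1 / norm z powr (N + 2 * s))"
      using hb by (subst nn_integral_multc) (auto simp: has_bochner_integral_iff nn_integral_eq_integral)
    also have "\<dots> = ennreal ?g * ?h z"
      using d by (simp add: ennreal_mult[symmetric])
    finally show ?thesis by simp
  qed
  have "ennreal ?g * ?J = (\<integral>\<^sup>+z. (\<integral>\<^sup>+\<xi>. ?F z \<xi> \<partial>lborel) \<partial>lborel)"
    unfolding avg[symmetric] by (rule nn_integral_cmult[symmetric]) measurable
  also have "\<dots> = (\<integral>\<^sup>+\<xi>. (\<integral>\<^sup>+z. ?F z \<xi> \<partial>lborel) \<partial>lborel)"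
    by (rule lborel_pair.Fubini') measurable
  also have "\<dots> = (\<integral>\<^sup>+\<xi>. ennreal (exp (- \<delta> * (norm \<xi>)^2)) * ennreal (norm (\<xi> :: 'a) powr (2 * s) / c) \<partial>lborel)"
    unfolding c_def N_def nn_integral_one_minus_cos[OF s, symmetric]
    by (intro nn_integral_cong nn_integral_cmult) measurable
  also have "\<dots> \<le> (\<integral>\<^sup>+\<xi>. ennreal (2 * \<delta> powr (- s) / c) * ennreal (exp (- (\<delta> / 2) * (norm (\<xi> :: 'a))^2)) \<partial>lborel)"
  proof (intro nn_integral_mono)
    fix \<xi> :: 'a
    define q where "q = \<delta> * (norm \<xi>)^2"
    have q: "q \<ge> 0" using d by (simp add: q_def)
    \<comment> \<open>The power is absorbed into half of the Gaussian exponent, which keeps the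
      frequency integral finite and leaves the scaling factor
      \<open>\<delta> powr (- s)\<close>.\<close>
    have "q powr s \<le> 1 + q"
    proof (cases "q \<le> 1")
      case True
      then have "q powr s \<le> 1" using q s powr_mono2[of s q 1] by simp
      then show ?thesis using q by simp
    next
      case False
      then have "q powr s \<le> q powr 1" using s by (intro powr_mono) auto
      then show ?thesis using False by simp
    qed
    also have "\<dots> \<le> 2 * exp (q / 2)" using exp_ge_add_one_self[of "q / 2"] q by linarith
    finally have "q powr s \<le> 2 * exp (q / 2)" .
    then have "\<delta> powr (- s) * q powr s \<le> \<delta> powr (- s) * (2 * exp (q / 2))" by (intro mult_left_mono) auto
    moreover have "\<delta> powr (- s) * q powr s = norm \<xi> powr (2 * s)"
    proof -
      have "q powr s = \<delta> powr s * ((norm \<xi>)^2) powr s" using d by (simp add: q_def powr_mult)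
      also have "((norm \<xi>)^2) powr s = (norm \<xi> powr 2) powr s" by simp
      also have "\<dots> = norm \<xi> powr (2 * s)" by (rule powr_powr)
      finally show ?thesis using d by (simp add: mult.assoc[symmetric] powr_add[symmetric])
    qed
    ultimately have "exp (- q) * norm \<xi> powr (2 * s) \<le> exp (- q) * (\<delta> powr (- s) * (2 * exp (q / 2)))" by (intro mult_left_mono) auto
    also have "\<dots> = 2 * \<delta> powr (- s) * exp (- q / 2)" by (simp add: exp_minus field_simps exp_add[symmetric])
    finally have "exp (- q) * (norm \<xi> powr (2 * s) / c) \<le> 2 * \<delta> powr (- s) / c * exp (- q / 2)"
      using c by (simp add: field_simps)
    then have "ennreal (exp (- q) * (norm \<xi> powr (2 * s) / c)) \<le> ennreal (2 * \<delta> powr (- s) / c * exp (- q / 2))" by (rule ennreal_leI)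
    then show "ennreal (exp (- \<delta> * (norm \<xi>)^2)) * ennreal (norm \<xi> powr (2 * s) / c)
      \<le> ennreal (2 * \<delta> powr (- s) / c) * ennreal (exp (- (\<delta> / 2) * (norm \<xi>)^2))"
      using c by (simp add: ennreal_mult[symmetric] q_def)
  qed
  also have "\<dots> = ennreal (2 * \<delta> powr (- s) / c) * ennreal ((pi / (\<delta> / 2)) powr (N / 2))"
    using gaussian_integral[of "\<delta> / 2", where 'a = 'a] d
    by (subst nn_integral_cmult) (auto simp: has_bochner_integral_iff nn_integral_eq_integral N_def)
  also have "\<dots> = ennreal ?g * ennreal (2 * 2 powr (N / 2) * \<delta> powr (- s) / c)"
  proof -
    have "(pi / (\<delta> / 2)) powr (N / 2) = (2 * (pi / \<delta>)) powr (N / 2)" by (simp add: field_simps)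
    also have "\<dots> = 2 powr (N / 2) * ?g" using d by (intro powr_mult)
    finally have "(pi / (\<delta> / 2)) powr (N / 2) = 2 powr (N / 2) * ?g" .
    then show ?thesis using c by (simp add: ennreal_mult[symmetric] mult_ac)
  qed
  finally have "ennreal ?g * ?J \<le> ennreal ?g * ennreal (2 * 2 powr (N / 2) * \<delta> powr (- s) / c)" .
  then have "?J \<le> ennreal (2 * 2 powr (N / 2) * \<delta> powr (- s) / c)"
    by (subst (asm) ennreal_mult_le_mult_iff) (use g in auto)
  then show ?thesis by (simp add: N_def c_def)
qed

text \<open>After \<open>x = y + z\<close> the energy integrates squared translation differences
  against the kernel. The profile \<open>min 1 ((norm z)^2 / \<delta>)\<close> is dominated by a
  multiple of the Gaussian one, whose kernel integral has just been estimated.\<close>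

lemma energy_le_of_translation:
  fixes w :: "'a::euclidean_space \<Rightarrow> real"
  assumes s: "0 < s" "s < 1" and d: "\<delta> > 0" and w[measurable]: "w \<in> borel_measurable borel" and C: "C \<ge> 0"
    and trans: "\<And>z. (\<integral>\<^sup>+y. ennreal ((w (y + z) - w y)^2) \<partial>lborel) \<le> ennreal (C * min 1 ((norm z)^2 / \<delta>))"
  shows "energy s w \<le> ennreal (10 * C * 2 powr (real DIM('a) / 2) / frac_const DIM('a) s * \<delta> powr (- s))"
proof -
  define p where "p = real DIM('a) + 2 * s"
  let ?h = "\<lambda>z::'a. ennreal ((1 - exp (- ((norm z)^2) / (4 * \<delta>))) / norm z powr p)" and ?d = "\<lambda>y z. ennreal ((w (y + z) - w y)^2 / norm z powr p)"
  have "energy s w = (\<integral>\<^sup>+y. (\<integral>\<^sup>+z. ?d y z \<partial>lborel) \<partial>lborel)"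
    unfolding energy_def
  proof (rule nn_integral_cong)
    fix y :: 'a
    show "(\<integral>\<^sup>+x. ennreal ((w x - w y)^2 / norm (x - y) powr (real DIM('a) + 2 * s)) \<partial>lborel) = (\<integral>\<^sup>+z. ?d y z \<partial>lborel)"
      using nn_integral_lborel_translate[of "\<lambda>x. ennreal ((w x - w y)^2 / norm (x - y) powr (real DIM('a) + 2 * s))" y]
      by (simp add: p_def)
  qed
  also have "\<dots> = (\<integral>\<^sup>+z. (\<integral>\<^sup>+y. ?d y z \<partial>lborel) \<partial>lborel)"
    by (rule lborel_pair.Fubini') measurable
  also have "\<dots> \<le> (\<integral>\<^sup>+z. ennreal (5 * C) * ?h z \<partial>lborel)"
  proof (intro nn_integral_mono)
    fix z :: 'a
    define q where "q = (norm z)^2 / \<delta>"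
    have q: "q \<ge> 0" using d by (simp add: q_def)
    have "1 + q / 4 \<le> exp (q / 4)" by (rule exp_ge_add_one_self)
    then have "exp (- (q / 4)) \<le> 1 / (1 + q / 4)" using q by (simp add: exp_minus field_simps)
    \<comment> \<open>The 5 comes from \<open>min 1 q * (4 + q) \<le> 5 * q\<close>, which is sharp
      at \<open>q = 1\<close>.\<close>
    moreover have "min 1 q \<le> 5 * (1 - 1 / (1 + q / 4))"
    proof -
      have "1 - 1 / (1 + q / 4) = q / (4 + q)" using q by (simp add: field_simps)
      moreover have "min 1 q * (4 + q) \<le> 5 * q"
        using q mult_left_le[of q q] by (cases "1 \<le> q") (auto simp: min_def distrib_left)
      ultimately show ?thesis using q by (simp add: field_simps)
    qed
    ultimately have m: "min 1 q \<le> 5 * (1 - exp (- ((norm z)^2) / (4 * \<delta>)))" by (simp add: q_def field_simps)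
    have "(\<integral>\<^sup>+y. ?d y z \<partial>lborel) = (\<integral>\<^sup>+y. ennreal ((w (y + z) - w y)^2) * ennreal (1 / norm z powr p) \<partial>lborel)"
      by (simp add: ennreal_mult[symmetric])
    also have "\<dots> = (\<integral>\<^sup>+y. ennreal ((w (y + z) - w y)^2) \<partial>lborel) * ennreal (1 / norm z powr p)"
      by (rule nn_integral_multc) measurable
    also have "\<dots> \<le> ennreal (C * min 1 q) * ennreal (1 / norm z powr p)"
      unfolding q_def by (intro mult_right_mono trans) simp
    also have "\<dots> \<le> ennreal (C * (5 * (1 - exp (- ((norm z)^2) / (4 * \<delta>))))) * ennreal (1 / norm z powr p)"
      using m C by (intro mult_right_mono ennreal_leI mult_left_mono) auto
    also have "\<dots> = ennreal (5 * C) * ?h z"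
      using C d by (simp add: ennreal_mult[symmetric] mult_ac)
    finally show "(\<integral>\<^sup>+y. ?d y z \<partial>lborel)
       \<le> ennreal (5 * C) * ?h z" .
  qed
  also have "\<dots> = ennreal (5 * C) * (\<integral>\<^sup>+z. ?h z \<partial>lborel)"
    by (rule nn_integral_cmult) measurable
  also have "\<dots> \<le> ennreal (5 * C) * ennreal (2 * 2 powr (real DIM('a) / 2) * \<delta> powr (- s) / frac_const DIM('a) s)"
    unfolding p_def by (intro mult_left_mono nn_integral_one_minus_gauss_le s d) simp
  also have "\<dots> = ennreal (10 * C * 2 powr (real DIM('a) / 2) / frac_const DIM('a) s * \<delta> powr (- s))"
    using C frac_const_pos[OF s, of "DIM('a)"] by (simp add: ennreal_mult[symmetric] mult_ac)
  finally show ?thesis .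
qed

text \<open>Distance to the complement rather than to the frontier: it vanishes off
  \<open>\<Omega>\<close> by itself and is Lipschitz on the whole space.\<close>

definition cutoff :: "'a::metric_space set \<Rightarrow> real \<Rightarrow> 'a \<Rightarrow> real" where
  "cutoff \<Omega> \<delta> x = min 1 (infdist x (- \<Omega>) / \<delta>)"

lemma cutoff_bounds: "\<delta> > 0 \<Longrightarrow> 0 \<le> cutoff \<Omega> \<delta> x" "cutoff \<Omega> \<delta> x \<le> 1"
  by (simp_all add: cutoff_def infdist_nonneg)

lemma cutoff_outside: "x \<notin> \<Omega> \<Longrightarrow> cutoff \<Omega> \<delta> x = 0"
  by (simp add: cutoff_def)

lemma cutoff_measurable [measurable]: "cutoff \<Omega> \<delta> \<in> borel_measurable borel"
  unfolding cutoff_def by (intro borel_measurable_min borel_measurable_divide borel_measurable_continuous_onI continuous_intros)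

lemma infdist_Lipschitz: "\<bar>infdist x A - infdist y A\<bar> \<le> dist x y"
  using infdist_triangle[of x A y] infdist_triangle[of y A x] by (auto simp: dist_commute abs_le_iff)

text \<open>If neither endpoint lies in the layer of depth \<open>\<delta> + norm z\<close>, the two
  values agree: either both points are outside \<open>\<Omega>\<close>, or both have depth at least
  \<open>\<delta>\<close>, where the cutoff is 1.\<close>

lemma cutoff_translate_sq_le:
  fixes \<Omega> :: "'a::euclidean_space set"
  assumes d: "\<delta> > 0"
  shows "(cutoff \<Omega> \<delta> (y + z) - cutoff \<Omega> \<delta> y)^2 \<le>
    min 1 ((norm z)^2 / \<delta>^2) * (indicator {x\<in>\<Omega>. infdist x (- \<Omega>) < \<delta> + norm z} (y + z) + indicator {x\<in>\<Omega>. infdist x (- \<Omega>) < \<delta> + norm z} y)"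
proof -
  let ?d = "cutoff \<Omega> \<delta> (y + z) - cutoff \<Omega> \<delta> y" and ?L = "{x\<in>\<Omega>. infdist x (- \<Omega>) < \<delta> + norm z}"
  let ?\<sigma> = "\<lambda>x. infdist x (- \<Omega>)"
  have L: "\<bar>?\<sigma> (y + z) - ?\<sigma> y\<bar> \<le> norm z" using infdist_Lipschitz[of "y + z" "- \<Omega>" y] by (simp add: dist_norm)
  show ?thesis
  proof (cases "(y + z \<in> \<Omega> \<and> ?\<sigma> (y + z) < \<delta> + norm z) \<or> (y \<in> \<Omega> \<and> ?\<sigma> y < \<delta> + norm z)")
    case True
    have "\<bar>?d\<bar> \<le> \<bar>?\<sigma> (y + z) / \<delta> - ?\<sigma> y / \<delta>\<bar>"
      unfolding cutoff_def by (simp add: min_def abs_if)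
    also have "\<dots> \<le> norm z / \<delta>" using L d by (simp add: diff_divide_distrib[symmetric] divide_right_mono)
    finally have 1: "?d^2 \<le> (norm z / \<delta>)^2"
      by (subst abs_le_square_iff[symmetric]) (use d in auto)
    have "\<bar>?d\<bar> \<le> 1"
      using cutoff_bounds(1)[OF d, of \<Omega> "y + z"] cutoff_bounds(1)[OF d, of \<Omega> y]
        cutoff_bounds(2)[of \<Omega> \<delta> "y + z"] cutoff_bounds(2)[of \<Omega> \<delta> y] by (simp add: abs_le_iff)
    then have 2: "?d^2 \<le> 1" by (simp add: abs_square_le_1)
    have m: "min 1 ((norm z)^2 / \<delta>^2) \<ge> 0" by simp
    have "(1::real) \<le> indicator ?L (y + z) + indicator ?L y"
      using True by (auto simp: indicator_def)
    from mult_left_mono[OF this m] show ?thesis using 1 2 by (simp add: power_divide)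
  next
    case False
    have "cutoff \<Omega> \<delta> (y + z) = cutoff \<Omega> \<delta> y"
    proof (cases "y \<in> \<Omega> \<or> y + z \<in> \<Omega>")
      case True
      then have "?\<sigma> y \<ge> \<delta>" "?\<sigma> (y + z) \<ge> \<delta>" using False L norm_ge_zero[of z] by (auto simp: not_less)
      then show ?thesis using d by (simp add: cutoff_def)
    qed (simp add: cutoff_outside)
    then show ?thesis by simp
  qed
qed

text \<open>Differences live on two copies of a layer of volume at most
  \<open>min M (C * (\<delta> + norm z))\<close>. For \<open>norm z \<le> \<delta>\<close> the
  Lipschitz factor \<open>(norm z)^2 / \<delta>^2\<close> meets a depth of at most
  \<open>2 * \<delta>\<close>; beyond, the depth is at most \<open>2 * norm z\<close>, hence at most
  \<open>2 * (norm z)^2 / \<delta>\<close>. The total volume \<open>M\<close> gives the cap.\<close>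

lemma cutoff_translation_bound:
  fixes \<Omega> :: "'a::euclidean_space set"
  assumes op: "open \<Omega>" and d: "\<delta> > 0" and C: "C \<ge> 0" and M: "emeasure lborel \<Omega> = ennreal M" "M \<ge> 0"
    and layer: "\<And>t. t > 0 \<Longrightarrow> emeasure lborel {x\<in>\<Omega>. infdist x (- \<Omega>) < t} \<le> ennreal (C * t)"
  shows "(\<integral>\<^sup>+y. ennreal ((cutoff \<Omega> \<delta> (y + z) - cutoff \<Omega> \<delta> y)^2) \<partial>lborel) \<le> ennreal ((4 * C + 2 * M) * min 1 ((norm z)^2 / \<delta>))"
proof -
  let ?d = "\<lambda>y. cutoff \<Omega> \<delta> (y + z) - cutoff \<Omega> \<delta> y"
  define L where "L = {x\<in>\<Omega>. infdist x (- \<Omega>) < \<delta> + norm z}"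
  have L_eq: "L = \<Omega> \<inter> {x. infdist x (- \<Omega>) < \<delta> + norm z}" by (auto simp: L_def)
  have [measurable]: "L \<in> sets borel" unfolding L_eq using op
    by (intro sets.Int borel_open open_Collect_less continuous_intros) auto
  define a where "a = min 1 ((norm z)^2 / \<delta>^2)"
  have a: "a \<ge> 0" by (simp add: a_def)
  define l where "l = min M (C * (\<delta> + norm z))"
  have l0: "l \<ge> 0" using C M d by (simp add: l_def)
  have Ll: "emeasure lborel L \<le> ennreal l"
  proof -
    have "emeasure lborel L \<le> ennreal M" unfolding M(1)[symmetric] using op by (intro emeasure_mono) (auto simp: L_def)
    moreover have "emeasure lborel L \<le> ennreal (C * (\<delta> + norm z))"
      unfolding L_def using d norm_ge_zero[of z] by (intro layer) linarith
    ultimately show ?thesis unfolding l_def by (simp add: min_def)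
  qed
  have "(\<integral>\<^sup>+y. ennreal ((?d y)^2) \<partial>lborel) \<le> (\<integral>\<^sup>+y. ennreal a * (indicator L (z + y) + indicator L y) \<partial>lborel)"
  proof (intro nn_integral_mono)
    fix y
    have "ennreal ((?d y)^2) \<le> ennreal (a * (indicator L (y + z) + indicator L y))"
      unfolding a_def L_def by (intro ennreal_leI cutoff_translate_sq_le d)
    also have "\<dots> = ennreal a * (indicator L (z + y) + indicator L y)"
      using a by (simp add: ennreal_mult ennreal_plus ennreal_indicator add.commute)
    finally show "ennreal ((?d y)^2) \<le> ennreal a * (indicator L (z + y) + indicator L y)" .
  qed
  also have "\<dots> = ennreal a * (emeasure lborel L + emeasure lborel L)"
    using nn_integral_lborel_translate[of "indicator L" z] by (simp add: nn_integral_cmult nn_integral_add)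
  also have "\<dots> \<le> ennreal a * (ennreal l + ennreal l)" by (intro mult_left_mono add_mono Ll) simp
  also have "\<dots> = ennreal (2 * a * l)" using a l0 by (simp add: ennreal_mult[symmetric] ennreal_plus[symmetric] del: ennreal_plus)
  also have "\<dots> \<le> ennreal ((4 * C + 2 * M) * min 1 ((norm z)^2 / \<delta>))"
  proof (rule ennreal_leI)
    have "2 * a * l \<le> 2 * M"
    proof -
      have "a * l \<le> 1 * M" using a l0 by (intro mult_mono) (auto simp: a_def l_def)
      then show ?thesis by simp
    qed
    then have 1: "2 * a * l \<le> 4 * C + 2 * M" using C by linarith
    have "a * l \<le> 2 * C * ((norm z)^2 / \<delta>)"
    proof (cases "norm z \<le> \<delta>")
      case True
      have "a * l \<le> (norm z)^2 / \<delta>^2 * (C * (2 * \<delta>))"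
        using a l0 True C by (intro mult_mono) (auto simp: a_def l_def min_le_iff_disj intro!: mult_left_mono)
      also have "\<dots> = 2 * C * ((norm z)^2 / \<delta>)" using d by (simp add: power2_eq_square field_simps)
      finally show ?thesis .
    next
      case False
      have "a * l \<le> 1 * (C * (2 * norm z))"
        using a l0 False C by (intro mult_mono) (auto simp: a_def l_def min_le_iff_disj intro!: mult_left_mono)
      also have "\<dots> = 2 * C * (norm z * \<delta> / \<delta>)" using d by simp
      also have "\<dots> \<le> 2 * C * ((norm z)^2 / \<delta>)"
        using False d C by (intro mult_left_mono divide_right_mono) (auto simp: power2_eq_square intro!: mult_left_mono)
      finally show ?thesis .
    qed
    then have "2 * a * l \<le> 4 * C * ((norm z)^2 / \<delta>)" by simp
    also have "\<dots> \<le> (4 * C + 2 * M) * ((norm z)^2 / \<delta>)" using M d by (intro mult_right_mono) auto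
    finally show "2 * a * l \<le> (4 * C + 2 * M) * min 1 ((norm z)^2 / \<delta>)" using 1 by (simp add: min_def)
  qed
  finally show ?thesis .
qed

text \<open>Points of the complement lie outside the ball that fits into \<open>\<Omega>\<close>.
  Hence a layer measured from the complement is contained in the one measured from the frontier,
  whose volume is controlled.\<close>

lemma infdist_frontier_le_complement:
  fixes \<Omega> :: "'a::euclidean_space set"
  assumes "x \<in> \<Omega>" "- \<Omega> \<noteq> {}"
  shows "infdist x (frontier \<Omega>) \<le> infdist x (- \<Omega>)"
proof -
  have "infdist x (frontier \<Omega>) \<le> dist x y" if "y \<in> - \<Omega>" for y
    using ball_subset_of_infdist_frontier[OF assms(1)] that by (force simp: not_less)
  then show ?thesis unfolding infdist_def[of x "- \<Omega>"] using assms(2) by (auto intro!: cINF_greatest)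
qed

text \<open>Converts the relative volume deficit \<open>q\<close> of the cutoff into a relative
  error of the Weyl term, with \<open>p\<close> standing for \<open>2 * s / N\<close>.\<close>

lemma powr_neg_one_minus_le:
  fixes p q :: real
  assumes "0 \<le> p" "p \<le> 2" "0 \<le> q" "q \<le> 1 / 2"
  shows "(1 - q) powr (- p) \<le> 1 + 6 * q"
proof -
  have "(1 - q) powr (- p) = (1 / (1 - q)) powr p" using assms by (simp add: powr_minus powr_divide inverse_eq_divide)
  also have "\<dots> \<le> (1 / (1 - q)) powr 2" using assms by (intro powr_mono) auto
  also have "\<dots> = (1 / (1 - q))^2" using assms by simp
  also have "\<dots> \<le> (1 + 2 * q)^2"
  proof (rule power_mono)
    have "0 \<le> q * (1 - 2 * q)" using assms by simp
    then show "1 / (1 - q) \<le> 1 + 2 * q" using assms by (simp add: field_simps)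
  qed (use assms in simp)
  also have "\<dots> \<le> 1 + 6 * q"
  proof -
    have "q * (4 * q) \<le> q * 2" using assms by (intro mult_left_mono) auto
    then show ?thesis by (simp add: power2_eq_square algebra_simps)
  qed
  finally show ?thesis .
qed


theorem theorem1p1:
  fixes s R c0 :: real
    and \<Omega> :: "(real ^ 'n) set"
    and lam :: "nat \<Rightarrow> real"
  assumes s: "0 < s" "s < 1"
    and domain: "open \<Omega>" "connected \<Omega>" "\<Omega> \<noteq> {}" "bounded \<Omega>"
    and R: "0 < R" "ball 0 R \<subseteq> \<Omega>" "\<Omega> \<subseteq> ball 0 (2 * R)"
    and c0: "0 < c0"
    and level_sets: "\<forall>t>0. hausdorff_measure (CARD('n) - 1) {x \<in> \<Omega>. infdist x (frontier \<Omega>) = t}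
                       \<le> ennreal (c0 * R ^ (CARD('n) - 1))"
    and lam: "eigenvalue_sequence s \<Omega> lam"
  shows "\<exists>c1>0. \<forall>k::nat. 1 \<le> k \<longrightarrow>
           (\<Sum>i=1..k. lam i)
             \<le> (2 * pi) powr (2 * s) * real CARD('n) / (real CARD('n) + 2 * s)
                 * (measure lebesgue (ball 0 1 :: (real ^ 'n) set) * measure lebesgue \<Omega>)
                     powr (- (2 * s / real CARD('n)))
                 * real k powr (1 + 2 * s / real CARD('n))
               + c1 * real k powr (1 + s / real CARD('n))"
proof -
  define N where "N = real CARD('n)"
  have N: "N \<ge> 1" by (simp add: N_def Suc_leI)
  define \<omega> where "\<omega> = unit_ball_vol N"
  have \<omega>: "\<omega> > 0" using N by (simp add: \<omega>_def)
  have \<omega>_eq: "measure lebesgue (ball 0 1 :: (real ^ 'n) set) = \<omega>" by (simp add: content_ball \<omega>_def N_def)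
  have \<Omega>[measurable]: "\<Omega> \<in> sets borel" using domain(1) by simp
  define M where "M = measure lebesgue \<Omega>"
  have M_eq: "emeasure lborel \<Omega> = ennreal M"
    using emeasure_bounded_finite[OF domain(4)] by (simp add: M_def emeasure_eq_ennreal_measure less_top)
  have M: "M > 0"
  proof -
    have "0 < emeasure lborel (ball (0 :: real ^ 'n) R)" using R(1) by (simp add: emeasure_ball)
    also have "\<dots> \<le> emeasure lborel \<Omega>" using R(2) by (intro emeasure_mono) auto
    finally show ?thesis by (simp add: M_eq)
  qed
  have "\<Omega> \<noteq> UNIV" using domain(4) not_bounded_UNIV by blast
  then have comp: "- \<Omega> \<noteq> {}" by auto
  have front: "frontier \<Omega> \<noteq> {}" using frontier_not_empty[OF domain(3) \<open>\<Omega> \<noteq> UNIV\<close>] .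
  define C where "C = 40 ^ CARD('n) * layer_const CARD('n) * (c0 * R ^ (CARD('n) - 1))"
  have C: "C > 0" using layer_const_pos[of "CARD('n)"] c0 R(1) by (simp add: C_def)
  have layer: "emeasure lborel {x\<in>\<Omega>. infdist x (- \<Omega>) < t} \<le> ennreal (C * t)" if t: "t > 0" for t
  proof -
    have m: "{x\<in>\<Omega>. infdist x (frontier \<Omega>) < t} \<in> sets borel"
    proof -
      have "{x\<in>\<Omega>. infdist x (frontier \<Omega>) < t} = \<Omega> \<inter> {x. infdist x (frontier \<Omega>) < t}" by auto
      also have "\<dots> \<in> sets borel" using domain(1) by (intro sets.Int borel_open open_Collect_less continuous_intros) auto
      finally show ?thesis .
    qed
    have "emeasure lborel {x\<in>\<Omega>. infdist x (- \<Omega>) < t} \<le> emeasure lborel {x\<in>\<Omega>. infdist x (frontier \<Omega>) < t}"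
      using m infdist_frontier_le_complement[OF _ comp] by (intro emeasure_mono) force+
    also have "\<dots> \<le> ennreal (40 ^ DIM(real ^ 'n) * layer_const DIM(real ^ 'n) * (c0 * R ^ (CARD('n) - 1)) * t)"
      using level_sets c0 R(1) t by (intro boundary_layer_measure domain(1) front) auto
    finally show ?thesis by (simp add: C_def)
  qed
  define c where "c = frac_const CARD('n) s"
  have c: "c > 0" unfolding c_def by (rule frac_const_pos[OF s])
  \<comment> \<open>With this factor the layer bound \<open>C * \<delta>\<close> equals
    \<open>M * q\<close> for \<open>q = real k powr (- 1 / N) / 2\<close>, which is at most
    \<open>1 / 2\<close>; the squared norm of the cutoff is then at least \<open>M / 2\<close> for
    every \<open>k\<close>.\<close>
  define \<epsilon> where "\<epsilon> = M / (2 * C)"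
  have \<epsilon>: "\<epsilon> > 0" using M C by (simp add: \<epsilon>_def)
  define K where "K = 10 * (4 * C + 2 * M) * 2 powr (N / 2) / c"
  have K: "K > 0" using C M c by (simp add: K_def)
  define p where "p = 2 * s / N"
  have p: "0 \<le> p" "p \<le> 2"
  proof -
    have "2 * s / N \<le> 2 * s / 1" using N s by (intro divide_left_mono) auto
    then show "0 \<le> p" "p \<le> 2" using s N by (auto simp: p_def)
  qed
  define A where "A = (2 * pi) powr (2 * s) * N / (N + 2 * s) * (\<omega> * M) powr (- p)"
  have A: "A > 0" using N s \<omega> M by (simp add: A_def)
  \<comment> \<open>\<open>3 * A\<close> comes from the Weyl coefficient times
    \<open>6 * q = 3 * real k powr (- 1 / N)\<close>; the second part bounds
    \<open>c * W / (2 * X)\<close> through \<open>X \<ge> M / 2\<close>.\<close>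
  define c1 where "c1 = 3 * A + c * K * \<epsilon> powr (- s) / M"
  have c1: "c1 > 0" using A c K \<epsilon> M by (simp add: c1_def add_pos_pos)
  have main: "(\<Sum>i=1..k. lam i) \<le> A * real k powr (1 + p) + c1 * real k powr (1 + s / N)" if k: "1 \<le> k" for k :: nat
  proof -
    have k0: "real k \<ge> 1" using k by simp
    define \<delta> where "\<delta> = \<epsilon> * real k powr (- 1 / N)"
    have d: "\<delta> > 0" using \<epsilon> k0 by (simp add: \<delta>_def)
    define w where "w = cutoff \<Omega> \<delta>"
    have w[measurable]: "w \<in> borel_measurable borel" unfolding w_def by measurable
    have wb: "0 \<le> w x" "w x \<le> 1" for x using cutoff_bounds(1)[OF d] cutoff_bounds(2) by (auto simp: w_def)
    have w0: "w x = 0" if "x \<notin> \<Omega>" for x using that by (simp add: w_def cutoff_outside)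
    define X where "X = (LINT x|lborel. (w x)^2)"
    define q where "q = real k powr (- 1 / N) / 2"
    have q: "0 \<le> q" "q \<le> 1 / 2" "C * \<delta> = M * q"
    proof -
      have "real k powr (- 1 / N) \<le> real k powr 0" using k0 N by (intro powr_mono) auto
      then show "0 \<le> q" "q \<le> 1 / 2" using k0 by (auto simp: q_def)
      show "C * \<delta> = M * q" using C by (simp add: \<delta>_def \<epsilon>_def q_def)
    qed
    have X_bounds: "M * (1 - q) \<le> X"
    proof -
      define L where "L = {x\<in>\<Omega>. infdist x (- \<Omega>) < \<delta>}"
      have L_eq: "L = \<Omega> \<inter> {x. infdist x (- \<Omega>) < \<delta>}" by (auto simp: L_def)
      have L[measurable]: "L \<in> sets borel" unfolding L_eq using domain(1)
        by (intro sets.Int borel_open open_Collect_less continuous_intros) auto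
      have Lm: "emeasure lborel L \<le> ennreal (C * \<delta>)" unfolding L_def by (rule layer[OF d])
      have iO: "integrable lborel (indicator \<Omega> :: real ^ 'n \<Rightarrow> real)" by (simp add: M_eq)
      have iL: "integrable lborel (indicator L :: real ^ 'n \<Rightarrow> real)"
        using le_less_trans[OF Lm] by simp
      have wle: "(w x)^2 \<le> indicator \<Omega> x" for x
        using w0[of x] wb[of x] by (cases "x \<in> \<Omega>") (auto simp: power_le_one)
      have w2: "integrable lborel (\<lambda>x. (w x)^2)"
        by (rule Bochner_Integration.integrable_bound[OF iO]) (use wle in auto)
      have "measure lborel L \<le> M * q"
        using Lm C d unfolding q(3)[symmetric] by (simp add: measure_def enn2real_leI)
      then have "M * (1 - q) \<le> measure lborel \<Omega> - measure lborel L"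
        by (simp add: M_def algebra_simps)
      also have "\<dots> = (LINT x|lborel. indicator \<Omega> x - indicator L x)"
        using iO iL by (subst Bochner_Integration.integral_diff) auto
      also have "\<dots> \<le> X"
        unfolding X_def
      proof (rule integral_mono)
        show "integrable lborel (\<lambda>x. indicator \<Omega> x - indicator L x :: real)" using iO iL by (rule Bochner_Integration.integrable_diff)
        fix x
        \<comment> \<open>At depth \<open>\<delta>\<close> or more the cutoff is 1, so only the
          layer can reduce the norm.\<close>
        show "indicator \<Omega> x - indicator L x \<le> (w x)^2"
          using d by (cases "x \<in> \<Omega> \<and> x \<notin> L") (auto simp: L_def w_def cutoff_def indicator_def)
      qed (rule w2)
      finally show ?thesis .
    qed
    have half: "M / 2 \<le> X"
    proof -
      have "M * (1 / 2) \<le> M * (1 - q)" using M q by (intro mult_left_mono) auto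
      then show ?thesis using X_bounds by simp
    qed
    then have X: "X > 0" using M by linarith
    define W where "W = K * \<delta> powr (- s)"
    have W0: "W \<ge> 0" using K by (simp add: W_def)
    have W: "energy s w \<le> ennreal W"
      using energy_le_of_translation[OF s d w _ cutoff_translation_bound[OF domain(1) d _ M_eq _ layer, folded w_def]] C M
      by (simp add: W_def K_def N_def c_def)
    \<comment> \<open>The solution of the volume condition in
      \<open>eigenvalue_sum_le\<close>.\<close>
    define r where "r = 2 * pi * (real k / (\<omega> * X)) powr (1 / N)"
    have r: "r > 0" using k0 \<omega> X by (simp add: r_def)
    have "((real k / (\<omega> * X)) powr (1 / N)) ^ CARD('n) = real k / (\<omega> * X)"
      using k0 \<omega> X N by (simp add: powr_realpow[symmetric] powr_powr N_def)
    then have rX: "unit_ball_vol CARD('n) * r ^ CARD('n) * X = (2 * pi) ^ CARD('n) * real k"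
      using \<omega> X unfolding r_def power_mult_distrib by (simp add: \<omega>_def[symmetric] N_def[symmetric])
    have "(\<Sum>i=1..k. lam i) \<le> real k * (N / (N + 2 * s) * r powr (2 * s) + c * W / (2 * X))"
      unfolding N_def c_def
      by (rule eigenvalue_sum_le[OF s domain(4) _ lam k w _ w0 W W0 X_def X r rX]) (use wb in \<open>auto simp: abs_le_iff intro: order_trans\<close>)
    also have "\<dots> \<le> A * real k powr (1 + p) + c1 * real k powr (1 + s / N)"
    proof -
      have "r powr (2 * s) = (2 * pi) powr (2 * s) * (real k / (\<omega> * X)) powr p"
        using k0 \<omega> X by (simp add: r_def powr_mult powr_powr p_def)
      also have "(real k / (\<omega> * X)) powr p = real k powr p * (\<omega> * X) powr (- p)"
        using k0 \<omega> X by (simp add: powr_divide powr_minus_divide)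
      also have "(\<omega> * X) powr (- p) \<le> (\<omega> * (M * (1 - q))) powr (- p)"
        using X_bounds \<omega> M q p by (intro powr_mono2') (auto intro!: mult_left_mono mult_pos_pos)
      also have "(\<omega> * (M * (1 - q))) powr (- p) = (\<omega> * M) powr (- p) * (1 - q) powr (- p)"
        using \<omega> M q by (simp add: powr_mult mult.assoc)
      also have "\<dots> \<le> (\<omega> * M) powr (- p) * (1 + 6 * q)"
        using p q by (intro mult_left_mono powr_neg_one_minus_le) auto
      finally have "r powr (2 * s) \<le> (2 * pi) powr (2 * s) * (real k powr p * ((\<omega> * M) powr (- p) * (1 + 6 * q)))"
        by (simp add: mult_left_mono)
      then have "N / (N + 2 * s) * r powr (2 * s) \<le> N / (N + 2 * s) * ((2 * pi) powr (2 * s) * (real k powr p * ((\<omega> * M) powr (- p) * (1 + 6 * q))))"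
        using N s by (intro mult_left_mono) auto
      also have "\<dots> = A * real k powr p + 3 * A * (real k powr p * real k powr (- 1 / N))"
        by (simp add: A_def q_def algebra_simps)
      \<comment> \<open>The exponent is \<open>(2 * s - 1) / N\<close>, at most \<open>s / N\<close>
        because \<open>s < 1\<close>: the volume error is absorbed by the order of the energy
        error.\<close>
      also have "real k powr p * real k powr (- 1 / N) \<le> real k powr (s / N)"
      proof -
        have "p + (- 1 / N) = (2 * s - 1) / N" by (simp add: p_def diff_divide_distrib)
        also have "\<dots> \<le> s / N" using s N by (intro divide_right_mono) auto
        finally show ?thesis using k0 by (simp add: powr_add[symmetric] powr_mono)
      qed
      finally have 1: "N / (N + 2 * s) * r powr (2 * s) \<le> A * real k powr p + 3 * A * real k powr (s / N)"
        using A by simp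
      have "c * W / (2 * X) \<le> c * W / M"
        using half M c W0 by (intro divide_left_mono) auto
      \<comment> \<open>\<open>\<delta> powr (- s)\<close> contributes
        \<open>real k powr (s / N)\<close>, the order of the remainder per eigenvalue.\<close>
      also have "c * W / M = c * K * \<epsilon> powr (- s) / M * real k powr (s / N)"
        using \<epsilon> k0 by (simp add: W_def \<delta>_def powr_mult powr_powr)
      finally have 2: "c * W / (2 * X) \<le> c * K * \<epsilon> powr (- s) / M * real k powr (s / N)" .
      have "real k * (N / (N + 2 * s) * r powr (2 * s) + c * W / (2 * X)) \<le> real k * (A * real k powr p + c1 * real k powr (s / N))"
        using 1 2 by (intro mult_left_mono) (auto simp: c1_def algebra_simps)
      also have "\<dots> = A * real k powr (1 + p) + c1 * real k powr (1 + s / N)"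
        using k0 by (simp add: powr_add algebra_simps)
      finally show ?thesis .
    qed
    finally show ?thesis .
  qed
  show ?thesis
    using c1 main unfolding \<omega>_eq M_def[symmetric] N_def[symmetric] A_def p_def by (intro exI[of _ c1]) (simp add: mult_ac)
qed

end
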